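(* Fix $d,k\ge 2$ and $0<p\le r<1$. Let $H$ be a $d$-regular $k$-uniform linear hypergraph. Let $G_n\sim\mathcal{G}^{(k)}(n,p)$ be the random $k$-uniform hypergraph on $n$ vertices with hyperedge probability $p$. (i) If the point $(r^d,h_p(r))$ lies on the convex minorant of the function $x\mapsto h_p(x^{1/d})$, then $$\lim_{n\to\infty}\frac{1}{\binom nk}\log\mathbb{P}\left(t(H,G_n)\ge r^{e(H)}\right) = -h_p(r),$$ and furthermore, for every $\varepsilon>0$ there exists some constant $C=C(H,\varepsilon,p,r)>0$ such that for all $n$, $$\mathbb{P}\left(\delta_\square(G_n,r)<\varepsilon \,\middle|\, t(H,G_n)\ge r^{e(H)}\right)\ge 1-e^{-Cn^k}.$$ (ii) If the point $(r^d,h_p(r))$ does not lie on the convex minorant of the function $x\mapsto h_p(x^{1/d})$, then $$\lim_{n\to\infty}\frac{1}{\binom nk}\log\mathbb{P}\left(t(H,G_n)\ge r^{e(H)}\right) > -h_p(r),$$ and furthermore, there exist $\varepsilon,C>0$ such that for all $n$, $$\mathbb{P}\left(\inf\{\delta_\square(G_n,s):0\le s\le 1\}>\varepsilon \,\middle|\, t(H,G_n)\ge r^{e(H)}\right)\ge 1-e^{-Cn^k}.$$ In particular, when $d=2$, case (ii) occurs if and only if $p<\left[1+(r^{-1}-1)^{1/(1-2r)}\right]^{-1}$.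
   Context: A $k$-uniform hypergraph $G$ has a finite vertex set $V(G)$ and a set $E(G)$ of hyperedges, each a $k$-element subset of $V(G)$; $e(G)=|E(G)|$. It is $d$-regular if every vertex is in exactly $d$ hyperedges, and linear if every two distinct vertices are contained in at most one common hyperedge. $\mathcal{G}^{(k)}(n,p)$ has $n$ vertices and contains each $k$-element subset as a hyperedge independently with probability $p$. $t(H,G):=\hom(H,G)/|V(G)|^{|V(H)|}$, where $\hom(H,G)$ is the number of maps $V(H)\to V(G)$ carrying hyperedges to hyperedges. For a $k$-uniform hypergraph $G$ and $r\in[0,1]$, $\delta_\square(G,r):=\sup_{A_1,\dots,A_k\subset V(G)}\frac{1}{|V(G)|^k}\big|e_G(A_1,\dots,A_k)-r|A_1|\cdots|A_k|\big|$, where $e_G(A_1,\dots,A_k)$ is the number of tuples $(a_1,\dots,a_k)\in A_1\times\cdots\times A_k$ with $\{a_1,\dots,a_k\}\in E(G)$. For $p\in(0,1)$, $x\in[0,1]$, $h_p(x):=x\log\frac xp+(1-x)\log\frac{1-x}{1-p}$ (with $0\log0=0$). The convex minorant of a function on $[0,1]$ is the largest convex function on $[0,1]$ that is pointwise at most that function. For $r=1/2$ the expression $(r^{-1}-1)^{1/(1-2r)}$ is interpreted as its limit $e^2$ as $r\to1/2$.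
   Formalization: In (i) the conditional bound is stated for all sufficiently large n (for fixed n it fails once ε ≤ r/n^k, as δ(G,r) ≥ r/n^k always); in (ii) it is for all n where the conditioning event has positive probability; H is assumed to have at least one vertex. *)

theory Defs
  imports "HOL-Probability.Probability" "HOL-Real_Asymp.Real_Asymp"
begin

record 'a hypergraph =
  verts :: "'a set"
  hedges :: "'a set set"

definition uniform_hypergraph :: "nat \<Rightarrow> 'a hypergraph \<Rightarrow> bool" where
  "uniform_hypergraph k G \<longleftrightarrow>
     finite (verts G) \<and> (\<forall>e\<in>hedges G. e \<subseteq> verts G \<and> card e = k)"

definition regular_hypergraph :: "nat \<Rightarrow> 'a hypergraph \<Rightarrow> bool" where
  "regular_hypergraph d G \<longleftrightarrow> (\<forall>v\<in>verts G. card {e \<in> hedges G. v \<in> e} = d)"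

definition linear_hypergraph :: "'a hypergraph \<Rightarrow> bool" where
  "linear_hypergraph G \<longleftrightarrow>
     (\<forall>u\<in>verts G. \<forall>v\<in>verts G. u \<noteq> v \<longrightarrow> card {e \<in> hedges G. u \<in> e \<and> v \<in> e} \<le> 1)"

definition hom_count :: "'a hypergraph \<Rightarrow> 'b hypergraph \<Rightarrow> nat" where
  "hom_count H G = card {\<phi> \<in> verts H \<rightarrow>\<^sub>E verts G. \<forall>e\<in>hedges H. \<phi> ` e \<in> hedges G}"

definition hom_density :: "'a hypergraph \<Rightarrow> 'b hypergraph \<Rightarrow> real" where
  "hom_density H G = real (hom_count H G) / real (card (verts G)) ^ card (verts H)"

text \<open>The \<open>k\<close> vertex sets \<open>A\<^sub>1, \<dots>, A\<^sub>k\<close> are indexed by \<open>{..<k}\<close>; likewise for tuples of vertices.\<close>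

definition edge_tuples :: "nat \<Rightarrow> 'a hypergraph \<Rightarrow> (nat \<Rightarrow> 'a set) \<Rightarrow> nat" where
  "edge_tuples k G A = card {a \<in> PiE {..<k} A. a ` {..<k} \<in> hedges G}"

definition cut_dist :: "nat \<Rightarrow> 'a hypergraph \<Rightarrow> real \<Rightarrow> real" where
  "cut_dist k G r =
     (SUP A \<in> {..<k} \<rightarrow>\<^sub>E Pow (verts G).
        \<bar>real (edge_tuples k G A) - r * (\<Prod>i<k. real (card (A i)))\<bar> / real (card (verts G)) ^ k)"

definition random_hypergraph :: "nat \<Rightarrow> nat \<Rightarrow> real \<Rightarrow> nat hypergraph pmf" where
  "random_hypergraph k n p =
     (let K = {e. e \<subseteq> {..<n} \<and> card e = k}
      in map_pmf (\<lambda>\<omega>. \<lparr>verts = {..<n}, hedges = {e \<in> K. \<omega> e}\<rparr>)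
           (Pi_pmf K False (\<lambda>_. bernoulli_pmf p)))"

text \<open>The convention \<open>0 log 0 = 0\<close> holds automatically, since \<open>0 * y = 0\<close>.\<close>

definition rel_entropy :: "real \<Rightarrow> real \<Rightarrow> real" where
  "rel_entropy p x = x * ln (x / p) + (1 - x) * ln ((1 - x) / (1 - p))"

text \<open>
  The largest convex minorant is obtained as a pointwise supremum; the lemmas below show that, for
  functions bounded below, it is indeed convex, below \<open>f\<close> and above every other convex minorant.
\<close>

definition convex_minorant :: "(real \<Rightarrow> real) \<Rightarrow> real \<Rightarrow> real" where
  "convex_minorant f x =
     (SUP g \<in> {g. convex_on {0..1} g \<and> (\<forall>y\<in>{0..1}. g y \<le> f y)}. g x)"

lemma convex_minorant_upper:
  assumes "convex_on {0..1} g" "\<And>y. y \<in> {0..1} \<Longrightarrow> g y \<le> f y" "x \<in> {0..1}"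
  shows "g x \<le> convex_minorant f x"
  unfolding convex_minorant_def
  by (rule cSUP_upper) (use assms in \<open>auto intro!: bdd_aboveI[of _ "f x"]\<close>)

lemma convex_minorant_least:
  assumes "\<And>y. y \<in> {0..1} \<Longrightarrow> b \<le> f y"
    and "\<And>g. convex_on {0..1} g \<Longrightarrow> (\<And>y. y \<in> {0..1} \<Longrightarrow> g y \<le> f y) \<Longrightarrow> g x \<le> c"
  shows "convex_minorant f x \<le> c"
  unfolding convex_minorant_def
proof (rule cSUP_least)
  have "(\<lambda>_. b) \<in> {g. convex_on {0..1} g \<and> (\<forall>y\<in>{0..1}. g y \<le> f y)}"
    using assms(1) by (auto simp: convex_on_def algebra_simps simp flip: distrib_right)
  then show "{g. convex_on {0..1} g \<and> (\<forall>y\<in>{0..1}. g y \<le> f y)} \<noteq> {}" by blast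
qed (use assms(2) in auto)

lemma convex_minorant_le:
  assumes "\<And>y. y \<in> {0..1} \<Longrightarrow> b \<le> f y" "x \<in> {0..1}"
  shows "convex_minorant f x \<le> f x"
  using assms by (intro convex_minorant_least[of b]) auto

lemma convex_on_convex_minorant:
  assumes b: "\<And>y. y \<in> {0..1} \<Longrightarrow> b \<le> f y"
  shows "convex_on {0..1} (convex_minorant f)"
proof (rule convex_onI)
  fix t x y :: real
  assume t: "0 < t" "t < 1" and xy: "x \<in> {0..1}" "y \<in> {0..1}"
  show "convex_minorant f ((1 - t) *\<^sub>R x + t *\<^sub>R y)
          \<le> (1 - t) * convex_minorant f x + t * convex_minorant f y"
  proof (rule convex_minorant_least[of b])
    fix g assume g: "convex_on {0..1} g" "\<And>y. y \<in> {0..1} \<Longrightarrow> g y \<le> f y"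
    have "g ((1 - t) *\<^sub>R x + t *\<^sub>R y) \<le> (1 - t) * g x + t * g y"
      using convex_onD[OF g(1), of t x y] t xy by simp
    also have "\<dots> \<le> (1 - t) * convex_minorant f x + t * convex_minorant f y"
      using t xy g by (intro add_mono mult_left_mono convex_minorant_upper) auto
    finally show "g ((1 - t) *\<^sub>R x + t *\<^sub>R y)
          \<le> (1 - t) * convex_minorant f x + t * convex_minorant f y" .
  qed (rule b)
qed simp

definition threshold_base :: "real \<Rightarrow> real" where
  "threshold_base r = (if r = 1/2 then exp 2 else (inverse r - 1) powr (1 / (1 - 2 * r)))"

lemma threshold_base_half: "(threshold_base \<longlongrightarrow> threshold_base (1/2)) (at (1/2))"
proof -
  have "((\<lambda>r::real. (inverse r - 1) powr (1 / (1 - 2 * r))) \<longlongrightarrow> exp 2) (at (1/2))"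
    by real_asymp
  moreover have "eventually (\<lambda>r. (inverse r - 1) powr (1 / (1 - 2 * r)) = threshold_base r) (at (1/2))"
    unfolding threshold_base_def eventually_at by (auto intro: exI[of _ 1])
  ultimately have "(threshold_base \<longlongrightarrow> exp 2) (at (1/2))"
    by (rule Lim_transform_eventually)
  then show ?thesis by (simp add: threshold_base_def)
qed

end

theory Submission
  imports Defs "HOL-Probability.Hoeffding"
begin

text \<open>
  The structured approximations of a random graph, given by conditional expectations on the algebras
  generated by boundedly many cut tests, are only \<open>exp (o (n\<^sup>k))\<close> in number; the probability of
  seeing the approximation \<open>w\<close> is at most \<open>exp (- I(w))\<close>, where \<open>I\<close> sums \<open>h\<^sub>p\<close> over all
  \<open>k\<close>-subsets. Conversely, sampling from \<open>w\<close> costs \<open>I(w)\<close> and stays cut-close to \<open>w\<close> by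
  Hoeffding's inequality. As homomorphism densities of linear hypergraphs are continuous in the cut
  norm, the upper tail is governed by minimising \<open>I\<close> subject to a density constraint, and blowing up
  near-minimisers shows that the limit exists.

  By Finner's inequality the mean of \<open>w\<^sup>d\<close> is at least about \<open>r\<^sup>d\<close> for admissible \<open>w\<close>, so a
  supporting line of \<open>x \<mapsto> h\<^sub>p(x\<^bsup>1/d\<^esup>)\<close> at \<open>r\<^sup>d\<close> gives \<open>I(w) \<ge> h\<^sub>p(r)\<close> on average; such a
  line touches the graph elsewhere on one side of \<open>r\<^sup>d\<close> at most, which yields stability. If there
  is no supporting line, changing the weights at a small set of vertices to the two ends of a chord
  below the graph raises the density and lowers the cost. For \<open>d = 2\<close> the supporting line condition
  is the optimal-constant Pinsker inequality \<open>h\<^sub>r(u) \<ge> c(r) (u - r)\<^sup>2\<close>, tight at \<open>u = 1 - r\<close>.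
\<close>

section \<open>Product Bernoulli measures on edge sets\<close>

text \<open>A count of structured approximations is useful only if the probability of each is
  controlled up to \<open>exp (o (n ^ k))\<close>, and \<open>rel_entropy p\<close> has infinite
  slope at \<open>0\<close> and \<open>1\<close>, so weights may not be rounded. Conditional
  expectations avoid rounding: the approximation is fixed by its tests and one edge count per atom,
  and the likelihood ratio depends on these counts only. The tests are the boxes of the cut norm,
  \<open>2 ^ (n * k)\<close> of them; \<open>k \<ge> 2\<close> makes \<open>n\<close> negligible
  against \<open>n ^ k\<close>, here and in the union bound of the converse. The converse needs a
  density strictly above the threshold, whereas the upper bound yields one slightly below it. Moving
  every weight a little towards \<open>1\<close> closes this gap at small cost. It makes the
  normalised logarithms almost monotone, so that they converge without passing to a space of limit
  objects. Once the rate is known to exist, conditioning reduces to showing that the bad part of the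
  upper tail has a strictly smaller exponent; the upper bound is therefore stated for arbitrary
  subevents.\<close>

definition bern :: "'e set \<Rightarrow> ('e \<Rightarrow> real) \<Rightarrow> 'e set \<Rightarrow> real" where
  "bern K w E = (\<Prod>e\<in>E. w e) * (\<Prod>e\<in>K - E. 1 - w e)"

text \<open>Events are arbitrary families, cut down to \<open>Pow K\<close> only inside the sum, so
  that unions and complements need no ground set.\<close>

definition bprob :: "'e set \<Rightarrow> ('e \<Rightarrow> real) \<Rightarrow> 'e set set \<Rightarrow> real" where
  "bprob K w A = sum (bern K w) (Pow K \<inter> A)"

lemma bern_nonneg:
  assumes "\<And>e. e \<in> K \<Longrightarrow> w e \<in> {0..1}" "E \<subseteq> K"
  shows "0 \<le> bern K w E"
  unfolding bern_def using assms by (intro mult_nonneg_nonneg prod_nonneg) auto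

lemma bern_pos:
  assumes "\<And>e. e \<in> K \<Longrightarrow> w e \<in> {0<..<1}" "E \<subseteq> K"
  shows "0 < bern K w E"
  unfolding bern_def using assms by (intro mult_pos_pos prod_pos) auto

text \<open>When the product over \<open>K\<close> is expanded, the subset \<open>E\<close> records
  where the first summand is chosen. Expectations of functions that factor over edges are instances
  of this.\<close>

lemma sum_bern_prod:
  assumes "finite K"
  shows "(\<Sum>E\<in>Pow K. bern K w E * ((\<Prod>e\<in>E. a e) * (\<Prod>e\<in>K - E. b e)))
           = (\<Prod>e\<in>K. w e * a e + (1 - w e) * b e)"
  by (subst prod_add[OF assms]) (simp add: bern_def prod.distrib mult_ac)

lemma sum_bern: "finite K \<Longrightarrow> (\<Sum>E\<in>Pow K. bern K w E) = 1"
  using sum_bern_prod[of K w "\<lambda>_. 1" "\<lambda>_. 1"] by simp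

lemma sum_bern_single:
  assumes "finite K" "e \<in> K"
  shows "(\<Sum>E\<in>Pow K. bern K w E * (if e \<in> E then a else b)) = w e * a + (1 - w e) * b"
proof -
  let ?a = "\<lambda>e'. if e' = e then a else 1" and ?b = "\<lambda>e'. if e' = e then b else 1"
  have "(\<Prod>e\<in>E. ?a e) * (\<Prod>e\<in>K - E. ?b e) = (if e \<in> E then a else b)" if "E \<subseteq> K" for E
  proof -
    have "finite E" "finite (K - E)" using that assms(1) finite_subset by auto
    then show ?thesis using that assms by (auto simp: prod.delta)
  qed
  then have "(\<Sum>E\<in>Pow K. bern K w E * (if e \<in> E then a else b))
      = (\<Sum>E\<in>Pow K. bern K w E * ((\<Prod>e\<in>E. ?a e) * (\<Prod>e\<in>K - E. ?b e)))"
    by (intro sum.cong) auto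
  also have "\<dots> = (\<Prod>e'\<in>K. if e' = e then w e * a + (1 - w e) * b else 1)"
    unfolding sum_bern_prod[OF assms(1)] by (intro prod.cong) auto
  also have "\<dots> = w e * a + (1 - w e) * b"
    using assms by (simp add: prod.delta)
  finally show ?thesis .
qed

lemma bprob_nonneg:
  assumes "\<And>e. e \<in> K \<Longrightarrow> w e \<in> {0..1}"
  shows "0 \<le> bprob K w A"
  unfolding bprob_def by (intro sum_nonneg bern_nonneg assms) auto

lemma bprob_mono:
  assumes "finite K" "\<And>e. e \<in> K \<Longrightarrow> w e \<in> {0..1}" "\<And>E. E \<subseteq> K \<Longrightarrow> E \<in> A \<Longrightarrow> E \<in> B"
  shows "bprob K w A \<le> bprob K w B"
  unfolding bprob_def using assms by (intro sum_mono2) (auto intro!: bern_nonneg)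

lemma bprob_UNIV: "finite K \<Longrightarrow> bprob K w UNIV = 1"
  by (simp add: bprob_def sum_bern)

lemma bprob_le_1:
  assumes "finite K" "\<And>e. e \<in> K \<Longrightarrow> w e \<in> {0..1}"
  shows "bprob K w A \<le> 1"
  using bprob_mono[OF assms, where A = A and B = UNIV] bprob_UNIV[OF assms(1)] by auto

lemma bprob_Compl:
  assumes "finite K"
  shows "bprob K w (- A) = 1 - bprob K w A"
proof -
  have "sum (bern K w) (Pow K) = sum (bern K w) (Pow K \<inter> A) + sum (bern K w) (Pow K \<inter> - A)"
    using assms by (subst sum.union_disjoint[symmetric]) (auto intro!: sum.cong)
  then show ?thesis using sum_bern[OF assms, of w] by (simp add: bprob_def)
qed

lemma bprob_UN_le:
  assumes "finite K" "\<And>e. e \<in> K \<Longrightarrow> w e \<in> {0..1}" "finite I"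
  shows "bprob K w (\<Union>i\<in>I. A i) \<le> (\<Sum>i\<in>I. bprob K w (A i))"
proof -
  have "sum (bern K w) (\<Union>i\<in>I. Pow K \<inter> A i) \<le> (\<Sum>i\<in>I. sum (bern K w) (Pow K \<inter> A i))"
    using \<open>finite I\<close>
  proof (induction I rule: finite_induct)
    case (insert i I)
    have "sum (bern K w) (Pow K \<inter> A i \<union> (\<Union>i\<in>I. Pow K \<inter> A i))
        \<le> sum (bern K w) (Pow K \<inter> A i) + sum (bern K w) (\<Union>i\<in>I. Pow K \<inter> A i)"
    proof -
      have "0 \<le> sum (bern K w) ((Pow K \<inter> A i) \<inter> (\<Union>i\<in>I. Pow K \<inter> A i))"
        by (intro sum_nonneg bern_nonneg assms) auto
      then show ?thesis
        using assms(1) insert by (subst sum_Un) auto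
    qed
    with insert show ?case by simp
  qed simp
  then show ?thesis by (simp add: bprob_def)
qed

section \<open>Exponential moments and concentration\<close>

lemma bernoulli_mgf_le:
  fixes w t :: real
  assumes "w \<in> {0..1}"
  shows "w * exp (t * (1 - w)) + (1 - w) * exp (- t * w) \<le> exp (t\<^sup>2 / 8)"
proof -
  have *: "w * exp (t * (1 - w)) + (1 - w) * exp (- t * w) \<le> exp (t\<^sup>2 / 8)"
    if "w \<in> {0..1}" "t \<ge> 0" for w t :: real
  proof -
    have pos: "0 < 1 + w * (exp t - 1)"
      using that by (intro add_pos_nonneg mult_nonneg_nonneg) auto
    have "w * exp (t * (1 - w)) + (1 - w) * exp (- t * w) = exp (- t * w) * (1 + w * (exp t - 1))"
    proof -
      have "exp (t * (1 - w)) = exp (- t * w) * exp t" by (simp add: algebra_simps flip: exp_add)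
      then show ?thesis by (simp only:) (simp add: algebra_simps)
    qed
    also have "\<dots> = exp (- t * w + ln (1 + w * (exp t - 1)))"
      unfolding exp_add using pos by simp
    also have "\<dots> \<le> exp (t\<^sup>2 / 8)"
      using Hoeffdings_lemma_aux[of t w] that by simp
    finally show ?thesis .
  qed
  show ?thesis
  proof (cases "t \<ge> 0")
    \<comment> \<open>For negative \<open>t\<close> the two outcomes are exchanged: \<open>w\<close>
      becomes \<open>1 - w\<close> and \<open>t\<close> becomes \<open>- t\<close>.\<close>
    case False
    then have "(1 - w) * exp (- t * (1 - (1 - w))) + (1 - (1 - w)) * exp (- (- t) * (1 - w)) \<le> exp ((- t)\<^sup>2 / 8)"
      using assms by (intro *) auto
    then show ?thesis by (simp add: add.commute)
  qed (use *[of w t] assms in simp)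
qed

lemma bern_mgf_le:
  assumes "finite K" "\<And>e. e \<in> K \<Longrightarrow> w e \<in> {0..1}"
  shows "(\<Sum>E\<in>Pow K. bern K w E * exp (\<Sum>e\<in>K. c e * (of_bool (e \<in> E) - w e)))
           \<le> exp (\<Sum>e\<in>K. (c e)\<^sup>2 / 8)"
proof -
  have "exp (\<Sum>e\<in>K. c e * (of_bool (e \<in> E) - w e))
     = (\<Prod>e\<in>E. exp (c e * (1 - w e))) * (\<Prod>e\<in>K - E. exp (- c e * w e))" if "E \<subseteq> K" for E
  proof -
    have "(\<Sum>e\<in>K. c e * (of_bool (e \<in> E) - w e))
        = (\<Sum>e\<in>E. c e * (of_bool (e \<in> E) - w e)) + (\<Sum>e\<in>K-E. c e * (of_bool (e \<in> E) - w e))"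
      using sum.subset_diff[OF that assms(1), of "\<lambda>e. c e * (of_bool (e \<in> E) - w e)"] by linarith
    moreover have "finite E" using that assms(1) by (rule finite_subset)
    ultimately show ?thesis using assms(1) by (simp add: exp_add exp_sum)
  qed
  then have "(\<Sum>E\<in>Pow K. bern K w E * exp (\<Sum>e\<in>K. c e * (of_bool (e \<in> E) - w e)))
     = (\<Sum>E\<in>Pow K. bern K w E * ((\<Prod>e\<in>E. exp (c e * (1 - w e))) * (\<Prod>e\<in>K - E. exp (- c e * w e))))"
    by (intro sum.cong) auto
  also have "\<dots> = (\<Prod>e\<in>K. w e * exp (c e * (1 - w e)) + (1 - w e) * exp (- c e * w e))"
    by (rule sum_bern_prod[OF assms(1)])
  also have "\<dots> \<le> (\<Prod>e\<in>K. exp ((c e)\<^sup>2 / 8))"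
    using assms by (intro prod_mono conjI bernoulli_mgf_le add_nonneg_nonneg mult_nonneg_nonneg) auto
  also have "\<dots> = exp (\<Sum>e\<in>K. (c e)\<^sup>2 / 8)"
    using assms(1) by (simp add: exp_sum)
  finally show ?thesis .
qed

lemma bern_chernoff:
  assumes "finite K" "\<And>e. e \<in> K \<Longrightarrow> w e \<in> {0..1}" "\<And>e. e \<in> K \<Longrightarrow> \<bar>s e\<bar> \<le> b"
    "\<delta> > 0" "b > 0" "real (card K) \<le> N" "N > 0"
  shows "bprob K w {E. (\<Sum>e\<in>K. s e * (of_bool (e \<in> E) - w e)) \<ge> \<delta>} \<le> exp (- 2 * \<delta>\<^sup>2 / (b\<^sup>2 * N))"
proof -
  \<comment> \<open>Minimiser of the exponent
    \<open>- t * \<delta> + t\<^sup>2 * b\<^sup>2 * N / 8\<close> that the moment bound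
    produces.\<close>
  define t where "t = 4 * \<delta> / (b\<^sup>2 * N)"
  have t: "t > 0" using assms by (simp add: t_def)
  let ?X = "\<lambda>E. \<Sum>e\<in>K. s e * (of_bool (e \<in> E) - w e)"
  have "bprob K w {E. ?X E \<ge> \<delta>}
      \<le> (\<Sum>E\<in>Pow K \<inter> {E. ?X E \<ge> \<delta>}. bern K w E * exp (t * (?X E - \<delta>)))"
    unfolding bprob_def
  proof (intro sum_mono)
    fix E assume E: "E \<in> Pow K \<inter> {E. ?X E \<ge> \<delta>}"
    then have "bern K w E * 1 \<le> bern K w E * exp (t * (?X E - \<delta>))"
      using t by (intro mult_left_mono bern_nonneg assms) auto
    then show "bern K w E \<le> bern K w E * exp (t * (?X E - \<delta>))" by simp
  qed
  also have "\<dots> \<le> (\<Sum>E\<in>Pow K. bern K w E * exp (t * (?X E - \<delta>)))"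
    using assms by (intro sum_mono2) (auto intro!: mult_nonneg_nonneg bern_nonneg)
  also have "\<dots> = exp (- t * \<delta>) * (\<Sum>E\<in>Pow K. bern K w E * exp (\<Sum>e\<in>K. (t * s e) * (of_bool (e \<in> E) - w e)))"
  proof -
    have "bern K w E * exp (t * (?X E - \<delta>))
        = exp (- t * \<delta>) * (bern K w E * exp (\<Sum>e\<in>K. (t * s e) * (of_bool (e \<in> E) - w e)))" for E
    proof -
      have "t * (?X E - \<delta>) = - t * \<delta> + (\<Sum>e\<in>K. (t * s e) * (of_bool (e \<in> E) - w e))"
        by (simp add: sum_distrib_left mult.assoc right_diff_distrib)
      then show ?thesis by (simp only: exp_add mult.left_commute)
    qed
    then show ?thesis by (simp only: sum_distrib_left)
  qed
  also have "\<dots> \<le> exp (- t * \<delta>) * exp (\<Sum>e\<in>K. (t * s e)\<^sup>2 / 8)"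
    by (intro mult_left_mono bern_mgf_le assms) auto
  also have "\<dots> \<le> exp (- t * \<delta>) * exp (t\<^sup>2 * b\<^sup>2 * N / 8)"
  proof -
    have "(\<Sum>e\<in>K. (t * s e)\<^sup>2 / 8) \<le> (\<Sum>e\<in>K. t\<^sup>2 * b\<^sup>2 / 8)"
    proof (intro sum_mono)
      fix e assume "e \<in> K"
      then have "(s e)\<^sup>2 \<le> b\<^sup>2" using assms(3,5) by (simp add: abs_le_square_iff[symmetric])
      then have "t\<^sup>2 * (s e)\<^sup>2 \<le> t\<^sup>2 * b\<^sup>2" by (intro mult_left_mono) auto
      then show "(t * s e)\<^sup>2 / 8 \<le> t\<^sup>2 * b\<^sup>2 / 8" by (simp add: power_mult_distrib)
    qed
    also have "\<dots> = t\<^sup>2 * b\<^sup>2 / 8 * real (card K)" by simp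
    also have "\<dots> \<le> t\<^sup>2 * b\<^sup>2 / 8 * N" using assms by (intro mult_left_mono) auto
    finally show ?thesis by simp
  qed
  also have "\<dots> = exp (- 2 * \<delta>\<^sup>2 / (b\<^sup>2 * N))"
    unfolding t_def exp_add[symmetric] using assms by (simp add: field_simps power2_eq_square)
  finally show ?thesis .
qed

lemma bern_hoeffding:
  assumes "finite K" "\<And>e. e \<in> K \<Longrightarrow> w e \<in> {0..1}" "\<And>e. e \<in> K \<Longrightarrow> \<bar>s e\<bar> \<le> b"
    "\<delta> > 0" "b > 0" "real (card K) \<le> N" "N > 0"
  shows "bprob K w {E. \<bar>\<Sum>e\<in>K. s e * (of_bool (e \<in> E) - w e)\<bar> \<ge> \<delta>} \<le> 2 * exp (- 2 * \<delta>\<^sup>2 / (b\<^sup>2 * N))"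
proof -
  let ?A = "\<lambda>s. {E. (\<Sum>e\<in>K. s e * (of_bool (e \<in> E) - w e)) \<ge> \<delta>}"
  let ?s = "\<lambda>i::bool. if i then s else (\<lambda>e. - s e)"
  have "bprob K w {E. \<bar>\<Sum>e\<in>K. s e * (of_bool (e \<in> E) - w e)\<bar> \<ge> \<delta>} \<le> bprob K w (\<Union>i\<in>UNIV. ?A (?s i))"
  proof (rule bprob_mono[OF assms(1,2)])
    fix E assume "E \<in> {E. \<bar>\<Sum>e\<in>K. s e * (of_bool (e \<in> E) - w e)\<bar> \<ge> \<delta>}"
    then have "E \<in> ?A (?s True) \<or> E \<in> ?A (?s False)"
      by (auto simp: sum_negf abs_if split: if_splits)
    then show "E \<in> (\<Union>i\<in>UNIV. ?A (?s i))" by blast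
  qed
  also have "\<dots> \<le> (\<Sum>i\<in>UNIV. bprob K w (?A (?s i)))"
    by (rule bprob_UN_le[OF assms(1,2)]) auto
  also have "\<dots> \<le> (\<Sum>i\<in>(UNIV::bool set). exp (- 2 * \<delta>\<^sup>2 / (b\<^sup>2 * N)))"
    by (intro sum_mono bern_chernoff) (use assms in auto)
  finally show ?thesis by (simp add: UNIV_bool)
qed

section \<open>Change of measure\<close>

lemma bern_log_ratio:
  assumes "finite K" "E \<subseteq> K" "\<And>e. e \<in> K \<Longrightarrow> w e \<in> {0..1}" "0 < p" "p < 1" "bern K w E > 0"
  shows "ln (bern K w E / bern K (\<lambda>_. p) E)
           = (\<Sum>e\<in>K. if e \<in> E then ln (w e / p) else ln ((1 - w e) / (1 - p)))"
proof -
  have fE: "finite E" "finite (K - E)" using assms finite_subset by auto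
  \<comment> \<open>Positivity of the mass forces \<open>w e > 0\<close> on \<open>E\<close> and
    \<open>w e < 1\<close> off \<open>E\<close>, so that no logarithm of \<open>0\<close> occurs
    although \<open>w\<close> may take the values \<open>0\<close> and \<open>1\<close>.\<close>
  have nz: "(\<Prod>e\<in>E. w e) \<noteq> 0" "(\<Prod>e\<in>K - E. 1 - w e) \<noteq> 0"
    using assms(6) by (auto simp: bern_def)
  have pos: "w e > 0" if "e \<in> E" for e using nz(1) fE that assms(2,3)
    by (auto simp: prod_zero_iff less_le)
  have pos': "w e < 1" if "e \<in> K - E" for e using nz(2) fE that assms(2,3)
    by (force simp: prod_zero_iff less_le)
  have "bern K w E / bern K (\<lambda>_. p) E = (\<Prod>e\<in>E. w e / p) * (\<Prod>e\<in>K-E. (1 - w e) / (1 - p))"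
    by (simp add: bern_def prod_dividef)
  also have "ln \<dots> = ln (\<Prod>e\<in>E. w e / p) + ln (\<Prod>e\<in>K-E. (1 - w e) / (1 - p))"
    using pos pos' assms by (intro ln_mult_pos prod_pos) auto
  also have "\<dots> = (\<Sum>e\<in>E. ln (w e / p)) + (\<Sum>e\<in>K-E. ln ((1 - w e) / (1 - p)))"
  proof -
    have "ln (\<Prod>e\<in>E. w e / p) = (\<Sum>e\<in>E. ln (w e / p))"
      by (rule ln_prod[OF fE(1)]) (use pos assms(4) in \<open>metis divide_pos_pos less_irrefl\<close>)
    moreover have "ln (\<Prod>e\<in>K-E. (1 - w e) / (1 - p)) = (\<Sum>e\<in>K-E. ln ((1 - w e) / (1 - p)))"
      by (rule ln_prod[OF fE(2)]) (use pos' assms(5) in \<open>metis diff_gt_0_iff_gt divide_pos_pos less_irrefl\<close>)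
    ultimately show ?thesis by simp
  qed
  also have "\<dots> = (\<Sum>e\<in>E. if e \<in> E then ln (w e / p) else ln ((1 - w e) / (1 - p)))
       + (\<Sum>e\<in>K-E. if e \<in> E then ln (w e / p) else ln ((1 - w e) / (1 - p)))"
    by simp
  also have "\<dots> = (\<Sum>e\<in>K. if e \<in> E then ln (w e / p) else ln ((1 - w e) / (1 - p)))"
    using sum.subset_diff[OF assms(2,1), of "\<lambda>e. if e \<in> E then ln (w e / p) else ln ((1 - w e) / (1 - p))"] by linarith
  finally show ?thesis .
qed

text \<open>Tangent-line form of the log-sum inequality, applied with slope \<open>Q(A)/P(A)\<close> on \<open>A\<close>
  and slope \<open>1\<close> off \<open>A\<close>.\<close>

lemma bprob_tilt_lower:
  assumes "finite K" "\<And>e. e \<in> K \<Longrightarrow> w e \<in> {0..1}" "0 < p" "p < 1" "bprob K w A > 0"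
  shows "bprob K (\<lambda>_. p) A > 0"
    and "ln (bprob K (\<lambda>_. p) A) \<ge> ln (bprob K w A) - ((\<Sum>e\<in>K. rel_entropy p (w e)) + 1) / bprob K w A"
proof -
  let ?P = "bern K (\<lambda>_. p)" and ?Q = "bern K w"
  have Ppos: "?P E > 0" if "E \<subseteq> K" for E using that assms by (intro bern_pos) auto
  have Qnn: "?Q E \<ge> 0" if "E \<subseteq> K" for E using that assms by (intro bern_nonneg) auto
  have ne: "Pow K \<inter> A \<noteq> {}" using assms(5) by (auto simp: bprob_def)
  show pos: "bprob K (\<lambda>_. p) A > 0"
    unfolding bprob_def using ne assms(1) by (intro sum_pos Ppos) auto
  let ?L = "\<lambda>E. ?Q E * ln (?Q E / ?P E)"
  \<comment> \<open>As a function of \<open>q\<close>, \<open>q * ln (q / P)\<close> is convex, and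
    the right-hand side is its tangent at \<open>q = \<alpha> * P\<close>.\<close>
  have tangent: "?L E \<ge> ?Q E * ln \<alpha> + ?Q E - \<alpha> * ?P E" if "E \<subseteq> K" "\<alpha> > 0" for E \<alpha>
  proof (cases "?Q E = 0")
    case True
    then show ?thesis using Ppos[OF that(1)] that by simp
  next
    case False
    then have q: "?Q E > 0" using Qnn[OF that(1)] by simp
    have "ln (\<alpha> * ?P E / ?Q E) \<le> \<alpha> * ?P E / ?Q E - 1"
      using q Ppos[OF that(1)] that by (intro ln_le_minus_one) auto
    then have "?Q E * ln (\<alpha> * ?P E / ?Q E) \<le> \<alpha> * ?P E - ?Q E"
      using q by (simp add: field_simps)
    moreover have "ln (\<alpha> * ?P E / ?Q E) = ln \<alpha> - ln (?Q E / ?P E)"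
      using q Ppos[OF that(1)] that by (simp add: ln_div ln_mult_pos)
    ultimately show ?thesis by (simp add: algebra_simps)
  qed
  have D: "(\<Sum>E\<in>Pow K. ?L E) = (\<Sum>e\<in>K. rel_entropy p (w e))"
  proof -
    have "(\<Sum>E\<in>Pow K. ?L E) = (\<Sum>E\<in>Pow K. \<Sum>e\<in>K. ?Q E * (if e \<in> E then ln (w e / p) else ln ((1 - w e) / (1 - p))))"
    proof (intro sum.cong refl)
      fix E assume "E \<in> Pow K"
      then show "?L E = (\<Sum>e\<in>K. ?Q E * (if e \<in> E then ln (w e / p) else ln ((1 - w e) / (1 - p))))"
        using bern_log_ratio[OF assms(1) _ assms(2,3,4), of E] Qnn[of E]
        by (cases "?Q E = 0") (simp_all flip: sum_distrib_left)
    qed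
    also have "\<dots> = (\<Sum>e\<in>K. \<Sum>E\<in>Pow K. ?Q E * (if e \<in> E then ln (w e / p) else ln ((1 - w e) / (1 - p))))"
      by (rule sum.swap)
    also have "\<dots> = (\<Sum>e\<in>K. rel_entropy p (w e))"
      using assms(1) by (intro sum.cong) (auto simp: sum_bern_single rel_entropy_def)
    finally show ?thesis .
  qed
  let ?\<alpha> = "bprob K w A / bprob K (\<lambda>_. p) A"
  have "(\<Sum>E\<in>Pow K \<inter> A. ?L E) \<ge> (\<Sum>E\<in>Pow K \<inter> A. ?Q E * ln ?\<alpha> + ?Q E - ?\<alpha> * ?P E)"
    using assms pos by (intro sum_mono tangent) auto
  also have "(\<Sum>E\<in>Pow K \<inter> A. ?Q E * ln ?\<alpha> + ?Q E - ?\<alpha> * ?P E) = bprob K w A * ln ?\<alpha> + bprob K w A - ?\<alpha> * bprob K (\<lambda>_. p) A"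
    by (simp only: sum.distrib sum_subtractf bprob_def sum_distrib_left sum_distrib_right)
  also have "\<dots> = bprob K w A * ln ?\<alpha>" using pos by simp
  finally have 1: "(\<Sum>E\<in>Pow K \<inter> A. ?L E) \<ge> bprob K w A * ln ?\<alpha>" .
  \<comment> \<open>Off \<open>A\<close> a difference of two probabilities remains, which is at
    least \<open>- 1\<close>. This is the \<open>+ 1\<close> of the statement, negligible after
    division by the number of edges.\<close>
  have "(\<Sum>E\<in>Pow K \<inter> -A. ?L E) \<ge> (\<Sum>E\<in>Pow K \<inter> -A. ?Q E * ln 1 + ?Q E - 1 * ?P E)"
    by (intro sum_mono tangent) auto
  also have "(\<Sum>E\<in>Pow K \<inter> -A. ?Q E * ln 1 + ?Q E - 1 * ?P E) = bprob K w (-A) - bprob K (\<lambda>_. p) (-A)"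
    by (simp add: sum_subtractf bprob_def)
  also have "\<dots> \<ge> - 1"
    using bprob_nonneg[of K w "-A"] bprob_le_1[of K "\<lambda>_. p" "-A"] assms by auto
  finally have 2: "(\<Sum>E\<in>Pow K \<inter> -A. ?L E) \<ge> -1" by simp
  have "(\<Sum>E\<in>Pow K. ?L E) = (\<Sum>E\<in>Pow K \<inter> A. ?L E) + (\<Sum>E\<in>Pow K \<inter> -A. ?L E)"
    using assms(1) by (subst sum.union_disjoint[symmetric]) (auto intro!: sum.cong)
  with 1 2 D have "bprob K w A * ln ?\<alpha> \<le> (\<Sum>e\<in>K. rel_entropy p (w e)) + 1" by linarith
  then have "ln ?\<alpha> \<le> ((\<Sum>e\<in>K. rel_entropy p (w e)) + 1) / bprob K w A"
    using assms(5) by (simp add: field_simps)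
  then show "ln (bprob K (\<lambda>_. p) A) \<ge> ln (bprob K w A) - ((\<Sum>e\<in>K. rel_entropy p (w e)) + 1) / bprob K w A"
    using assms(5) pos by (simp add: ln_div)
qed

section \<open>Weak regularity and the large deviation upper bound\<close>

text \<open>The conditional expectation of \<open>g\<close> given the label \<open>x\<close>, for
  the uniform measure on \<open>K\<close>.\<close>

definition cavg :: "'e set \<Rightarrow> ('e \<Rightarrow> 'x) \<Rightarrow> ('e \<Rightarrow> real) \<Rightarrow> 'e \<Rightarrow> real" where
  "cavg K x g e = sum g {e' \<in> K. x e' = x e} / real (card {e' \<in> K. x e' = x e})"

lemma cavg_range:
  assumes "finite K" "e \<in> K" "\<And>e. e \<in> K \<Longrightarrow> g e \<in> {0..1}"
  shows "cavg K x g e \<in> {0..1}"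
proof -
  let ?C = "{e' \<in> K. x e' = x e}"
  have "card ?C > 0" using assms by (auto simp: card_gt_0_iff)
  moreover have "sum g ?C \<ge> 0" using assms by (intro sum_nonneg) auto
  moreover have "sum g ?C \<le> (\<Sum>e\<in>?C. 1)" using assms by (intro sum_mono) auto
  ultimately show ?thesis by (simp add: cavg_def)
qed

lemma cavg_cong: "x e = x e' \<Longrightarrow> cavg K x g e = cavg K x g e'"
  by (simp add: cavg_def)

text \<open>Averaging over label classes is the orthogonal projection onto the functions of the
  label, hence invisible in a pairing with such a function.\<close>

lemma sum_cavg_mult:
  assumes "finite K" "\<And>e e'. e \<in> K \<Longrightarrow> e' \<in> K \<Longrightarrow> x e = x e' \<Longrightarrow> \<phi> e = \<phi> e'"
  shows "(\<Sum>e\<in>K. cavg K x g e * \<phi> e) = (\<Sum>e\<in>K. g e * \<phi> e)"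
proof -
  have "(\<Sum>e\<in>{e\<in>K. x e = y}. cavg K x g e * \<phi> e) = (\<Sum>e\<in>{e\<in>K. x e = y}. g e * \<phi> e)"
    if "y \<in> x ` K" for y
  proof -
    let ?C = "{e\<in>K. x e = y}"
    obtain e0 where e0: "e0 \<in> K" "x e0 = y" using \<open>y \<in> x ` K\<close> by blast
    have c: "card ?C > 0" using e0 assms(1) by (auto simp: card_gt_0_iff)
    have \<phi>: "\<phi> e = \<phi> e0" if "e \<in> ?C" for e
      by (rule assms(2)) (use that e0 in auto)
    have "(\<Sum>e\<in>?C. cavg K x g e * \<phi> e) = (\<Sum>e\<in>?C. sum g ?C / real (card ?C) * \<phi> e0)"
      using \<phi> by (intro sum.cong) (auto simp: cavg_def)
    also have "\<dots> = sum g ?C * \<phi> e0" using c by simp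
    also have "\<dots> = (\<Sum>e\<in>?C. g e * \<phi> e)"
      unfolding sum_distrib_right using \<phi> by (intro sum.cong) auto
    finally show ?thesis .
  qed
  then show ?thesis
    unfolding sum.image_gen[OF assms(1), of "\<lambda>e. cavg K x g e * \<phi> e" x]
      sum.image_gen[OF assms(1), of "\<lambda>e. g e * \<phi> e" x]
    by (rule sum.cong[OF refl])
qed

text \<open>Pythagoras for the projections to a coarse label \<open>x\<close> and a finer label
  \<open>y\<close>: the energy gained is the squared norm of their difference. The test
  \<open>s\<close> is a function of \<open>y\<close>, so it sees the whole discrepancy in this
  difference, and the Cauchy-Schwarz inequality turns discrepancy into energy.\<close>

lemma cavg_energy_step:
  assumes "finite K" "real (card K) \<le> N" "N > 0" "b > 0" "\<delta> \<ge> 0"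
    and finer: "\<And>e e'. y e = y e' \<Longrightarrow> x e = x e'"
    and meas: "\<And>e e'. y e = y e' \<Longrightarrow> s e = s e'"
    and "\<And>e. e \<in> K \<Longrightarrow> \<bar>s e\<bar> \<le> b"
    and gap: "\<bar>\<Sum>e\<in>K. s e * (g e - cavg K x g e)\<bar> \<ge> \<delta>"
  shows "(\<Sum>e\<in>K. (cavg K y g e)\<^sup>2) \<ge> (\<Sum>e\<in>K. (cavg K x g e)\<^sup>2) + \<delta>\<^sup>2 / (b\<^sup>2 * N)"
proof -
  let ?w = "cavg K x g" and ?v = "cavg K y g"
  have 1: "(\<Sum>e\<in>K. ?v e * ?w e) = (\<Sum>e\<in>K. g e * ?w e)"
    by (rule sum_cavg_mult[OF assms(1)]) (metis finer cavg_cong)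
  have 2: "(\<Sum>e\<in>K. ?w e * ?w e) = (\<Sum>e\<in>K. g e * ?w e)"
    by (rule sum_cavg_mult[OF assms(1)]) (metis cavg_cong)
  have 3: "(\<Sum>e\<in>K. ?v e * s e) = (\<Sum>e\<in>K. g e * s e)"
    by (rule sum_cavg_mult[OF assms(1)]) (metis meas)
  have pyth: "(\<Sum>e\<in>K. (?v e - ?w e)\<^sup>2) = (\<Sum>e\<in>K. (?v e)\<^sup>2) - (\<Sum>e\<in>K. (?w e)\<^sup>2)"
  proof -
    have "(\<Sum>e\<in>K. (?v e - ?w e)\<^sup>2) = (\<Sum>e\<in>K. (?v e)\<^sup>2) + (\<Sum>e\<in>K. (?w e)\<^sup>2) - 2 * (\<Sum>e\<in>K. ?v e * ?w e)"
      by (simp add: power2_diff sum.distrib sum_subtractf sum_distrib_left mult.assoc)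
    with 1 2 show ?thesis by (simp add: power2_eq_square)
  qed
  have "(\<Sum>e\<in>K. s e * (g e - ?w e)) = (\<Sum>e\<in>K. s e * (?v e - ?w e))"
    using 3 by (simp add: right_diff_distrib sum_subtractf mult.commute)
  then have "\<delta>\<^sup>2 \<le> (\<Sum>e\<in>K. s e * (?v e - ?w e))\<^sup>2"
    using gap assms(5) by (metis abs_ge_self abs_le_square_iff abs_of_nonneg)
  also have "\<dots> \<le> (\<Sum>e\<in>K. (s e)\<^sup>2) * (\<Sum>e\<in>K. (?v e - ?w e)\<^sup>2)"
    by (rule Cauchy_Schwarz_ineq_sum)
  also have "\<dots> \<le> (b\<^sup>2 * N) * (\<Sum>e\<in>K. (?v e - ?w e)\<^sup>2)"
  proof (intro mult_right_mono sum_nonneg)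
    have "(\<Sum>e\<in>K. (s e)\<^sup>2) \<le> (\<Sum>e\<in>K. b\<^sup>2)"
    proof (intro sum_mono)
      fix e assume "e \<in> K"
      then show "(s e)\<^sup>2 \<le> b\<^sup>2" using assms(4,8) by (simp add: abs_le_square_iff[symmetric])
    qed
    also have "\<dots> = b\<^sup>2 * real (card K)" by simp
    also have "\<dots> \<le> b\<^sup>2 * N" using assms(2) by (intro mult_left_mono) auto
    finally show "(\<Sum>e\<in>K. (s e)\<^sup>2) \<le> b\<^sup>2 * N" .
  qed auto
  finally have "\<delta>\<^sup>2 / (b\<^sup>2 * N) \<le> (\<Sum>e\<in>K. (?v e - ?w e)\<^sup>2)"
    using assms(3,4) by (simp add: field_simps)
  with pyth show ?thesis by linarith
qed

text \<open>Prepending a test refines the label. With tests valued in \<open>{..b}\<close>, lists of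
  at most \<open>m\<close> tests produce a number of labels bounded in terms of \<open>b\<close> and
  \<open>m\<close> alone; integer-valued tests serve this purpose.\<close>

definition label :: "('i \<Rightarrow> 'e \<Rightarrow> nat) \<Rightarrow> 'i list \<Rightarrow> 'e \<Rightarrow> nat list" where
  "label s xs e = map (\<lambda>i. s i e) xs"

text \<open>Energy increment. The structured part is a conditional expectation rather than a step function,
  which is what later makes the tilting argument lossless.\<close>

lemma weak_regularity:
  fixes s :: "'i \<Rightarrow> 'e \<Rightarrow> nat"
  assumes "finite K" "real (card K) \<le> N" "N > 0" "b > 0" "\<delta> > 0"
    and s: "\<And>i e. i \<in> I \<Longrightarrow> e \<in> K \<Longrightarrow> s i e \<le> b"
    and g: "\<And>e. e \<in> K \<Longrightarrow> g e \<in> {0..1}"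
    and m: "real m * \<delta>\<^sup>2 > (real b)\<^sup>2 * N\<^sup>2"
  shows "\<exists>xs. set xs \<subseteq> I \<and> length xs \<le> m \<and>
           (\<forall>i\<in>I. \<bar>\<Sum>e\<in>K. real (s i e) * (g e - cavg K (label s xs) g e)\<bar> \<le> \<delta>)"
proof (rule ccontr)
  assume "\<not> ?thesis"
  then have bad: "\<exists>i\<in>I. \<bar>\<Sum>e\<in>K. real (s i e) * (g e - cavg K (label s xs) g e)\<bar> \<ge> \<delta>"
    if "set xs \<subseteq> I" "length xs \<le> m" for xs using that by (meson linorder_le_cases)
  have "\<exists>xs. set xs \<subseteq> I \<and> length xs = j \<and>
      (\<Sum>e\<in>K. (cavg K (label s xs) g e)\<^sup>2) \<ge> real j * (\<delta>\<^sup>2 / ((real b)\<^sup>2 * N))" if "j \<le> m" for j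
    using that
  proof (induction j)
    case 0
    show ?case by (intro exI[of _ "[]"]) (auto intro: sum_nonneg)
  next
    case (Suc j)
    then obtain xs where xs: "set xs \<subseteq> I" "length xs = j"
      "(\<Sum>e\<in>K. (cavg K (label s xs) g e)\<^sup>2) \<ge> real j * (\<delta>\<^sup>2 / ((real b)\<^sup>2 * N))" by auto
    with bad[of xs] Suc obtain i where i: "i \<in> I"
      "\<bar>\<Sum>e\<in>K. real (s i e) * (g e - cavg K (label s xs) g e)\<bar> \<ge> \<delta>" by auto
    have "(\<Sum>e\<in>K. (cavg K (label s (i # xs)) g e)\<^sup>2)
        \<ge> (\<Sum>e\<in>K. (cavg K (label s xs) g e)\<^sup>2) + \<delta>\<^sup>2 / ((real b)\<^sup>2 * N)"
      by (rule cavg_energy_step[where s = "\<lambda>e. real (s i e)"])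
        (use assms i in \<open>auto simp: label_def\<close>)
    moreover have "real (Suc j) * (\<delta>\<^sup>2 / ((real b)\<^sup>2 * N))
        = real j * (\<delta>\<^sup>2 / ((real b)\<^sup>2 * N)) + \<delta>\<^sup>2 / ((real b)\<^sup>2 * N)"
      by (simp only: of_nat_Suc distrib_right mult_1 add.commute)
    ultimately have "(\<Sum>e\<in>K. (cavg K (label s (i # xs)) g e)\<^sup>2) \<ge> real (Suc j) * (\<delta>\<^sup>2 / ((real b)\<^sup>2 * N))"
      using xs(3) by linarith
    with xs i show ?case by (intro exI[of _ "i # xs"]) auto
  qed
  \<comment> \<open>After \<open>m\<close> steps the energy would exceed \<open>N\<close>, an upper
    bound for the energy of any function with values in \<open>[0, 1]\<close>.\<close>
  from this[of m] obtain xs where xs: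
    "(\<Sum>e\<in>K. (cavg K (label s xs) g e)\<^sup>2) \<ge> real m * (\<delta>\<^sup>2 / ((real b)\<^sup>2 * N))" by auto
  have "(\<Sum>e\<in>K. (cavg K (label s xs) g e)\<^sup>2) \<le> (\<Sum>e\<in>K. 1)"
    using cavg_range[OF assms(1) _ g, where x = "label s xs"] by (intro sum_mono) (auto simp: power_le_one)
  also have "\<dots> \<le> N" using assms by simp
  finally have "real m * (\<delta>\<^sup>2 / ((real b)\<^sup>2 * N)) \<le> N" using xs by simp
  then have "real m * \<delta>\<^sup>2 \<le> (real b)\<^sup>2 * N\<^sup>2"
    using assms(3,4) by (simp add: field_simps power2_eq_square)
  with m show False by simp
qed

text \<open>Tilting to \<open>w\<close> is exact here: on this event the likelihood ratio is constant.\<close>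

lemma bprob_cavg_eq_le:
  assumes "finite K" "0 < p" "p < 1" "\<And>e. e \<in> K \<Longrightarrow> w e \<in> {0..1}"
  shows "bprob K (\<lambda>_. p) {E. \<forall>e\<in>K. cavg K x (\<lambda>e. of_bool (e \<in> E)) e = w e}
           \<le> exp (- (\<Sum>e\<in>K. rel_entropy p (w e)))"
proof -
  let ?I = "\<Sum>e\<in>K. rel_entropy p (w e)"
  have le: "bern K (\<lambda>_. p) E \<le> exp (- ?I) * bern K w E"
    if E: "E \<subseteq> K" and eq: "\<forall>e\<in>K. cavg K x (\<lambda>e. of_bool (e \<in> E)) e = w e" for E
  proof -
    let ?g = "\<lambda>e. of_bool (e \<in> E) :: real"
    have Ppos: "bern K (\<lambda>_. p) E > 0" using assms E by (intro bern_pos) auto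
    \<comment> \<open>An edge of \<open>E\<close> counts in its own class, so the average there is
      positive. Dually, an absent edge keeps the average of its class below
      \<open>1\<close>.\<close>
    have w0: "w e > 0" if "e \<in> E" for e
    proof -
      have "e \<in> {e' \<in> K. x e' = x e}" "finite {e' \<in> K. x e' = x e}" using that E assms(1) by auto
      then have "sum ?g {e' \<in> K. x e' = x e} > 0" "card {e' \<in> K. x e' = x e} > 0"
        using that by (auto intro!: sum_pos2[of _ e] simp: card_gt_0_iff)
      then have "cavg K x ?g e > 0" by (auto simp: cavg_def)
      with eq that E show ?thesis by auto
    qed
    have w1: "w e < 1" if "e \<in> K - E" for e
    proof -
      have fin: "e \<in> {e' \<in> K. x e' = x e}" "finite {e' \<in> K. x e' = x e}" using that assms(1) by auto
      have "sum ?g {e' \<in> K. x e' = x e} < (\<Sum>e'\<in>{e' \<in> K. x e' = x e}. 1)"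
        using fin that by (intro sum_strict_mono2[of _ _ e] sum_strict_mono_ex1) auto
      moreover have "card {e' \<in> K. x e' = x e} > 0" using fin by (auto simp: card_gt_0_iff)
      ultimately have "cavg K x ?g e < 1" by (auto simp: cavg_def)
      with eq that show ?thesis by auto
    qed
    have fin: "finite E" "finite (K - E)" using assms(1) E finite_subset by auto
    have Qpos: "bern K w E > 0"
      unfolding bern_def using w0 w1 by (intro mult_pos_pos prod_pos) auto
    have wm: "w e = w e'" if "e \<in> K" "e' \<in> K" "x e = x e'" for e e'
      using that eq cavg_cong[of x e e' K ?g] by auto
    have "ln (bern K w E / bern K (\<lambda>_. p) E)
        = (\<Sum>e\<in>K. if e \<in> E then ln (w e / p) else ln ((1 - w e) / (1 - p)))"
      by (rule bern_log_ratio) (use assms E Qpos in auto)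
    also have "\<dots> = (\<Sum>e\<in>K. ?g e * (ln (w e / p) - ln ((1 - w e) / (1 - p))) + ln ((1 - w e) / (1 - p)))"
      by (intro sum.cong) auto
    also have "\<dots> = (\<Sum>e\<in>K. ?g e * (ln (w e / p) - ln ((1 - w e) / (1 - p)))) + (\<Sum>e\<in>K. ln ((1 - w e) / (1 - p)))"
      by (simp add: sum.distrib)
    \<comment> \<open>The coefficients are functions of the label because \<open>w\<close> is one,
      so the indicator of \<open>E\<close> may be exchanged for its average \<open>w\<close>. This
      removes the dependence on the particular graph in the event.\<close>
    also have "(\<Sum>e\<in>K. ?g e * (ln (w e / p) - ln ((1 - w e) / (1 - p))))
        = (\<Sum>e\<in>K. cavg K x ?g e * (ln (w e / p) - ln ((1 - w e) / (1 - p))))"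
      by (rule sum_cavg_mult[OF assms(1), symmetric]) (metis wm)
    also have "\<dots> = (\<Sum>e\<in>K. w e * (ln (w e / p) - ln ((1 - w e) / (1 - p))))"
      using eq by (intro sum.cong) auto
    also have "\<dots> + (\<Sum>e\<in>K. ln ((1 - w e) / (1 - p))) = ?I"
      unfolding sum.distrib[symmetric] rel_entropy_def by (intro sum.cong) (auto simp: algebra_simps)
    finally have "bern K w E / bern K (\<lambda>_. p) E = exp ?I"
      using Ppos Qpos by (metis divide_pos_pos exp_ln)
    then show ?thesis using Ppos by (simp add: field_simps exp_minus)
  qed
  have "bprob K (\<lambda>_. p) {E. \<forall>e\<in>K. cavg K x (\<lambda>e. of_bool (e \<in> E)) e = w e}
      \<le> (\<Sum>E\<in>Pow K \<inter> {E. \<forall>e\<in>K. cavg K x (\<lambda>e. of_bool (e \<in> E)) e = w e}. exp (- ?I) * bern K w E)"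
    unfolding bprob_def by (intro sum_mono le) auto
  also have "\<dots> = exp (- ?I) * bprob K w {E. \<forall>e\<in>K. cavg K x (\<lambda>e. of_bool (e \<in> E)) e = w e}"
    by (simp add: bprob_def sum_distrib_left)
  also have "\<dots> \<le> exp (- ?I) * 1"
    by (intro mult_left_mono bprob_le_1 assms) auto
  finally show ?thesis by simp
qed

text \<open>Each graph in \<open>A\<close> is assigned a list of tests and a table of edge counts
  per label, which together determine its structured part \<open>w\<close>. In a union bound over
  these pairs some pair carries at least the average share; its event is nonempty, and any graph in
  it is the witness \<open>E\<close>. The number of pairs is the prefactor.\<close>

lemma bern_ldp_upper:
  fixes s :: "'i \<Rightarrow> 'e \<Rightarrow> nat"
  assumes "finite K" "real (card K) \<le> N" "N > 0" "b > 0" "\<delta> > 0" "finite I" "I \<noteq> {}"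
    and s: "\<And>i e. i \<in> I \<Longrightarrow> e \<in> K \<Longrightarrow> s i e \<le> b"
    and m: "real m * \<delta>\<^sup>2 > (real b)\<^sup>2 * N\<^sup>2"
    and p: "0 < p" "p < 1" and pos: "bprob K (\<lambda>_. p) A > 0"
  obtains E w where "E \<subseteq> K" "E \<in> A" "\<And>e. e \<in> K \<Longrightarrow> w e \<in> {0..1}"
    "\<And>i. i \<in> I \<Longrightarrow> \<bar>\<Sum>e\<in>K. real (s i e) * (of_bool (e \<in> E) - w e)\<bar> \<le> \<delta>"
    "bprob K (\<lambda>_. p) A \<le> real (m + 1) * real (card I) ^ m
       * (real (card K) + 1) ^ card {ys. set ys \<subseteq> {..b} \<and> length ys \<le> m}
       * exp (- (\<Sum>e\<in>K. rel_entropy p (w e)))"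
proof -
  define J where "J = {xs. set xs \<subseteq> I \<and> length xs \<le> m}"
  define Y where "Y = {ys. set ys \<subseteq> {..b} \<and> length ys \<le> m}"
  define C where "C = (Y \<rightarrow>\<^sub>E {..card K})"
  have fin: "finite J" "finite Y" unfolding J_def Y_def
    using assms finite_lists_length_le[of I m] finite_lists_length_le[of "{..b}" m] by auto
  then have finC: "finite C" by (auto simp: C_def intro: finite_PiE)
  have neJ: "J \<noteq> {}" by (auto simp: J_def intro: exI[of _ "[]"])
  have neC: "C \<noteq> {}" unfolding C_def by (auto simp: PiE_eq_empty_iff)
  define w where "w = (\<lambda>(xs, c) e. real (c (label s xs e)) / real (card {e' \<in> K. label s xs e' = label s xs e}))"
  define reg where "reg = (\<lambda>xs E. \<forall>i\<in>I. \<bar>\<Sum>e\<in>K. real (s i e) * (of_bool (e \<in> E) - cavg K (label s xs) (\<lambda>e. of_bool (e \<in> E)) e)\<bar> \<le> \<delta>)"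
  define B where "B = (\<lambda>(xs, c). {E \<in> A. E \<subseteq> K \<and> reg xs E \<and> (\<forall>e\<in>K. cavg K (label s xs) (\<lambda>e. of_bool (e \<in> E)) e = w (xs, c) e)})"
  have p01: "\<And>e. e \<in> K \<Longrightarrow> p \<in> {0..1}" using p by auto
  have cover: "\<exists>z\<in>J \<times> C. E \<in> B z" if E: "E \<subseteq> K" "E \<in> A" for E
  proof -
    obtain xs where xs: "xs \<in> J" "reg xs E"
      using weak_regularity[OF assms(1-5), where s = s and I = I and g = "\<lambda>e. of_bool (e \<in> E)" and m = m] m s
      unfolding J_def reg_def by auto
    define c where "c = restrict (\<lambda>ys. card {e \<in> K. label s xs e = ys \<and> e \<in> E}) Y"
    have c: "c \<in> C" unfolding C_def c_def using assms(1) by (auto intro!: card_mono)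
    have "cavg K (label s xs) (\<lambda>e. of_bool (e \<in> E)) e = w (xs, c) e" if "e \<in> K" for e
    proof -
      have "label s xs e \<in> Y" using xs that s by (auto simp: label_def Y_def J_def)
      moreover have "(\<Sum>e\<in>{e' \<in> K. label s xs e' = label s xs e}. of_bool (e \<in> E) :: real)
          = real (card {e' \<in> K. label s xs e' = label s xs e \<and> e' \<in> E})"
        using assms(1) by (simp add: of_bool_def sum.If_cases) (auto intro!: arg_cong[of _ _ card])
      ultimately show ?thesis unfolding cavg_def w_def c_def by simp
    qed
    then have "E \<in> B (xs, c)" using E xs by (auto simp: B_def)
    with xs c show ?thesis by blast
  qed
  have "bprob K (\<lambda>_. p) A \<le> bprob K (\<lambda>_. p) (\<Union>z\<in>J \<times> C. B z)"
    using cover by (intro bprob_mono assms p01) auto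
  also have "\<dots> \<le> (\<Sum>z\<in>J \<times> C. bprob K (\<lambda>_. p) (B z))"
    using fin finC by (intro bprob_UN_le assms p01) auto
  finally have sum_ge: "bprob K (\<lambda>_. p) A \<le> (\<Sum>z\<in>J \<times> C. bprob K (\<lambda>_. p) (B z))" .
  have cardJC: "card (J \<times> C) > 0" using fin finC neJ neC by (auto simp: card_gt_0_iff)
  have "\<exists>z\<in>J \<times> C. bprob K (\<lambda>_. p) A / real (card (J \<times> C)) \<le> bprob K (\<lambda>_. p) (B z)"
  proof (rule ccontr)
    assume "\<not> ?thesis"
    then have "(\<Sum>z\<in>J \<times> C. bprob K (\<lambda>_. p) (B z)) < (\<Sum>z\<in>J \<times> C. bprob K (\<lambda>_. p) A / real (card (J \<times> C)))"
      using fin finC neJ neC by (intro sum_strict_mono) (auto simp: not_le)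
    also have "\<dots> = bprob K (\<lambda>_. p) A" using cardJC by simp
    finally show False using sum_ge by simp
  qed
  then obtain xs c where z: "(xs, c) \<in> J \<times> C"
    "bprob K (\<lambda>_. p) A / real (card (J \<times> C)) \<le> bprob K (\<lambda>_. p) (B (xs, c))" by auto
  then have "bprob K (\<lambda>_. p) (B (xs, c)) > 0"
    using pos cardJC by (metis divide_pos_pos of_nat_0_less_iff order_less_le_trans)
  then have "Pow K \<inter> B (xs, c) \<noteq> {}" by (auto simp: bprob_def)
  then obtain E where E: "E \<subseteq> K" "E \<in> B (xs, c)" by auto
  then have Ecavg: "\<And>e. e \<in> K \<Longrightarrow> cavg K (label s xs) (\<lambda>e. of_bool (e \<in> E)) e = w (xs, c) e"
    and EA: "E \<in> A" and Ereg: "reg xs E" by (auto simp: B_def)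
  have w01: "w (xs, c) e \<in> {0..1}" if "e \<in> K" for e
    using cavg_range[OF assms(1) that, of "\<lambda>e. of_bool (e \<in> E)" "label s xs"] Ecavg[OF that] by simp
  have "bprob K (\<lambda>_. p) (B (xs, c)) \<le> bprob K (\<lambda>_. p) {E. \<forall>e\<in>K. cavg K (label s xs) (\<lambda>e. of_bool (e \<in> E)) e = w (xs, c) e}"
    by (intro bprob_mono assms p01) (auto simp: B_def)
  also have "\<dots> \<le> exp (- (\<Sum>e\<in>K. rel_entropy p (w (xs, c) e)))"
    by (intro bprob_cavg_eq_le assms w01 p)
  finally have "bprob K (\<lambda>_. p) A / real (card (J \<times> C)) \<le> exp (- (\<Sum>e\<in>K. rel_entropy p (w (xs, c) e)))"
    using z(2) by linarith
  then have 1: "bprob K (\<lambda>_. p) A \<le> real (card (J \<times> C)) * exp (- (\<Sum>e\<in>K. rel_entropy p (w (xs, c) e)))"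
    using cardJC by (simp add: field_simps)
  have "card J \<le> (m + 1) * card I ^ m"
  proof -
    have cI: "card I \<ge> 1" using assms(6,7) by (simp add: Suc_leI card_gt_0_iff)
    have "card J = (\<Sum>i\<le>m. card I ^ i)" unfolding J_def by (rule card_lists_length_le[OF assms(6)])
    also have "\<dots> \<le> (\<Sum>i\<le>m. card I ^ m)" using cI by (intro sum_mono power_increasing) auto
    finally show ?thesis by simp
  qed
  moreover have "card C = (card K + 1) ^ card Y" unfolding C_def using fin by (simp add: card_PiE)
  ultimately have "card (J \<times> C) \<le> (m + 1) * card I ^ m * (card K + 1) ^ card Y"
    by (simp add: card_cartesian_product)
  then have "real (card (J \<times> C)) \<le> real ((m + 1) * card I ^ m * (card K + 1) ^ card Y)"
    by (simp only: of_nat_le_iff)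
  then have "bprob K (\<lambda>_. p) A \<le> real ((m + 1) * card I ^ m * (card K + 1) ^ card Y) * exp (- (\<Sum>e\<in>K. rel_entropy p (w (xs, c) e)))"
    using 1 by (meson exp_ge_zero mult_right_mono order_trans)
  then have 2: "bprob K (\<lambda>_. p) A \<le> real (m + 1) * real (card I) ^ m * (real (card K) + 1) ^ card Y * exp (- (\<Sum>e\<in>K. rel_entropy p (w (xs, c) e)))"
    by (simp only: of_nat_mult of_nat_power of_nat_add of_nat_1)
  show thesis
  proof (rule that[OF E(1) EA w01])
    show "\<bar>\<Sum>e\<in>K. real (s i e) * (of_bool (e \<in> E) - w (xs, c) e)\<bar> \<le> \<delta>" if "i \<in> I" for i
    proof -
      have "(\<Sum>e\<in>K. real (s i e) * (of_bool (e \<in> E) - w (xs, c) e))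
        = (\<Sum>e\<in>K. real (s i e) * (of_bool (e \<in> E) - cavg K (label s xs) (\<lambda>e. of_bool (e \<in> E)) e))"
        by (intro sum.cong) (auto simp: Ecavg)
      then show ?thesis using Ereg that by (simp add: reg_def)
    qed
  qed (use 2 in \<open>auto simp: Y_def\<close>)
qed

section \<open>Kernels and the counting lemma\<close>

definition mimg :: "('v \<Rightarrow> nat) \<Rightarrow> 'v set \<Rightarrow> nat multiset" where
  "mimg \<phi> e = image_mset \<phi> (mset_set e)"

text \<open>A kernel assigns a weight to every multiset of vertices, i.e. to every tuple up to order,
  tuples with repeated entries included.\<close>

definition hdens :: "nat \<Rightarrow> 'v hypergraph \<Rightarrow> (nat multiset \<Rightarrow> real) \<Rightarrow> real" where
  "hdens n H U =
     (\<Sum>\<phi>\<in>verts H \<rightarrow>\<^sub>E {..<n}. \<Prod>e\<in>hedges H. U (mimg \<phi> e)) / real n ^ card (verts H)"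

text \<open>The pairing of a kernel with the box of the sets \<open>A i\<close>. The cut norm,
  before normalisation, is the largest absolute value of such pairings.\<close>

definition tsum :: "nat \<Rightarrow> (nat \<Rightarrow> nat set) \<Rightarrow> (nat multiset \<Rightarrow> real) \<Rightarrow> real" where
  "tsum k A U = (\<Sum>a\<in>PiE {..<k} A. U (mimg a {..<k}))"

lemma mimg_cong: "(\<And>x. x \<in> e \<Longrightarrow> \<phi> x = \<psi> x) \<Longrightarrow> mimg \<phi> e = mimg \<psi> e"
  unfolding mimg_def by (cases "finite e") (auto intro!: image_mset_cong)

lemma mimg_restrict [simp]: "mimg (restrict \<phi> e) e = mimg \<phi> e"
  by (rule mimg_cong) auto

lemma sum_PiE_insert:
  assumes "v \<notin> V" "finite V" "\<And>x. x \<in> insert v V \<Longrightarrow> finite (X x)"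
  shows "sum F (PiE (insert v V) X) = (\<Sum>\<psi>\<in>PiE V X. \<Sum>y\<in>X v. F (\<psi>(v := y)))"
proof -
  have "sum F (PiE (insert v V) X) = (\<Sum>z\<in>X v \<times> PiE V X. F ((snd z)(v := fst z)))"
    unfolding PiE_insert_eq using assms(1)
    by (subst sum.reindex[OF inj_combinator]) (auto intro!: sum.cong)
  also have "\<dots> = (\<Sum>y\<in>X v. \<Sum>\<psi>\<in>PiE V X. F (\<psi>(v := y)))"
    by (simp add: sum.cartesian_product case_prod_beta)
  finally show ?thesis by (subst sum.swap)
qed

lemma sum_PiE_Un:
  assumes "finite V" "finite W" "V \<inter> W = {}" "finite X"
  shows "sum F ((V \<union> W) \<rightarrow>\<^sub>E X) = (\<Sum>\<psi>\<in>W \<rightarrow>\<^sub>E X. \<Sum>a\<in>V \<rightarrow>\<^sub>E X. F (\<lambda>x. if x \<in> V then a x else \<psi> x))"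
proof -
  have "sum F ((V \<union> W) \<rightarrow>\<^sub>E X)
      = (\<Sum>z\<in>(W \<rightarrow>\<^sub>E X) \<times> (V \<rightarrow>\<^sub>E X). F (\<lambda>x. if x \<in> V then snd z x else fst z x))"
  proof (rule sum.reindex_bij_witness[where j = "\<lambda>\<phi>. (restrict \<phi> W, restrict \<phi> V)"
        and i = "\<lambda>z x. if x \<in> V then snd z x else fst z x"], goal_cases)
    case (1 \<phi>)
    then show ?case by (auto simp: fun_eq_iff PiE_def extensional_def)
  next
    case (3 z)
    then show ?case using assms(3) by (cases z) (auto simp: fun_eq_iff PiE_def extensional_def)
  next
    case (5 \<phi>)
    then have eq: "(\<lambda>x. if x \<in> V then restrict \<phi> V x else restrict \<phi> W x) = \<phi>"
      by (auto simp: fun_eq_iff PiE_def extensional_def)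
    show ?case unfolding fst_conv snd_conv eq ..
  qed (use assms(3) in \<open>auto simp: PiE_def extensional_def Pi_def\<close>)
  then show ?thesis by (simp add: sum.cartesian_product case_prod_beta)
qed

text \<open>The weighted sum is largest with weight \<open>1\<close> exactly on the nonnegative
  terms and smallest with weight \<open>1\<close> exactly on the nonpositive ones; both extremes are
  subset sums.\<close>

lemma abs_weighted_sum_le:
  fixes T u :: "'a \<Rightarrow> real"
  assumes "finite Y" "\<And>Z. Z \<subseteq> Y \<Longrightarrow> \<bar>sum T Z\<bar> \<le> B" "\<And>y. y \<in> Y \<Longrightarrow> u y \<in> {0..1}"
  shows "\<bar>\<Sum>y\<in>Y. u y * T y\<bar> \<le> B"
proof -
  have "(\<Sum>y\<in>Y. u y * T y) \<le> sum T {y \<in> Y. T y \<ge> 0}"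
  proof -
    have "u y * T y \<le> (if T y \<ge> 0 then T y else 0)" if "y \<in> Y" for y
      using assms(3)[OF that] by (auto simp: mult_left_le_one_le mult_nonneg_nonpos)
    then have "(\<Sum>y\<in>Y. u y * T y) \<le> (\<Sum>y\<in>Y. if T y \<ge> 0 then T y else 0)" by (intro sum_mono)
    then show ?thesis using assms(1) by (simp add: sum.inter_filter)
  qed
  moreover have "(\<Sum>y\<in>Y. u y * T y) \<ge> sum T {y \<in> Y. T y \<le> 0}"
  proof -
    have "u y * T y \<ge> (if T y \<le> 0 then T y else 0)" if "y \<in> Y" for y
      using assms(3)[OF that] mult_left_le_one_le[of "- T y" "u y"] by auto
    then have "(\<Sum>y\<in>Y. u y * T y) \<ge> (\<Sum>y\<in>Y. if T y \<le> 0 then T y else 0)" by (intro sum_mono)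
    then show ?thesis using assms(1) by (simp add: sum.inter_filter)
  qed
  moreover have "\<bar>sum T {y \<in> Y. T y \<ge> 0}\<bar> \<le> B" "\<bar>sum T {y \<in> Y. T y \<le> 0}\<bar> \<le> B"
    by (intro assms; auto)+
  ultimately show ?thesis by linarith
qed

text \<open>A multilinear form is maximised at extreme points, so testing against sets suffices.\<close>

lemma multilinear_bound:
  fixes D :: "('i \<Rightarrow> 'a) \<Rightarrow> real"
  assumes "finite I" "finite V" "finite J" "J \<subseteq> I"
    and D: "\<And>A. (\<And>i. i \<in> I \<Longrightarrow> A i \<subseteq> V) \<Longrightarrow> \<bar>sum D (PiE I A)\<bar> \<le> B"
    and u: "\<And>j y. j \<in> J \<Longrightarrow> u j y \<in> {0..1}"
    and A: "\<And>i. i \<in> I \<Longrightarrow> A i \<subseteq> V"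
  shows "\<bar>\<Sum>a\<in>PiE I A. D a * (\<Prod>j\<in>J. u j (a j))\<bar> \<le> B"
  using assms(3,4) u A
proof (induction J arbitrary: A rule: finite_induct)
  case empty
  then show ?case using D by simp
next
  case (insert j J)
  \<comment> \<open>The contribution of the value \<open>y\<close> at coordinate \<open>j\<close>,
    with the weights of \<open>J\<close> in place. By the induction hypothesis the sums of
    \<open>T\<close> over subsets of \<open>A j\<close> are bounded, so the weight
    \<open>u j\<close> can be put in last.\<close>
  define T where "T y = (\<Sum>a\<in>PiE I (A(j := {y})). D a * (\<Prod>j\<in>J. u j (a j)))" for y
  have fA: "finite (A i)" if "i \<in> I" for i
    using insert.prems(3)[OF that] assms(2) by (rule finite_subset)
  have jI: "j \<in> I" using insert.prems(1) by auto
  note AV = insert.prems(3)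
  have split: "(\<Sum>a\<in>PiE I (A(j := Y)). f a) = (\<Sum>y\<in>Y. \<Sum>a\<in>PiE I (A(j := {y})). f a)"
    if "Y \<subseteq> V" for Y and f :: "('i \<Rightarrow> 'a) \<Rightarrow> real"
  proof -
    have fY: "finite Y" using that assms(2) finite_subset by auto
    have fin: "finite (PiE I (A(j := Y)))" using fA fY assms(1) by (intro finite_PiE) auto
    have "(\<Sum>y\<in>Y. sum f {a \<in> PiE I (A(j := Y)). a j = y}) = sum f (PiE I (A(j := Y)))"
      using fin fY jI by (intro sum.group) (auto simp: PiE_def Pi_def split: if_splits)
    moreover have "{a \<in> PiE I (A(j := Y)). a j = y} = PiE I (A(j := {y}))" if "y \<in> Y" for y
      using that jI by (auto simp: PiE_def Pi_def split: if_splits)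
    ultimately show ?thesis by simp
  qed
  have "(\<Sum>a\<in>PiE I A. D a * (\<Prod>j\<in>insert j J. u j (a j)))
      = (\<Sum>y\<in>A j. \<Sum>a\<in>PiE I (A(j := {y})). D a * (\<Prod>j\<in>insert j J. u j (a j)))"
    using split[OF AV[OF jI]] by simp
  also have "\<dots> = (\<Sum>y\<in>A j. u j y * T y)"
  proof (intro sum.cong refl)
    fix y assume "y \<in> A j"
    have "a j = y" if "a \<in> PiE I (A(j := {y}))" for a
      using that jI by (auto simp: PiE_def Pi_def split: if_splits)
    then have "(\<Sum>a\<in>PiE I (A(j := {y})). D a * (\<Prod>j\<in>insert j J. u j (a j)))
        = (\<Sum>a\<in>PiE I (A(j := {y})). u j y * (D a * (\<Prod>j\<in>J. u j (a j))))"
      using insert.hyps by (intro sum.cong) auto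
    then show "(\<Sum>a\<in>PiE I (A(j := {y})). D a * (\<Prod>j\<in>insert j J. u j (a j))) = u j y * T y"
      by (simp add: T_def sum_distrib_left)
  qed
  also have "\<bar>\<dots>\<bar> \<le> B"
  proof (rule abs_weighted_sum_le)
    fix Z assume Z: "Z \<subseteq> A j"
    then have ZV: "Z \<subseteq> V" using AV[OF jI] by auto
    have "\<bar>\<Sum>a\<in>PiE I (A(j := Z)). D a * (\<Prod>j\<in>J. u j (a j))\<bar> \<le> B"
    proof (rule insert.IH)
      show "(A(j := Z)) i \<subseteq> V" if "i \<in> I" for i using AV[OF that] ZV by simp
    qed (use insert.prems(1,2) in auto)
    then show "\<bar>sum T Z\<bar> \<le> B" using split[OF ZV] by (simp add: T_def)
  qed (use insert.prems(2) fA[OF jI] in auto)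
  finally show ?case .
qed

text \<open>Here it matters that kernels live on multisets: \<open>mimg\<close> forgets the
  numbering of the coordinates, so sums over maps defined on a hyperedge become sums over tuples
  indexed by \<open>{..<k}\<close>.\<close>

lemma sum_mimg_reindex:
  assumes "bij_betw h I J" "finite I"
  shows "(\<Sum>a\<in>PiE J A. D (mimg a J)) = (\<Sum>a\<in>PiE I (A \<circ> h). D (mimg a I))"
proof -
  have J: "J = h ` I" and inj: "inj_on h I" using assms(1) by (auto simp: bij_betw_def)
  show ?thesis
  proof (rule sum.reindex_bij_witness[where j = "\<lambda>a. restrict (a \<circ> h) I"
        and i = "\<lambda>b. restrict (b \<circ> inv_into I h) J"], goal_cases)
    case (1 a)
    then show ?case using inj by (auto simp: fun_eq_iff PiE_def extensional_def J f_inv_into_f inv_into_into)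
  next
    case (2 a)
    then show ?case by (auto simp: J PiE_def Pi_def)
  next
    case (3 b)
    then show ?case using inj by (auto simp: fun_eq_iff PiE_def extensional_def J)
  next
    case (4 b)
    then show ?case using inj by (auto simp: J PiE_def Pi_def)
  next
    case (5 a)
    have "mimg a J = mimg (a \<circ> h) I"
      by (simp add: mimg_def J image_mset_mset_set[OF inj, symmetric] multiset.map_comp)
    then show ?case by simp
  qed
qed

lemma sum_mimg_eq_tsum:
  assumes "finite e" "card e = k"
  obtains h where "bij_betw h {..<k} e"
    "\<And>A D. (\<Sum>a\<in>PiE e A. D (mimg a e)) = tsum k (A \<circ> h) D"
proof -
  obtain h where "bij_betw h {..<k} e"
    using ex_bij_betw_nat_finite[OF assms(1)] assms(2) by (auto simp: atLeast0LessThan)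
  then show thesis using that[of h] sum_mimg_reindex[of h "{..<k}" e] by (auto simp: tsum_def)
qed

lemma sum_mimg_const_eq_tsum:
  assumes "finite e" "card e = k"
  shows "(\<Sum>a\<in>e \<rightarrow>\<^sub>E X. D (mimg a e)) = tsum k (\<lambda>_. X) D"
proof -
  obtain h where h: "bij_betw h {..<k} e"
    "\<And>A (D :: nat multiset \<Rightarrow> real). (\<Sum>a\<in>PiE e A. D (mimg a e)) = tsum k (A \<circ> h) D"
    using sum_mimg_eq_tsum[OF assms] by blast
  show ?thesis unfolding h(2) by (simp add: comp_def)
qed

section \<open>The counting lemma for linear hypergraphs\<close>

locale linear_uniform =
  fixes k :: nat and H :: "'v hypergraph"
  assumes uniform: "uniform_hypergraph k H" and linear: "linear_hypergraph H"
begin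

lemma finite_verts [simp]: "finite (verts H)"
  using uniform unfolding uniform_hypergraph_def by blast

lemma hedges_subset: "e \<in> hedges H \<Longrightarrow> e \<subseteq> verts H"
  using uniform unfolding uniform_hypergraph_def by blast

lemma card_hedge: "e \<in> hedges H \<Longrightarrow> card e = k"
  using uniform unfolding uniform_hypergraph_def by blast

lemma hedges_Pow: "hedges H \<subseteq> Pow (verts H)"
  using hedges_subset by blast

lemma finite_hedges [simp]: "finite (hedges H)"
  using finite_subset[OF hedges_Pow] by simp

lemma finite_hedge: "e \<in> hedges H \<Longrightarrow> finite e"
  using hedges_subset finite_subset finite_verts by metis

lemma hedges_Int:
  assumes "e \<in> hedges H" "e' \<in> hedges H" "e \<noteq> e'" "x \<in> e" "x \<in> e'" "y \<in> e" "y \<in> e'"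
  shows "x = y"
proof (rule ccontr)
  assume "x \<noteq> y"
  then have "card {e \<in> hedges H. x \<in> e \<and> y \<in> e} \<le> 1"
    using linear assms hedges_subset unfolding linear_hypergraph_def by blast
  moreover have "card {e, e'} \<le> card {e \<in> hedges H. x \<in> e \<and> y \<in> e}"
    using assms by (intro card_mono) auto
  ultimately show False using assms(3) by simp
qed

text \<open>By linearity every other edge meets \<open>e0\<close> in at most one vertex, so once the vertices outside
  \<open>e0\<close> are fixed the remaining factors form a product of functions of one vertex each.\<close>

lemma sum_edge_replace_le:
  assumes e0: "e0 \<in> hedges H"
    and D: "\<And>A. (\<And>i. i < k \<Longrightarrow> A i \<subseteq> {..<n}) \<Longrightarrow> \<bar>tsum k A D\<bar> \<le> B"
    and Z: "\<And>e M. e \<in> hedges H \<Longrightarrow> Z e M \<in> {0..1}"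
  shows "\<bar>\<Sum>\<phi>\<in>verts H \<rightarrow>\<^sub>E {..<n}. D (mimg \<phi> e0) * (\<Prod>e\<in>hedges H - {e0}. Z e (mimg \<phi> e))\<bar>
           \<le> B * real n ^ (card (verts H) - k)"
proof -
  let ?W = "verts H - e0" and ?E = "hedges H - {e0}"
  let ?mg = "\<lambda>\<psi> a x. if x \<in> e0 then a x else \<psi> x"
  have V: "e0 \<union> ?W = verts H" using hedges_subset[OF e0] by auto
  note fe0 = finite_hedge[OF e0]
  have Bnn: "0 \<le> B" using D[of "\<lambda>_. {}"] by (metis abs_ge_zero empty_subsetI order_trans)
  have D': "\<bar>\<Sum>a\<in>PiE e0 A. D (mimg a e0)\<bar> \<le> B" if "\<And>i. i \<in> e0 \<Longrightarrow> A i \<subseteq> {..<n}" for A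
  proof -
    obtain h where h: "bij_betw h {..<k} e0" "(\<Sum>a\<in>PiE e0 A. D (mimg a e0)) = tsum k (A \<circ> h) D"
      using sum_mimg_eq_tsum[OF fe0 card_hedge[OF e0]] by metis
    have "h i \<in> e0" if "i < k" for i using h(1) that by (auto simp: bij_betw_def)
    then show ?thesis unfolding h(2) using that by (intro D) auto
  qed
  have inner: "\<bar>\<Sum>a\<in>e0 \<rightarrow>\<^sub>E {..<n}. D (mimg (?mg \<psi> a) e0) * (\<Prod>e\<in>?E. Z e (mimg (?mg \<psi> a) e))\<bar> \<le> B" for \<psi>
  proof -
    \<comment> \<open>Edges disjoint from \<open>e0\<close> depend on the outer map
      \<open>\<psi>\<close> only; an edge through a vertex \<open>x\<close> of \<open>e0\<close>
      depends on \<open>\<psi>\<close> and on the image of \<open>x\<close>.\<close>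
    define C where "C = (\<Prod>e\<in>{e \<in> ?E. e \<inter> e0 = {}}. Z e (mimg \<psi> e))"
    define u where "u x y = (\<Prod>e\<in>{e \<in> ?E. x \<in> e}. Z e (mimg (\<psi>(x := y)) e))" for x y
    have C01: "C \<in> {0..1}" unfolding C_def using Z by (auto intro!: prod_nonneg prod_le_1)
    have u01: "u x y \<in> {0..1}" for x y unfolding u_def using Z by (auto intro!: prod_nonneg prod_le_1)
    have fac: "(\<Prod>e\<in>?E. Z e (mimg (?mg \<psi> a) e)) = C * (\<Prod>x\<in>e0. u x (a x))" for a
    proof -
      let ?P = "\<lambda>e. Z e (mimg (?mg \<psi> a) e)"
      have E: "?E = {e \<in> ?E. e \<inter> e0 = {}} \<union> (\<Union>x\<in>e0. {e \<in> ?E. x \<in> e})" by auto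
      have "prod ?P ?E = prod ?P {e \<in> ?E. e \<inter> e0 = {}} * prod ?P (\<Union>x\<in>e0. {e \<in> ?E. x \<in> e})"
        by (subst E, subst prod.union_disjoint) (use fe0 in auto)
      also have "prod ?P (\<Union>x\<in>e0. {e \<in> ?E. x \<in> e}) = (\<Prod>x\<in>e0. prod ?P {e \<in> ?E. x \<in> e})"
      proof (rule prod.UNION_disjoint)
        show "\<forall>x\<in>e0. \<forall>y\<in>e0. x \<noteq> y \<longrightarrow> {e \<in> ?E. x \<in> e} \<inter> {e \<in> ?E. y \<in> e} = {}"
          using hedges_Int[OF e0] by blast
      qed (use fe0 in auto)
      also have "(\<Prod>x\<in>e0. prod ?P {e \<in> ?E. x \<in> e}) = (\<Prod>x\<in>e0. u x (a x))"
        unfolding u_def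
      proof (intro prod.cong refl)
        fix x e assume x: "x \<in> e0" and e: "e \<in> {e \<in> ?E. x \<in> e}"
        have "mimg (?mg \<psi> a) e = mimg (\<psi>(x := a x)) e"
          by (rule mimg_cong) (use hedges_Int[OF e0, of e x] x e in auto)
        then show "?P e = Z e (mimg (\<psi>(x := a x)) e)" by simp
      qed
      also have "prod ?P {e \<in> ?E. e \<inter> e0 = {}} = C"
        unfolding C_def
      proof (intro prod.cong refl)
        fix e assume "e \<in> {e \<in> ?E. e \<inter> e0 = {}}"
        then have "mimg (?mg \<psi> a) e = mimg \<psi> e" by (intro mimg_cong) auto
        then show "?P e = Z e (mimg \<psi> e)" by simp
      qed
      finally show ?thesis .
    qed
    have "mimg (?mg \<psi> a) e0 = mimg a e0" for a by (rule mimg_cong) auto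
    then have "(\<Sum>a\<in>e0 \<rightarrow>\<^sub>E {..<n}. D (mimg (?mg \<psi> a) e0) * (\<Prod>e\<in>?E. Z e (mimg (?mg \<psi> a) e)))
       = C * (\<Sum>a\<in>e0 \<rightarrow>\<^sub>E {..<n}. D (mimg a e0) * (\<Prod>x\<in>e0. u x (a x)))"
      unfolding fac by (simp add: sum_distrib_left mult_ac)
    moreover have "\<bar>\<Sum>a\<in>e0 \<rightarrow>\<^sub>E {..<n}. D (mimg a e0) * (\<Prod>x\<in>e0. u x (a x))\<bar> \<le> B"
      by (rule multilinear_bound[where V = "{..<n}"]) (use fe0 D' u01 in auto)
    moreover have "\<bar>C\<bar> \<le> 1" using C01 by simp
    ultimately show ?thesis
      using mult_mono[of "\<bar>C\<bar>" 1 _ B] by (simp add: abs_mult)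
  qed
  have "\<bar>\<Sum>\<phi>\<in>verts H \<rightarrow>\<^sub>E {..<n}. D (mimg \<phi> e0) * (\<Prod>e\<in>?E. Z e (mimg \<phi> e))\<bar>
     = \<bar>\<Sum>\<psi>\<in>?W \<rightarrow>\<^sub>E {..<n}. \<Sum>a\<in>e0 \<rightarrow>\<^sub>E {..<n}. D (mimg (?mg \<psi> a) e0) * (\<Prod>e\<in>?E. Z e (mimg (?mg \<psi> a) e))\<bar>"
    using sum_PiE_Un[OF fe0, of ?W "{..<n}" "\<lambda>\<phi>. D (mimg \<phi> e0) * (\<Prod>e\<in>?E. Z e (mimg \<phi> e))"]
    unfolding V by simp
  also have "\<dots> \<le> (\<Sum>\<psi>\<in>?W \<rightarrow>\<^sub>E {..<n}. B)"
    by (rule order_trans[OF sum_abs]) (intro sum_mono inner)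
  also have "\<dots> = B * real n ^ (card (verts H) - k)"
    using card_Diff_subset[OF fe0 hedges_subset[OF e0]] card_hedge[OF e0] by (simp add: card_PiE)
  finally show ?thesis .
qed

text \<open>The hyperedges are switched from \<open>U'\<close> to \<open>U\<close> one at a time. A
  switch changes a single factor, the other hyperedges carrying \<open>U\<close> or
  \<open>U'\<close> according to the set \<open>S\<close> already switched, and it costs at most
  \<open>\<delta>\<close> after normalisation.\<close>

lemma counting_lemma:
  assumes n: "n > 0"
    and cut: "\<And>A. (\<And>i. i < k \<Longrightarrow> A i \<subseteq> {..<n}) \<Longrightarrow> \<bar>tsum k A U - tsum k A U'\<bar> \<le> \<delta> * real n ^ k"
    and U: "\<And>M. U M \<in> {0..1}" and U': "\<And>M. U' M \<in> {0..1}"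
  shows "\<bar>hdens n H U - hdens n H U'\<bar> \<le> real (card (hedges H)) * \<delta>"
proof -
  define \<Phi> where "\<Phi> = verts H \<rightarrow>\<^sub>E {..<n}"
  define P where "P S = (\<Sum>\<phi>\<in>\<Phi>. \<Prod>e\<in>hedges H. (if e \<in> S then U else U') (mimg \<phi> e))" for S
  have step: "\<bar>P S - P {}\<bar> \<le> real (card S) * (\<delta> * real n ^ card (verts H))" if "finite S" "S \<subseteq> hedges H" for S
    using that
  proof (induction S rule: finite_induct)
    case (insert e0 S)
    then have e0: "e0 \<in> hedges H" by auto
    let ?Z = "\<lambda>e. if e \<in> S then U else U'"
    have kv: "k \<le> card (verts H)"
      using card_mono[OF finite_verts hedges_subset[OF e0]] card_hedge[OF e0] by simp
    have "P (insert e0 S) - P S = (\<Sum>\<phi>\<in>\<Phi>. (U (mimg \<phi> e0) - U' (mimg \<phi> e0)) * (\<Prod>e\<in>hedges H - {e0}. ?Z e (mimg \<phi> e)))"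
      unfolding P_def sum_subtractf[symmetric]
    proof (intro sum.cong refl)
      fix \<phi>
      have "(\<Prod>e\<in>hedges H - {e0}. (if e \<in> insert e0 S then U else U') (mimg \<phi> e)) = (\<Prod>e\<in>hedges H - {e0}. ?Z e (mimg \<phi> e))"
        by (intro prod.cong) auto
      then show "(\<Prod>e\<in>hedges H. (if e \<in> insert e0 S then U else U') (mimg \<phi> e)) - (\<Prod>e\<in>hedges H. ?Z e (mimg \<phi> e))
          = (U (mimg \<phi> e0) - U' (mimg \<phi> e0)) * (\<Prod>e\<in>hedges H - {e0}. ?Z e (mimg \<phi> e))"
        using insert.hyps by (subst (1 2) prod.remove[OF finite_hedges e0]) (simp add: left_diff_distrib)
    qed
    also have "\<bar>\<dots>\<bar> \<le> (\<delta> * real n ^ k) * real n ^ (card (verts H) - k)"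
      unfolding \<Phi>_def
    proof (rule sum_edge_replace_le[OF e0, where D = "\<lambda>M. U M - U' M" and Z = ?Z])
      fix A :: "nat \<Rightarrow> nat set" assume "\<And>i. i < k \<Longrightarrow> A i \<subseteq> {..<n}"
      from cut[OF this] show "\<bar>tsum k A (\<lambda>M. U M - U' M)\<bar> \<le> \<delta> * real n ^ k"
        by (simp add: tsum_def sum_subtractf)
    qed (use U U' in auto)
    also have "\<dots> = \<delta> * real n ^ card (verts H)"
      using kv by (simp add: mult.assoc flip: power_add)
    finally have "\<bar>P (insert e0 S) - P S\<bar> \<le> \<delta> * real n ^ card (verts H)" .
    moreover have "\<bar>P S - P {}\<bar> \<le> real (card S) * (\<delta> * real n ^ card (verts H))"
      using insert by auto
    ultimately have "\<bar>P (insert e0 S) - P {}\<bar> \<le> \<delta> * real n ^ card (verts H) + real (card S) * (\<delta> * real n ^ card (verts H))"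
      by linarith
    then show ?case using insert.hyps by (simp add: algebra_simps)
  qed simp
  have "hdens n H U - hdens n H U' = (P (hedges H) - P {}) / real n ^ card (verts H)"
    unfolding hdens_def P_def \<Phi>_def by (simp add: diff_divide_distrib)
  then have "\<bar>hdens n H U - hdens n H U'\<bar> = \<bar>P (hedges H) - P {}\<bar> / real n ^ card (verts H)"
    by simp
  also have "\<dots> \<le> real (card (hedges H)) * (\<delta> * real n ^ card (verts H)) / real n ^ card (verts H)"
    using step[of "hedges H"] by (intro divide_right_mono) auto
  finally show ?thesis using n by simp
qed

end

section \<open>Finner's inequality\<close>

text \<open>Hoelder's inequality with \<open>d\<close> equal exponents: after scaling every factor
  to \<open>d\<close>-norm \<open>1\<close>, the arithmetic-geometric mean inequality bounds the
  product pointwise by the mean of the \<open>d\<close>-th powers. A factor of norm \<open>0\<close>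
  vanishes identically and is treated apart.\<close>

lemma holder_prod_sum:
  fixes f :: "'e \<Rightarrow> 'y \<Rightarrow> real"
  assumes "finite Y" "finite E" "card E = d" "d > 0" "\<And>e y. e \<in> E \<Longrightarrow> y \<in> Y \<Longrightarrow> f e y \<ge> 0"
  shows "(\<Sum>y\<in>Y. \<Prod>e\<in>E. f e y) \<le> (\<Prod>e\<in>E. root d (\<Sum>y\<in>Y. f e y ^ d))"
proof -
  define N where "N e = root d (\<Sum>y\<in>Y. f e y ^ d)" for e
  have Nnn: "N e \<ge> 0" if "e \<in> E" for e
    unfolding N_def using assms that by (intro real_root_ge_zero sum_nonneg) auto
  show ?thesis
  proof (cases "\<exists>e\<in>E. N e = 0")
    case True
    then obtain e where e: "e \<in> E" "(\<Sum>y\<in>Y. f e y ^ d) = 0" using assms(4) by (auto simp: N_def)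
    have "f e y = 0" if "y \<in> Y" for y
    proof -
      have "\<forall>y\<in>Y. f e y ^ d = 0"
        using e(2) by (subst (asm) sum_nonneg_eq_0_iff) (use assms e in auto)
      with that show ?thesis by auto
    qed
    then have "(\<Prod>e\<in>E. f e y) = 0" if "y \<in> Y" for y
      using that e assms(2) by (auto simp: prod_zero_iff)
    then have "(\<Sum>y\<in>Y. \<Prod>e\<in>E. f e y) = 0" by simp
    also have "0 \<le> (\<Prod>e\<in>E. N e)" by (intro prod_nonneg Nnn)
    finally show ?thesis by (simp add: N_def)
  next
    case False
    then have Npos: "N e > 0" if "e \<in> E" for e using Nnn[OF that] that by (auto simp: less_le)
    have Nd: "N e ^ d = (\<Sum>y\<in>Y. f e y ^ d)" if "e \<in> E" for e
      unfolding N_def using assms that by (intro real_root_pow_pos2 sum_nonneg) auto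
    have E0: "E \<noteq> {}" using assms by auto
    have amgm: "(\<Prod>e\<in>E. f e y / N e) \<le> (\<Sum>e\<in>E. (f e y / N e) ^ d / real d)" if "y \<in> Y" for y
    proof -
      have nn: "f e y / N e \<ge> 0" if "e \<in> E" for e
        using assms(5)[OF that \<open>y \<in> Y\<close>] Npos[OF that] by auto
      have "(\<Prod>e\<in>E. (f e y / N e) ^ d) powr (1 / real (card E)) \<le> (\<Sum>e\<in>E. (f e y / N e) ^ d / real (card E))"
        using nn by (intro arith_geom_mean assms E0) auto
      moreover have "(\<Prod>e\<in>E. (f e y / N e) ^ d) powr (1 / real d) = (\<Prod>e\<in>E. f e y / N e)"
      proof -
        have *: "(z ^ d) powr (1 / real d) = z" if "z \<ge> 0" for z :: real
          using that assms(4) by (cases "z = 0") (simp_all add: powr_powr flip: powr_realpow)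
        show ?thesis
          unfolding prod_power_distrib[symmetric] using nn by (intro * prod_nonneg) auto
      qed
      ultimately show ?thesis by (simp add: assms(3))
    qed
    have "(\<Sum>y\<in>Y. \<Prod>e\<in>E. f e y / N e) \<le> (\<Sum>y\<in>Y. \<Sum>e\<in>E. (f e y / N e) ^ d / real d)"
      by (intro sum_mono amgm)
    also have "\<dots> = (\<Sum>e\<in>E. \<Sum>y\<in>Y. (f e y / N e) ^ d / real d)" by (rule sum.swap)
    also have "\<dots> = (\<Sum>e\<in>E. 1 / real d)"
    proof (intro sum.cong refl)
      fix e assume e: "e \<in> E"
      have "(\<Sum>y\<in>Y. (f e y / N e) ^ d / real d) = (\<Sum>y\<in>Y. f e y ^ d) / N e ^ d / real d"
        by (simp add: power_divide sum_divide_distrib)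
      also have "\<dots> = 1 / real d" using Nd[OF e] Npos[OF e] by (metis divide_self less_irrefl zero_less_power)
      finally show "(\<Sum>y\<in>Y. (f e y / N e) ^ d / real d) = 1 / real d" .
    qed
    also have "\<dots> = 1" using assms by simp
    finally have "(\<Sum>y\<in>Y. \<Prod>e\<in>E. f e y) / (\<Prod>e\<in>E. N e) \<le> 1"
      by (simp add: prod_dividef sum_divide_distrib)
    moreover have "(\<Prod>e\<in>E. N e) > 0" by (intro prod_pos) (auto simp: Npos)
    ultimately show ?thesis by (simp add: N_def)
  qed
qed

text \<open>Finner's inequality, raised to the power \<open>d\<close> to avoid roots: one coordinate is integrated out at
  a time by Hoelder's inequality.\<close>

lemma finner:
  fixes f :: "'e \<Rightarrow> ('v \<Rightarrow> 'y) \<Rightarrow> real"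
  assumes "finite V" "finite E" "finite X" "d > 0"
    and "\<And>e. e \<in> E \<Longrightarrow> c e \<subseteq> V"
    and "\<And>v. v \<in> V \<Longrightarrow> card {e \<in> E. v \<in> c e} = d"
    and "\<And>e a. e \<in> E \<Longrightarrow> f e a \<ge> 0"
  shows "(\<Sum>\<phi>\<in>V \<rightarrow>\<^sub>E X. \<Prod>e\<in>E. f e (restrict \<phi> (c e))) ^ d
           \<le> (\<Prod>e\<in>E. \<Sum>a\<in>c e \<rightarrow>\<^sub>E X. f e a ^ d)"
  using assms(1,5,6,7)
proof (induction V arbitrary: c f rule: finite_induct)
  case empty
  then have "c e = {}" if "e \<in> E" for e using that by auto
  then have "(\<Prod>e\<in>E. \<Sum>a\<in>c e \<rightarrow>\<^sub>E X. f e a ^ d) = (\<Prod>e\<in>E. f e (\<lambda>_. undefined)) ^ d"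
    by (simp add: prod_power_distrib)
  moreover have "(\<Prod>e\<in>E. f e (restrict (\<lambda>_. undefined) (c e))) = (\<Prod>e\<in>E. f e (\<lambda>_. undefined))"
    by (simp add: restrict_def)
  ultimately show ?case by simp
next
  case (insert v V)
  define c' where "c' e = c e - {v}" for e
  \<comment> \<open>The \<open>d\<close>-norm in the coordinate \<open>v\<close> that is integrated
    out. Exactly \<open>d\<close> of the functions depend on this coordinate, which matches the
    exponent in Hoelder's inequality.\<close>
  define f' where "f' e b = (if v \<in> c e then root d (\<Sum>y\<in>X. f e (b(v := y)) ^ d) else f e b)" for e b
  have f'nn: "f' e b \<ge> 0" if "e \<in> E" for e b
    unfolding f'_def using insert.prems(3)[OF that] assms(4) by (auto intro!: real_root_ge_zero sum_nonneg)
  have c'V: "c' e \<subseteq> V" if "e \<in> E" for e using insert.prems(1)[OF that] by (auto simp: c'_def)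
  have fc: "finite (c e)" if "e \<in> E" for e
    using insert.prems(1)[OF that] insert.hyps(1) by (meson finite_insert finite_subset)
  have "(\<Sum>\<phi>\<in>insert v V \<rightarrow>\<^sub>E X. \<Prod>e\<in>E. f e (restrict \<phi> (c e)))
      = (\<Sum>\<psi>\<in>V \<rightarrow>\<^sub>E X. \<Sum>y\<in>X. \<Prod>e\<in>E. f e (restrict (\<psi>(v := y)) (c e)))"
    using insert.hyps assms(3) by (intro sum_PiE_insert) auto
  also have "\<dots> \<le> (\<Sum>\<psi>\<in>V \<rightarrow>\<^sub>E X. \<Prod>e\<in>E. f' e (restrict \<psi> (c' e)))"
  proof (intro sum_mono)
    fix \<psi> assume "\<psi> \<in> V \<rightarrow>\<^sub>E X"
    let ?E1 = "{e \<in> E. v \<in> c e}" and ?E2 = "{e \<in> E. v \<notin> c e}"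
    have E: "E = ?E1 \<union> ?E2" by auto
    have split: "prod g E = prod g ?E1 * prod g ?E2" for g :: "'e \<Rightarrow> real"
      by (subst E, rule prod.union_disjoint) (use assms(2) in auto)
    have r1: "restrict (\<psi>(v := y)) (c e) = (restrict \<psi> (c' e))(v := y)" if "e \<in> ?E1" for e y
      using that by (auto simp: fun_eq_iff c'_def)
    have r2: "restrict (\<psi>(v := y)) (c e) = restrict \<psi> (c' e)" if "e \<in> ?E2" for e y
      using that by (auto simp: fun_eq_iff c'_def)
    have "(\<Sum>y\<in>X. \<Prod>e\<in>E. f e (restrict (\<psi>(v := y)) (c e)))
        = (\<Sum>y\<in>X. (\<Prod>e\<in>?E1. f e ((restrict \<psi> (c' e))(v := y))) * (\<Prod>e\<in>?E2. f' e (restrict \<psi> (c' e))))"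
      unfolding split
    proof (intro sum.cong refl arg_cong2[where f = "(*)"] prod.cong)
      fix y e assume "e \<in> ?E2"
      with r2[OF this] show "f e (restrict (\<psi>(v := y)) (c e)) = f' e (restrict \<psi> (c' e))"
        by (simp add: f'_def)
    qed (use r1 in simp)
    also have "\<dots> = (\<Sum>y\<in>X. \<Prod>e\<in>?E1. f e ((restrict \<psi> (c' e))(v := y))) * (\<Prod>e\<in>?E2. f' e (restrict \<psi> (c' e)))"
      by (simp add: sum_distrib_right)
    also have "\<dots> \<le> (\<Prod>e\<in>?E1. f' e (restrict \<psi> (c' e))) * (\<Prod>e\<in>?E2. f' e (restrict \<psi> (c' e)))"
    proof (intro mult_right_mono prod_nonneg)
      have "(\<Sum>y\<in>X. \<Prod>e\<in>?E1. f e ((restrict \<psi> (c' e))(v := y)))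
          \<le> (\<Prod>e\<in>?E1. root d (\<Sum>y\<in>X. f e ((restrict \<psi> (c' e))(v := y)) ^ d))"
        by (rule holder_prod_sum) (use assms(2,3,4) insert.prems(2,3) in auto)
      also have "\<dots> = (\<Prod>e\<in>?E1. f' e (restrict \<psi> (c' e)))"
        by (intro prod.cong) (auto simp: f'_def)
      finally show "(\<Sum>y\<in>X. \<Prod>e\<in>?E1. f e ((restrict \<psi> (c' e))(v := y))) \<le> (\<Prod>e\<in>?E1. f' e (restrict \<psi> (c' e)))" .
    qed (use f'nn in auto)
    also have "\<dots> = (\<Prod>e\<in>E. f' e (restrict \<psi> (c' e)))" by (rule split[symmetric])
    finally show "(\<Sum>y\<in>X. \<Prod>e\<in>E. f e (restrict (\<psi>(v := y)) (c e))) \<le> (\<Prod>e\<in>E. f' e (restrict \<psi> (c' e)))" .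
  qed
  finally have "(\<Sum>\<phi>\<in>insert v V \<rightarrow>\<^sub>E X. \<Prod>e\<in>E. f e (restrict \<phi> (c e))) ^ d
      \<le> (\<Sum>\<psi>\<in>V \<rightarrow>\<^sub>E X. \<Prod>e\<in>E. f' e (restrict \<psi> (c' e))) ^ d"
    using insert.prems(3) by (intro power_mono sum_nonneg prod_nonneg) auto
  also have "\<dots> \<le> (\<Prod>e\<in>E. \<Sum>a\<in>c' e \<rightarrow>\<^sub>E X. f' e a ^ d)"
  proof (rule insert.IH)
    fix u assume u: "u \<in> V"
    have "{e \<in> E. u \<in> c' e} = {e \<in> E. u \<in> c e}" using u insert.hyps(2) by (auto simp: c'_def)
    then show "card {e \<in> E. u \<in> c' e} = d" using insert.prems(2)[of u] u by simp
  qed (use c'V f'nn in auto)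
  also have "\<dots> = (\<Prod>e\<in>E. \<Sum>a\<in>c e \<rightarrow>\<^sub>E X. f e a ^ d)"
  proof (intro prod.cong refl)
    fix e assume e: "e \<in> E"
    show "(\<Sum>a\<in>c' e \<rightarrow>\<^sub>E X. f' e a ^ d) = (\<Sum>a\<in>c e \<rightarrow>\<^sub>E X. f e a ^ d)"
    proof (cases "v \<in> c e")
      case True
      then have ce: "c e = insert v (c' e)" by (auto simp: c'_def)
      have "(\<Sum>a\<in>c e \<rightarrow>\<^sub>E X. f e a ^ d) = (\<Sum>b\<in>c' e \<rightarrow>\<^sub>E X. \<Sum>y\<in>X. f e (b(v := y)) ^ d)"
        unfolding ce using fc[OF e] assms(3) by (intro sum_PiE_insert) (auto simp: c'_def)
      also have "\<dots> = (\<Sum>b\<in>c' e \<rightarrow>\<^sub>E X. f' e b ^ d)"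
        using True insert.prems(3)[OF e] assms(4)
        by (intro sum.cong) (auto simp: f'_def real_root_pow_pos2 sum_nonneg)
      finally show ?thesis by simp
    next
      case False
      then show ?thesis by (simp add: c'_def f'_def)
    qed
  qed
  finally show ?case .
qed

lemma (in linear_uniform) handshake:
  assumes "regular_hypergraph d H"
  shows "card (verts H) * d = k * card (hedges H)"
proof -
  have "card (verts H) * d = (\<Sum>v\<in>verts H. card {e \<in> hedges H. v \<in> e})"
    using assms by (simp add: regular_hypergraph_def)
  also have "\<dots> = (\<Sum>v\<in>verts H. \<Sum>e\<in>hedges H. of_bool (v \<in> e))"
    by (intro sum.cong refl) (simp add: of_bool_def sum.If_cases Int_def)
  also have "\<dots> = (\<Sum>e\<in>hedges H. \<Sum>v\<in>verts H. of_bool (v \<in> e))" by (rule sum.swap)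
  also have "\<dots> = (\<Sum>e\<in>hedges H. k)"
  proof (intro sum.cong refl)
    fix e assume e: "e \<in> hedges H"
    have "{v \<in> verts H. v \<in> e} = e" using hedges_subset[OF e] by auto
    then show "(\<Sum>v\<in>verts H. of_bool (v \<in> e)) = k"
      using card_hedge[OF e] by (simp add: of_bool_def sum.If_cases Int_def)
  qed
  finally show ?thesis by (simp add: mult.commute)
qed

text \<open>One function per hyperedge; by \<open>handshake\<close> the power
  \<open>real n ^ (card (verts H) * d)\<close> splits evenly into a factor \<open>real n ^ k\<close>
  for each hyperedge.\<close>

lemma (in linear_uniform) hdens_finner:
  assumes reg: "regular_hypergraph d H" and d: "d > 0" and n: "n > 0"
    and U: "\<And>M. U M \<ge> 0"
  shows "hdens n H U ^ d \<le> (tsum k (\<lambda>_. {..<n}) (\<lambda>M. U M ^ d) / real n ^ k) ^ card (hedges H)"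
proof -
  have "(\<Sum>\<phi>\<in>verts H \<rightarrow>\<^sub>E {..<n}. \<Prod>e\<in>hedges H. U (mimg (restrict \<phi> e) e)) ^ d
      \<le> (\<Prod>e\<in>hedges H. \<Sum>a\<in>e \<rightarrow>\<^sub>E {..<n}. U (mimg a e) ^ d)"
    using finner[where V = "verts H" and E = "hedges H" and X = "{..<n}" and d = d and c = "\<lambda>e. e"
        and f = "\<lambda>e a. U (mimg a e)"] reg d U hedges_subset
    by (auto simp: regular_hypergraph_def)
  also have "\<dots> = (\<Prod>e\<in>hedges H. tsum k (\<lambda>_. {..<n}) (\<lambda>M. U M ^ d))"
    using sum_mimg_const_eq_tsum[OF finite_hedge card_hedge, where D = "\<lambda>M. U M ^ d"] by (intro prod.cong) auto
  finally have "(\<Sum>\<phi>\<in>verts H \<rightarrow>\<^sub>E {..<n}. \<Prod>e\<in>hedges H. U (mimg \<phi> e)) ^ d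
      \<le> tsum k (\<lambda>_. {..<n}) (\<lambda>M. U M ^ d) ^ card (hedges H)" by simp
  then show ?thesis
    unfolding hdens_def power_divide power_mult[symmetric] handshake[OF reg]
    by (rule divide_right_mono) simp
qed

section \<open>Relative entropy and supporting lines\<close>

lemma rel_entropy_alt:
  assumes "0 < p" "p < 1" "u \<in> {0..1}"
  shows "rel_entropy p u = u * ln u + (1 - u) * ln (1 - u) - u * ln p - (1 - u) * ln (1 - p)"
proof -
  have "u * ln (u / p) = u * ln u - u * ln p"
    using assms by (cases "u = 0") (auto simp: ln_div right_diff_distrib)
  moreover have "(1 - u) * ln ((1 - u) / (1 - p)) = (1 - u) * ln (1 - u) - (1 - u) * ln (1 - p)"
    using assms by (cases "u = 1") (auto simp: ln_div right_diff_distrib)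
  ultimately show ?thesis by (simp add: rel_entropy_def)
qed

lemma continuous_on_x_ln_x: "continuous_on {0..} (\<lambda>x::real. x * ln x)"
proof (rule continuous_on_eq_continuous_within[THEN iffD2], intro ballI)
  fix x :: real assume x: "x \<in> {0..}"
  show "continuous (at x within {0..}) (\<lambda>x. x * ln x)"
  proof (cases "x = 0")
    case True
    have "((\<lambda>x::real. x * ln x) \<longlongrightarrow> 0) (at_right 0)" by real_asymp
    then have "((\<lambda>x::real. x * ln x) \<longlongrightarrow> 0 * ln 0) (at 0 within {0..})"
      by (simp add: at_within_Ici_at_right)
    then show ?thesis using True by (simp add: continuous_within)
  next
    case False
    then show ?thesis using x by (intro continuous_intros) auto
  qed
qed

lemma continuous_on_rel_entropy:
  assumes "0 < p" "p < 1"
  shows "continuous_on {0..1} (rel_entropy p)"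
proof -
  have 1: "continuous_on {0..1} (\<lambda>u::real. u * ln u)"
    by (rule continuous_on_subset[OF continuous_on_x_ln_x]) auto
  have 2: "continuous_on {0..1} (\<lambda>u::real. (1 - u) * ln (1 - u))"
    by (rule continuous_on_compose2[OF continuous_on_x_ln_x]) (auto intro!: continuous_intros)
  have "continuous_on {0..1} (\<lambda>u. u * ln u + (1 - u) * ln (1 - u) - u * ln p - (1 - u) * ln (1 - p))"
    by (intro continuous_intros 1 2)
  then show ?thesis
    by (rule continuous_on_cong[THEN iffD1, rotated 2]) (use rel_entropy_alt[OF assms] in auto)
qed

definition rel_entropy_deriv :: "real \<Rightarrow> real \<Rightarrow> real" where
  "rel_entropy_deriv p u = ln u - ln (1 - u) - ln p + ln (1 - p)"

lemma has_real_derivative_rel_entropy: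
  assumes "0 < p" "p < 1" "0 < u" "u < 1"
  shows "(rel_entropy p has_real_derivative rel_entropy_deriv p u) (at u)"
proof -
  have "((\<lambda>u. u * ln u + (1 - u) * ln (1 - u) - u * ln p - (1 - u) * ln (1 - p))
      has_real_derivative rel_entropy_deriv p u) (at u)"
    unfolding rel_entropy_deriv_def using assms
    by (auto intro!: derivative_eq_intros)
  then show ?thesis
    by (rule has_field_derivative_transform_within_open[where S = "{0<..<1}"])
      (use assms rel_entropy_alt in auto)
qed

lemma has_real_derivative_rel_entropy_deriv:
  assumes "0 < u" "u < 1"
  shows "(rel_entropy_deriv p has_real_derivative 1 / (u * (1 - u))) (at u)"
  unfolding rel_entropy_deriv_def using assms
  by (auto intro!: derivative_eq_intros simp: field_simps)

text \<open>Applied to \<open>(u, p)\<close> and to \<open>(1 - u, 1 - p)\<close>, the linear lower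
  bounds cancel and give nonnegativity of \<open>rel_entropy\<close>.\<close>

lemma mult_ln_ge:
  assumes "x \<ge> 0" "q > (0::real)"
  shows "x * ln (x / q) \<ge> x - q" and "x \<noteq> q \<Longrightarrow> x * ln (x / q) > x - q"
proof -
  have *: "x * ln (x / q) - (x - q) = x * ((q / x - 1) - ln (q / x))" if "x > 0"
    using that assms by (simp add: ln_div algebra_simps)
  have "ln (q / x) \<le> q / x - 1" if "x > 0"
    using that assms by (intro ln_le_minus_one) auto
  then have "x * ((q / x - 1) - ln (q / x)) \<ge> 0" if "x > 0"
    using that by (intro mult_nonneg_nonneg) auto
  with * assms show 1: "x * ln (x / q) \<ge> x - q" by (cases "x = 0") auto
  assume "x \<noteq> q"
  have "x * ((q / x - 1) - ln (q / x)) > 0" if "x > 0"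
  proof -
    have "ln (q / x) \<noteq> q / x - 1"
      using that assms \<open>x \<noteq> q\<close> ln_eq_minus_one[of "q / x"] by auto
    moreover have "ln (q / x) \<le> q / x - 1" using that assms by (intro ln_le_minus_one) auto
    ultimately show ?thesis using that by (intro mult_pos_pos) auto
  qed
  with * assms show "x * ln (x / q) > x - q" by (cases "x = 0") auto
qed

lemma rel_entropy_nonneg:
  assumes "0 < p" "p < 1" "u \<in> {0..1}"
  shows "0 \<le> rel_entropy p u"
    and "u \<noteq> p \<Longrightarrow> 0 < rel_entropy p u"
  using mult_ln_ge[of u p] mult_ln_ge[of "1 - u" "1 - p"] assms
  by (auto simp: rel_entropy_def)

lemma rel_entropy_self [simp]: "0 < p \<Longrightarrow> p < 1 \<Longrightarrow> rel_entropy p p = 0"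
  by (simp add: rel_entropy_def)

text \<open>Entropies with different reference values differ by an affine function, so the remainder
  of the first-order expansion at \<open>r\<close> is again an entropy, now relative to
  \<open>r\<close>.\<close>

lemma rel_entropy_tangent:
  assumes "0 < p" "p < 1" "0 < r" "r < 1" "u \<in> {0..1}"
  shows "rel_entropy p u = rel_entropy p r + rel_entropy_deriv p r * (u - r) + rel_entropy r u"
  using assms by (simp add: rel_entropy_alt rel_entropy_deriv_def algebra_simps)

lemma rel_entropy_ge_tangent:
  assumes "0 < p" "p < 1" "0 < r" "r < 1" "u \<in> {0..1}"
  shows "rel_entropy p u \<ge> rel_entropy p r + rel_entropy_deriv p r * (u - r)"
  using rel_entropy_tangent[OF assms] rel_entropy_nonneg(1)[of r u] assms by simp

lemma rel_entropy_deriv_nonneg: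
  assumes "0 < p" "p \<le> r" "r < 1"
  shows "rel_entropy_deriv p r \<ge> 0"
proof -
  have "ln p \<le> ln r" "ln (1 - r) \<le> ln (1 - p)" using assms by auto
  then show ?thesis by (simp add: rel_entropy_deriv_def)
qed

lemma rel_entropy_deriv_pos:
  assumes "0 < p" "p < r" "r < 1"
  shows "rel_entropy_deriv p r > 0"
proof -
  have "ln p < ln r" "ln (1 - r) < ln (1 - p)" using assms by auto
  then show ?thesis by (simp add: rel_entropy_deriv_def)
qed

text \<open>Convexity on the segment from \<open>u\<close> to \<open>1\<close>, read off from the
  tangent at the intermediate point; the factor \<open>1 - t\<close> of the first term is dropped by
  nonnegativity. At \<open>u = 1\<close> the intermediate point is an endpoint without a tangent,
  hence the separate case.\<close>

lemma rel_entropy_boost: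
  assumes "0 < p" "p < 1" "u \<in> {0..1}" "0 < t" "t < 1"
  shows "rel_entropy p ((1 - t) * u + t) \<le> rel_entropy p u + t * rel_entropy p 1"
proof -
  let ?v = "(1 - t) * u + t"
  have nn: "t * rel_entropy p u \<ge> 0" using assms rel_entropy_nonneg(1) by auto
  show ?thesis
  proof (cases "u = 1")
    case True
    then show ?thesis using assms rel_entropy_nonneg(1)[of p 1] by simp
  next
    case False
    have v: "0 < ?v" using assms by (intro add_nonneg_pos) auto
    have "(1 - t) * (1 - u) > 0" using assms False by auto
    then have v1: "?v < 1" by (simp add: algebra_simps)
    let ?D = "rel_entropy_deriv p ?v"
    have "(1 - t) * rel_entropy p u \<ge> (1 - t) * (rel_entropy p ?v + ?D * (u - ?v))"
      using assms v v1 by (intro mult_left_mono rel_entropy_ge_tangent) auto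
    moreover have "t * rel_entropy p 1 \<ge> t * (rel_entropy p ?v + ?D * (1 - ?v))"
      using assms v v1 by (intro mult_left_mono rel_entropy_ge_tangent) auto
    moreover have "(1 - t) * (rel_entropy p ?v + ?D * (u - ?v)) + t * (rel_entropy p ?v + ?D * (1 - ?v)) = rel_entropy p ?v"
      by (simp add: algebra_simps)
    ultimately show ?thesis using nn by (simp add: algebra_simps)
  qed
qed

text \<open>Touching the convex minorant at an interior point means having a supporting line there,
  and the substitution \<open>x = u ^ d\<close> removes the root. The right-hand side is the form in
  which the two phases are treated.\<close>

lemma on_convex_minorant_iff:
  assumes "0 < p" "p < 1" "0 < r" "r < 1" "d > 0"
  shows "convex_minorant (\<lambda>x. rel_entropy p (root d x)) (r ^ d) = rel_entropy p r \<longleftrightarrow>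
    (\<exists>\<kappa>. \<forall>u\<in>{0..1}. rel_entropy p u \<ge> rel_entropy p r + \<kappa> * (u ^ d - r ^ d))" (is "?L \<longleftrightarrow> ?R")
proof -
  let ?\<psi> = "\<lambda>x. rel_entropy p (root d x)"
  have root01: "root d y \<in> {0..1}" if "y \<in> {0..1}" for y
    using that assms by auto
  have nn: "0 \<le> ?\<psi> y" if "y \<in> {0..1}" for y
    using rel_entropy_nonneg(1)[OF assms(1,2) root01[OF that]] .
  have rd: "0 < r ^ d" "r ^ d < 1" using assms by (auto simp: power_less_one_iff)
  have \<psi>r: "?\<psi> (u ^ d) = rel_entropy p u" if "u \<ge> 0" for u
    using that assms by (simp add: real_root_power_cancel)
  show ?thesis
  proof
    assume L: ?L
    let ?c = "convex_minorant ?\<psi>"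
    \<comment> \<open>The right derivative of the minorant at \<open>r ^ d\<close>, as the infimum
      of its difference quotients.\<close>
    let ?\<kappa> = "Inf ((\<lambda>t. (?c (r ^ d) - ?c t) / (r ^ d - t)) ` ({r ^ d<..} \<inter> {0..1}))"
    have conv: "convex_on {0..1} ?c" by (rule convex_on_convex_minorant[of 0]) (use nn in auto)
    show ?R
    proof (intro exI ballI)
      fix u :: real assume u: "u \<in> {0..1}"
      then have ud: "u ^ d \<in> {0..1}" by (auto simp: power_le_one)
      have "?c (u ^ d) \<ge> ?c (r ^ d) + ?\<kappa> * (u ^ d - r ^ d)"
        by (rule convex_le_Inf_differential[OF conv _ ud]) (use rd in auto)
      moreover have "?c (u ^ d) \<le> ?\<psi> (u ^ d)" by (rule convex_minorant_le[of 0]) (use nn ud in auto)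
      ultimately show "rel_entropy p u \<ge> rel_entropy p r + ?\<kappa> * (u ^ d - r ^ d)"
        using L \<psi>r[of u] u by auto
    qed
  next
    assume ?R
    then obtain \<kappa> where \<kappa>: "\<And>u. u \<in> {0..1} \<Longrightarrow> rel_entropy p u \<ge> rel_entropy p r + \<kappa> * (u ^ d - r ^ d)" by blast
    have "rel_entropy p r + \<kappa> * (r ^ d - r ^ d) \<le> convex_minorant ?\<psi> (r ^ d)"
    proof (rule convex_minorant_upper[where g = "\<lambda>x. rel_entropy p r + \<kappa> * (x - r ^ d)"])
      show "convex_on {0..1} (\<lambda>x. rel_entropy p r + \<kappa> * (x - r ^ d))"
        by (rule convex_onI) (simp_all add: algebra_simps)
      show "rel_entropy p r + \<kappa> * (y - r ^ d) \<le> ?\<psi> y" if "y \<in> {0..1}" for y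
        using \<kappa>[OF root01[OF that]] that assms by (simp add: real_root_pow_pos2)
    qed (use rd in auto)
    moreover have "convex_minorant ?\<psi> (r ^ d) \<le> ?\<psi> (r ^ d)"
      by (rule convex_minorant_le[of 0]) (use nn rd in auto)
    ultimately show ?L using \<psi>r[of r] assms by simp
  qed
qed

text \<open>The difference of the two sides has a minimum at the interior point \<open>r\<close>,
  which forces the slope of a supporting line.\<close>

lemma supporting_slope_eq:
  assumes "0 < p" "p < 1" "0 < r" "r < 1"
    and \<kappa>: "\<And>u. u \<in> {0..1} \<Longrightarrow> rel_entropy p u \<ge> rel_entropy p r + \<kappa> * (u ^ d - r ^ d)"
  shows "\<kappa> * (real d * r ^ (d - 1)) = rel_entropy_deriv p r"
proof -
  let ?F = "\<lambda>u. rel_entropy p u - \<kappa> * u ^ d"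
  have der: "(?F has_real_derivative rel_entropy_deriv p r - \<kappa> * (real d * r ^ (d - 1))) (at r)"
    using has_real_derivative_rel_entropy[OF assms(1-4)]
    by (auto intro!: derivative_eq_intros)
  have min: "\<forall>y. \<bar>r - y\<bar> < min r (1 - r) \<longrightarrow> ?F r \<le> ?F y"
  proof (intro allI impI)
    fix y assume "\<bar>r - y\<bar> < min r (1 - r)"
    then have "y \<in> {0..1}" by auto
    from \<kappa>[OF this] show "?F r \<le> ?F y" by (simp add: algebra_simps)
  qed
  have "rel_entropy_deriv p r - \<kappa> * (real d * r ^ (d - 1)) = 0"
    by (rule DERIV_local_min[OF der _ min]) (use assms in auto)
  then show ?thesis by simp
qed

text \<open>If, in the variable \<open>u ^ d\<close>, every chord slope from the left were at most
  every chord slope to the right, the supremum of the former would be a supporting slope. The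
  conclusion is the failure of this comparison with denominators cleared: the point at
  \<open>r\<close> lies above the chord from \<open>r1\<close> to \<open>r2\<close>.\<close>

lemma chord_below:
  assumes "0 < r" "r < 1" "d > 0"
    and no: "\<not> (\<exists>\<kappa>. \<forall>u\<in>{0..1}. f u \<ge> f r + \<kappa> * (u ^ d - r ^ d))"
  obtains r1 r2 :: real where "0 \<le> r1" "r1 < r" "r < r2" "r2 \<le> 1"
    "(f r2 - f r) * (r ^ d - r1 ^ d) < (f r - f r1) * (r2 ^ d - r ^ d)"
proof (rule ccontr)
  assume "\<not> thesis"
  with that have le: "(f r - f r1) * (r2 ^ d - r ^ d) \<le> (f r2 - f r) * (r ^ d - r1 ^ d)"
    if "0 \<le> r1" "r1 < r" "r < r2" "r2 \<le> 1" for r1 r2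
    using that by (meson not_le)
  have pw: "u ^ d < v ^ d" if "0 \<le> u" "u < v" for u v :: real
    using that assms(3) by (intro power_strict_mono) auto
  define s where "s u = (f r - f u) / (r ^ d - u ^ d)" for u
  define \<kappa> where "\<kappa> = (SUP u\<in>{0..<r}. s u)"
  have s_le: "s r1 \<le> (f r2 - f r) / (r2 ^ d - r ^ d)" if "r1 \<in> {0..<r}" "r < r2" "r2 \<le> 1" for r1 r2
    using le[of r1 r2] pw[of r1 r] pw[of r r2] that assms(1) by (simp add: s_def divide_simps mult.commute)
  have bdd: "bdd_above (s ` {0..<r})"
    using s_le[of _ 1] assms by (intro bdd_aboveI[where M = "(f 1 - f r) / (1 ^ d - r ^ d)"]) auto
  have "f u \<ge> f r + \<kappa> * (u ^ d - r ^ d)" if u: "u \<in> {0..1}" for u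
  proof (cases u r rule: linorder_cases)
    case less
    then have "s u \<le> \<kappa>" unfolding \<kappa>_def using u bdd by (intro cSUP_upper) auto
    then have "f r - f u \<le> \<kappa> * (r ^ d - u ^ d)"
      using pw[of u r] less u by (simp add: s_def divide_simps)
    then show ?thesis by (simp add: algebra_simps)
  next
    case greater
    have "\<kappa> \<le> (f u - f r) / (u ^ d - r ^ d)"
      unfolding \<kappa>_def using s_le[of _ u] greater u assms by (intro cSUP_least) auto
    then have "\<kappa> * (u ^ d - r ^ d) \<le> f u - f r"
      using pw[of r u] greater assms by (simp add: pos_le_divide_eq)
    then show ?thesis by simp
  qed simp
  with no show False by blast
qed

text \<open>The weights will be numbers of vertices in \<open>perturb\<close>, hence natural
  numbers. Weights that balance the mean of the \<open>d\<close>-th powers exactly at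
  \<open>r ^ d\<close> already lower the mean of \<open>f\<close>; a small shift towards
  \<open>r2\<close> makes both inequalities strict. The ratio \<open>a / b\<close> may range over an
  open interval, so a rational one exists.\<close>

lemma natural_weights_below:
  assumes "0 < r" "r < 1" "d > 0"
    and "\<not> (\<exists>\<kappa>. \<forall>u\<in>{0..1}. f u \<ge> f r + \<kappa> * (u ^ d - r ^ d))"
  obtains r1 r2 :: real and a b :: nat where "r1 \<in> {0..1}" "r2 \<in> {0..1}" "a > 0" "b > 0"
    "real a * r1 ^ d + real b * r2 ^ d > real (a + b) * r ^ d"
    "real a * f r1 + real b * f r2 < real (a + b) * f r"
proof -
  obtain r1 r2 where r12: "0 \<le> r1" "r1 < r" "r < r2" "r2 \<le> 1"
    and lt: "(f r2 - f r) * (r ^ d - r1 ^ d) < (f r - f r1) * (r2 ^ d - r ^ d)"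
    by (rule chord_below[OF assms])
  define X1 X2 Y1 Y2 where "X1 = r ^ d - r1 ^ d" and "X2 = r2 ^ d - r ^ d"
    and "Y1 = f r - f r1" and "Y2 = f r2 - f r"
  have X: "X1 > 0" "X2 > 0" unfolding X1_def X2_def using r12 assms by (auto intro!: power_strict_mono)
  have lt': "Y2 * X1 < Y1 * X2" using lt by (simp add: X1_def X2_def Y1_def Y2_def)
  have "\<exists>q\<in>\<rat>. 0 < q \<and> q < X2 / X1 \<and> q * Y1 > Y2"
  proof (cases "Y1 > 0")
    case True
    have "Y2 / Y1 < X2 / X1" using X True lt' by (simp add: divide_simps mult.commute)
    then have "max 0 (Y2 / Y1) < X2 / X1" using X by auto
    then obtain q where "q \<in> \<rat>" "max 0 (Y2 / Y1) < q" "q < X2 / X1" using Rats_dense_in_real by blast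
    then show ?thesis using True by (auto simp: divide_simps intro!: bexI[of _ q])
  next
    \<comment> \<open>Here a smaller ratio only helps the second inequality, so any positive
      rational below \<open>X2 / X1\<close> will do.\<close>
    case False
    obtain q where q: "q \<in> \<rat>" "0 < q" "q < X2 / X1" using Rats_dense_in_real[of 0 "X2 / X1"] X by auto
    have "Y2 < Y1 * (X2 / X1)" using lt' X by (simp add: divide_simps)
    also have "\<dots> \<le> Y1 * q" using q False by (intro mult_left_mono_neg) auto
    finally show ?thesis using q by (auto simp: mult.commute)
  qed
  then obtain q where q: "q \<in> \<rat>" "0 < q" "q < X2 / X1" "q * Y1 > Y2" by blast
  then obtain a b :: nat where ab: "b \<noteq> 0" "\<bar>q\<bar> = real a / real b" using Rats_abs_nat_div_natE by metis
  then have qab: "q = real a / real b" and b: "b > 0" using q by auto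
  have a: "a > 0" using qab q(2) b by (auto simp: zero_less_divide_iff)
  have 1: "real a * X1 < real b * X2" using q(3) X b unfolding qab by (simp add: divide_simps mult.commute)
  have 2: "real a * Y1 > real b * Y2" using q(4) b unfolding qab by (simp add: divide_simps mult.commute)
  show thesis
  proof (rule that[of r1 r2 a b])
    show "real a * r1 ^ d + real b * r2 ^ d > real (a + b) * r ^ d"
      using 1 by (simp add: X1_def X2_def algebra_simps)
    show "real a * f r1 + real b * f r2 < real (a + b) * f r"
      using 2 by (simp add: Y1_def Y2_def algebra_simps)
  qed (use r12 assms a b in auto)
qed

section \<open>Stability of the symmetric minimiser\<close>

text \<open>If the tangent line touched on both sides of \<open>r\<close>, Rolle's theorem would put \<open>r\<close>
  strictly between two zeros of the second derivative
  \<open>(1 - \<kappa> d (d - 1) u\<^bsup>d - 1\<^esup> (1 - u)) / (u (1 - u))\<close>, where that is negative because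
  \<open>u\<^bsup>d - 1\<^esup> (1 - u)\<close> is unimodal; but \<open>r\<close> is a minimum.\<close>

lemma not_tangent_both_sides:
  assumes "0 < p" "p < 1" "0 < r" "r < 1" "d \<ge> 2"
    and \<kappa>: "\<And>u. u \<in> {0..1} \<Longrightarrow> rel_entropy p u \<ge> rel_entropy p r + \<kappa> * (u ^ d - r ^ d)"
    and "0 \<le> u1" "u1 < r" "r < u2" "u2 \<le> 1"
    and u1: "rel_entropy p u1 = rel_entropy p r + \<kappa> * (u1 ^ d - r ^ d)"
    and u2: "rel_entropy p u2 = rel_entropy p r + \<kappa> * (u2 ^ d - r ^ d)"
  shows False
proof -
  define F where "F u = rel_entropy p u - rel_entropy p r - \<kappa> * (u ^ d - r ^ d)" for u
  define F' where "F' u = rel_entropy_deriv p u - \<kappa> * (real d * u ^ (d - 1))" for u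
  define C where "C = \<kappa> * real d * real (d - 1)"
  define G where "G u = u ^ (d - 1) * (1 - u)" for u :: real
  have dF: "(F has_real_derivative F' u) (at u)" if "0 < u" "u < 1" for u
    unfolding F_def F'_def using has_real_derivative_rel_entropy[OF assms(1,2) that]
    by (auto intro!: derivative_eq_intros)
  have dF': "(F' has_real_derivative (1 - C * G u) / (u * (1 - u))) (at u)" if "0 < u" "u < 1" for u
  proof -
    have "u ^ (d - 1) = u * u ^ (d - 2)" using assms(5) by (simp flip: power_Suc add: Suc_diff_Suc numeral_2_eq_2)
    then have "(1 - C * G u) / (u * (1 - u)) = 1 / (u * (1 - u)) - \<kappa> * (real d * (real (d - 1) * u ^ (d - 2)))"
      using that by (simp add: C_def G_def divide_simps)
    moreover have "((\<lambda>u. \<kappa> * (real d * u ^ (d - 1))) has_real_derivative \<kappa> * (real d * (real (d - 1) * u ^ (d - 2)))) (at u)"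
      by (auto intro!: derivative_eq_intros simp: numeral_2_eq_2)
    ultimately show ?thesis
      unfolding F'_def using has_real_derivative_rel_entropy_deriv[OF that]
      by (auto intro!: DERIV_diff)
  qed
  have contF: "continuous_on {0..1} F"
    unfolding F_def by (intro continuous_intros continuous_on_rel_entropy assms)
  have F0: "F u1 = 0" "F r = 0" "F u2 = 0" using u1 u2 by (auto simp: F_def)
  have Fnn: "F u \<ge> 0" if "u \<in> {0..1}" for u using \<kappa>[OF that] by (simp add: F_def)
  have F'r: "F' r = 0"
    using supporting_slope_eq[OF assms(1-4) \<kappa>] by (simp add: F'_def)
  have rolle: "\<exists>m>x. m < y \<and> F' m = 0" if "0 \<le> x" "x < y" "y \<le> 1" "F x = F y" for x y
  proof -
    have "continuous_on {x..y} F" using that by (intro continuous_on_subset[OF contF]) auto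
    from Rolle_deriv[OF that(2,4) this, of "\<lambda>u v. F' u * v"] that dF
    obtain m where "x < m" "m < y" "(\<lambda>v. F' m * v) = (\<lambda>v. 0)"
      by (auto simp: has_field_derivative_def)
    then show ?thesis by (metis mult.right_neutral)
  qed
  obtain m1 where m1: "u1 < m1" "m1 < r" "F' m1 = 0" using rolle[of u1 r] F0 assms by auto
  obtain m2 where m2: "r < m2" "m2 < u2" "F' m2 = 0" using rolle[of r u2] F0 assms by auto
  have mvt': "\<exists>z>x. z < y \<and> F' y - F' x = (y - x) * ((1 - C * G z) / (z * (1 - z)))"
    if "0 < x" "x < y" "y < 1" for x y
    using MVT2[OF that(2), of F' "\<lambda>z. (1 - C * G z) / (z * (1 - z))"] dF' that by auto
  obtain z1 where z1: "m1 < z1" "z1 < r" "C * G z1 = 1"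
    using mvt'[of m1 r] m1 assms F'r by force
  obtain z2 where z2: "r < z2" "z2 < m2" "C * G z2 = 1"
    using mvt'[of r m2] m2 assms F'r by force
  have z01: "0 < z1" "z2 < 1" using z1 z2 m1 m2 assms by auto
  have Cpos: "C > 0"
  proof -
    have "G z1 > 0" using z01 z1 assms by (auto simp: G_def)
    then show ?thesis using z1(3) by (metis zero_less_mult_pos2 zero_less_one)
  qed
  have dG: "(G has_real_derivative u ^ (d - 2) * (real (d - 1) - real d * u)) (at u)" for u
  proof -
    obtain m where m: "d = Suc (Suc m)" using assms(5) by (metis Suc_le_D numeral_2_eq_2 Suc_le_mono)
    have "((\<lambda>u. u ^ Suc m) has_real_derivative real (Suc m) * u ^ m) (at u)"
      using DERIV_pow[of "Suc m" u] by simp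
    moreover have "((\<lambda>u. 1 - u) has_real_derivative - 1) (at u)"
      by (auto intro!: derivative_eq_intros)
    ultimately have "((\<lambda>u. u ^ Suc m * (1 - u)) has_real_derivative
        real (Suc m) * u ^ m * (1 - u) + (- 1) * u ^ Suc m) (at u)"
      by (rule DERIV_mult)
    moreover have "real (Suc m) * u ^ m * (1 - u) + (- 1) * u ^ Suc m = u ^ m * (real (Suc m) - real (Suc (Suc m)) * u)"
      by (simp add: algebra_simps)
    ultimately show ?thesis unfolding G_def m by simp
  qed
  have mvtG: "\<exists>z>x. z < y \<and> G y - G x = (y - x) * (z ^ (d - 2) * (real (d - 1) - real d * z))"
    if "x < y" for x y
    using MVT2[OF that dG] by blast
  \<comment> \<open>If \<open>G\<close> dropped to its common value at \<open>z1\<close> and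
    \<open>z2\<close> or below in between, the mean value theorem would give a point where the
    derivative is nonpositive followed by one where it is nonnegative; but its linear factor is
    decreasing.\<close>
  have G_mid: "C * G u > 1" if "z1 < u" "u < z2" for u
  proof (rule ccontr)
    assume "\<not> C * G u > 1"
    then have le: "G u \<le> G z1" "G u \<le> G z2"
      using z1(3) z2(3) Cpos by (metis mult_le_cancel_left_pos not_le)+
    obtain y1 where y1: "z1 < y1" "y1 < u" "G u - G z1 = (u - z1) * (y1 ^ (d - 2) * (real (d - 1) - real d * y1))"
      using mvtG[OF \<open>z1 < u\<close>] by blast
    obtain y2 where y2: "u < y2" "y2 < z2" "G z2 - G u = (z2 - u) * (y2 ^ (d - 2) * (real (d - 1) - real d * y2))"
      using mvtG[OF \<open>u < z2\<close>] by blast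
    have pos: "y1 ^ (d - 2) > 0" "y2 ^ (d - 2) > 0" using y1 y2 z01 by auto
    have "(u - z1) * (y1 ^ (d - 2) * (real (d - 1) - real d * y1)) \<le> 0" using le y1 by simp
    then have "real (d - 1) - real d * y1 \<le> 0" using pos that by (auto simp: mult_le_0_iff)
    moreover have "(z2 - u) * (y2 ^ (d - 2) * (real (d - 1) - real d * y2)) \<ge> 0" using le y2 by simp
    then have "real (d - 1) - real d * y2 \<ge> 0" using pos that by (auto simp: zero_le_mult_iff)
    moreover have "real d * y1 < real d * y2" using y1 y2 assms(5) by auto
    ultimately show False by linarith
  qed
  \<comment> \<open>Between \<open>z1\<close> and \<open>r\<close> the second derivative is
    negative, so \<open>F'\<close> decreases to its zero at \<open>r\<close> and is positive before.
    Then \<open>F\<close> increases to \<open>F r = 0\<close> and is negative just left of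
    \<open>r\<close>.\<close>
  have F'_pos: "F' x > 0" if "z1 < x" "x < r" for x
  proof -
    obtain z where z: "x < z" "z < r" "F' r - F' x = (r - x) * ((1 - C * G z) / (z * (1 - z)))"
      using mvt'[of x r] \<open>z1 < x\<close> \<open>x < r\<close> z01 assms(4) by auto
    have "(1 - C * G z) / (z * (1 - z)) < 0"
      using G_mid[of z] z that z2 z01 assms by (intro divide_neg_pos) auto
    then have "(r - x) * ((1 - C * G z) / (z * (1 - z))) < 0" using that by (intro mult_pos_neg) auto
    with z F'r show ?thesis by simp
  qed
  define x where "x = (z1 + r) / 2"
  have x: "z1 < x" "x < r" using z1 by (auto simp: x_def)
  obtain z where z: "x < z" "z < r" "F r - F x = (r - x) * F' z"
    using MVT2[OF x(2), of F F'] dF x z01 assms by auto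
  have "(r - x) * F' z > 0" using z x F'_pos[of z] by (intro mult_pos_pos) auto
  then have "F x < 0" using z F0 by simp
  moreover have "F x \<ge> 0" using x z01 assms by (intro Fnn) auto
  ultimately show False by simp
qed

text \<open>On the compact set where \<open>g \<ge> \<epsilon>\<close> the function \<open>F\<close>
  has a positive minimum; its reciprocal serves as \<open>C\<close> because
  \<open>g \<le> 1\<close>. A small mean of \<open>F\<close> then forces a small mean of the
  positive part of \<open>g\<close>.\<close>

lemma dominated_off_zeros:
  fixes F g :: "real \<Rightarrow> real"
  assumes F: "continuous_on {0..1} F" "\<And>u. u \<in> {0..1} \<Longrightarrow> F u \<ge> 0"
    and g: "continuous_on {0..1} g" "\<And>u. u \<in> {0..1} \<Longrightarrow> g u \<le> 1"
    and pos: "\<And>u. u \<in> {0..1} \<Longrightarrow> g u > 0 \<Longrightarrow> F u > 0"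
    and "\<epsilon> > 0"
  obtains C where "C \<ge> 0" "\<And>u. u \<in> {0..1} \<Longrightarrow> max 0 (g u) \<le> \<epsilon> + C * F u"
proof (cases "{u \<in> {0..1}. g u \<ge> \<epsilon>} = {}")
  case True
  have "max 0 (g u) \<le> \<epsilon> + 0 * F u" if "u \<in> {0..1}" for u
  proof -
    have "\<not> g u \<ge> \<epsilon>" using True that by blast
    then show ?thesis using \<open>\<epsilon> > 0\<close> by simp
  qed
  then show thesis by (intro that[of 0]) auto
next
  case False
  let ?S = "{u \<in> {0..1}. g u \<ge> \<epsilon>}"
  have "closed ?S"
    using continuous_closed_preimage[OF g(1), of "{\<epsilon>..}"] by (simp add: vimage_def Int_def)
  moreover have "bounded ?S" by (rule bounded_subset[of "{0..1}"]) auto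
  ultimately have "compact ?S" by (simp add: compact_eq_bounded_closed)
  moreover have "continuous_on ?S F" by (rule continuous_on_subset[OF F(1)]) auto
  ultimately obtain u0 where u0: "u0 \<in> ?S" "\<And>u. u \<in> ?S \<Longrightarrow> F u0 \<le> F u"
    using continuous_attains_inf[of ?S F] False by blast
  have c: "F u0 > 0" using u0(1) \<open>\<epsilon> > 0\<close> by (intro pos) auto
  show thesis
  proof (rule that[of "1 / F u0"])
    fix u :: real assume u: "u \<in> {0..1}"
    show "max 0 (g u) \<le> \<epsilon> + 1 / F u0 * F u"
    proof (cases "g u \<ge> \<epsilon>")
      case True
      then have "F u / F u0 \<ge> 1" using u0(2)[of u] u c by (simp add: le_divide_eq_1)
      then show ?thesis using g(2)[OF u] \<open>\<epsilon> > 0\<close> by simp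
    next
      case False
      have "1 / F u0 * F u \<ge> 0" using c F(2)[OF u] by simp
      then show ?thesis using False \<open>\<epsilon> > 0\<close> by linarith
    qed
  qed (use c in auto)
qed

definition avg :: "'e set \<Rightarrow> ('e \<Rightarrow> real) \<Rightarrow> real" where
  "avg K f = sum f K / real (card K)"

lemma avg_mono: "(\<And>e. e \<in> K \<Longrightarrow> f e \<le> g e) \<Longrightarrow> avg K f \<le> avg K g"
  unfolding avg_def by (intro divide_right_mono sum_mono) auto

lemma avg_add: "avg K (\<lambda>e. f e + g e) = avg K f + avg K g"
  and avg_diff: "avg K (\<lambda>e. f e - g e) = avg K f - avg K g"
  and avg_cmult: "avg K (\<lambda>e. c * f e) = c * avg K f"
  by (simp_all add: avg_def sum.distrib sum_subtractf add_divide_distrib diff_divide_distrib sum_distrib_left)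

lemma avg_const: "finite K \<Longrightarrow> K \<noteq> {} \<Longrightarrow> avg K (\<lambda>e. c) = c"
  by (simp add: avg_def)

lemma avg_cong: "(\<And>e. e \<in> K \<Longrightarrow> f e = g e) \<Longrightarrow> avg K f = avg K g"
  by (simp add: avg_def)

text \<open>\<open>u - r\<close> divides \<open>u ^ d - r ^ d\<close>, and the cofactor has
  nonnegative terms, among them \<open>r ^ (d - 1)\<close>.\<close>

lemma power_diff_ge:
  fixes r u :: real
  assumes "r > 0" "u \<ge> 0" "d > 0"
  shows "\<bar>u - r\<bar> * r ^ (d - 1) \<le> \<bar>u ^ d - r ^ d\<bar>"
proof -
  obtain m where m: "d = Suc m" using assms(3) by (cases d) auto
  have "r ^ m = u ^ 0 * r ^ (m - 0)" by simp
  also have "\<dots> \<le> (\<Sum>i<Suc m. u ^ i * r ^ (m - i))"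
    using assms by (intro member_le_sum) auto
  finally have "\<bar>u - r\<bar> * r ^ m \<le> \<bar>u - r\<bar> * (\<Sum>i<Suc m. u ^ i * r ^ (m - i))"
    by (intro mult_left_mono) auto
  also have "\<dots> = \<bar>(u - r) * (\<Sum>i<Suc m. u ^ i * r ^ (m - i))\<bar>"
  proof -
    have "(\<Sum>i<Suc m. u ^ i * r ^ (m - i)) \<ge> 0" using assms by (intro sum_nonneg) auto
    then show ?thesis by (simp only: abs_mult abs_of_nonneg)
  qed
  also have "\<dots> = \<bar>u ^ d - r ^ d\<bar>"
    unfolding m by (subst diff_power_eq_sum) (simp add: mult.commute)
  finally show ?thesis by (simp add: m)
qed

text \<open>\<open>F\<close> is the height above the supporting line, and its mean is small. On a
  side of \<open>r\<close> where \<open>F > 0\<close> this controls the deviation of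
  \<open>w ^ d\<close>. The deviation on the other side follows from the mean of
  \<open>w ^ d - r ^ d\<close>, which is bounded below by hypothesis and, for
  \<open>\<kappa> > 0\<close>, above through the cost. The sign \<open>s\<close> marks the
  controlled side: \<open>1\<close> for values above \<open>r\<close>, \<open>- 1\<close> for values
  below.\<close>

lemma replica_stability:
  assumes "0 < p" "p \<le> r" "r < 1" "d \<ge> 2"
    and \<kappa>: "\<And>u. u \<in> {0..1} \<Longrightarrow> rel_entropy p u \<ge> rel_entropy p r + \<kappa> * (u ^ d - r ^ d)"
    and "\<epsilon> > 0"
  obtains \<eta> where "\<eta> > 0"
    "\<And>(K :: 'e set) w. finite K \<Longrightarrow> K \<noteq> {} \<Longrightarrow> (\<And>e. e \<in> K \<Longrightarrow> w e \<in> {0..1}) \<Longrightarrow>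
       avg K (\<lambda>e. w e ^ d) \<ge> r ^ d - \<eta> \<Longrightarrow> avg K (\<lambda>e. rel_entropy p (w e)) \<le> rel_entropy p r + \<eta> \<Longrightarrow>
       avg K (\<lambda>e. \<bar>w e - r\<bar>) \<le> \<epsilon>"
proof -
  have p1: "p < 1" and r0: "0 < r" using assms by auto
  define F where "F u = rel_entropy p u - rel_entropy p r - \<kappa> * (u ^ d - r ^ d)" for u
  have contF: "continuous_on {0..1} F"
    unfolding F_def by (intro continuous_intros continuous_on_rel_entropy assms p1)
  have Fnn: "F u \<ge> 0" if "u \<in> {0..1}" for u using \<kappa>[OF that] by (simp add: F_def)
  have slope: "\<kappa> * (real d * r ^ (d - 1)) = rel_entropy_deriv p r"
    by (rule supporting_slope_eq[OF assms(1) p1 r0 assms(3) \<kappa>])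
  have dpos: "real d * r ^ (d - 1) > 0" using r0 assms(4) by auto
  have \<kappa>pos: "\<kappa> > 0" if "p < r"
    using rel_entropy_deriv_pos[OF assms(1) that assms(3)] dpos unfolding slope[symmetric]
    by (metis zero_less_mult_pos2)
  have \<kappa>nn: "\<kappa> \<ge> 0"
    using \<kappa>pos rel_entropy_deriv_nonneg[OF assms(1-3)] dpos unfolding slope[symmetric]
    by (metis zero_le_mult_iff not_le)
  have \<kappa>0: "\<kappa> = 0" if "p = r"
  proof -
    have "rel_entropy_deriv p r = 0" using that by (simp add: rel_entropy_deriv_def)
    with slope show ?thesis using r0 assms(4) by auto
  qed
  \<comment> \<open>For \<open>p = r\<close> the slope is \<open>0\<close> and \<open>F\<close> is
    the entropy itself, with its only zero at \<open>r\<close>. The option left of \<open>r\<close>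
    is tied to \<open>p < r\<close>, since it requires \<open>\<kappa> > 0\<close>.\<close>
  have sides: "(p < r \<and> (\<forall>u\<in>{0..1}. u < r \<longrightarrow> F u > 0)) \<or> (\<forall>u\<in>{0..1}. r < u \<longrightarrow> F u > 0)"
  proof (cases "p = r")
    case True
    then show ?thesis using rel_entropy_nonneg(2)[OF assms(1) p1] \<kappa>0 assms(1) p1 by (auto simp: F_def)
  next
    case False
    show ?thesis
    proof (rule ccontr)
      assume neg: "\<not> ?thesis"
      moreover have "p < r" using False assms(2) by simp
      ultimately have "\<not> (\<forall>u\<in>{0..1}. u < r \<longrightarrow> F u > 0)" by blast
      then obtain u1 where u1: "u1 \<in> {0..1}" "u1 < r" "\<not> F u1 > 0" by blast
      from neg obtain u2 where u2: "u2 \<in> {0..1}" "r < u2" "\<not> F u2 > 0" by blast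
      have "F u1 = 0" "F u2 = 0" using Fnn[OF u1(1)] Fnn[OF u2(1)] u1 u2 by linarith+
      then show False
        using not_tangent_both_sides[OF assms(1) p1 r0 assms(3,4) \<kappa>, of u1 u2]
          u1 u2 by (auto simp: F_def)
    qed
  qed
  define e0 where "e0 = \<epsilon> * r ^ (d - 1) / 4"
  have e0: "e0 > 0" using assms r0 by (simp add: e0_def)
  obtain s :: real and C where s: "s = 1 \<or> s = - 1" "s = - 1 \<longrightarrow> \<kappa> > 0" and C: "C \<ge> 0"
    "\<And>u. u \<in> {0..1} \<Longrightarrow> max 0 (s * (u ^ d - r ^ d)) \<le> e0 + C * F u"
  proof -
    have ud: "u ^ d \<in> {0..1}" if "u \<in> {0..1}" for u :: real using that by (auto simp: power_le_one)
    have lt: "u ^ d < v ^ d \<Longrightarrow> u < v" if "v \<ge> 0" for u v :: real using that by (metis power_less_imp_less_base)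
    have "\<exists>s::real. (s = 1 \<or> s = - 1) \<and> (s = - 1 \<longrightarrow> \<kappa> > 0) \<and> (\<forall>u\<in>{0..1}. s * (u ^ d - r ^ d) > 0 \<longrightarrow> F u > 0)"
      using sides
    proof
      assume *: "p < r \<and> (\<forall>u\<in>{0..1}. u < r \<longrightarrow> F u > 0)"
      then show ?thesis using \<kappa>pos lt r0 by (intro exI[of _ "-1"]) auto
    next
      assume *: "\<forall>u\<in>{0..1}. r < u \<longrightarrow> F u > 0"
      then show ?thesis using lt by (intro exI[of _ 1]) auto
    qed
    then obtain s :: real where s: "s = 1 \<or> s = - 1" "s = - 1 \<longrightarrow> \<kappa> > 0"
      "\<forall>u\<in>{0..1}. s * (u ^ d - r ^ d) > 0 \<longrightarrow> F u > 0" by blast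
    have "s * (u ^ d - r ^ d) \<le> 1" if "u \<in> {0..1}" for u
    proof -
      have "0 \<le> u ^ d" "u ^ d \<le> 1" "0 \<le> r ^ d" "r ^ d \<le> 1" using ud[OF that] ud[of r] r0 assms(3) by auto
      then show ?thesis using s(1) by (elim disjE) simp_all
    qed
    moreover have "continuous_on {0..1} (\<lambda>u. s * (u ^ d - r ^ d))" by (intro continuous_intros)
    ultimately obtain C where "C \<ge> 0" "\<And>u. u \<in> {0..1} \<Longrightarrow> max 0 (s * (u ^ d - r ^ d)) \<le> e0 + C * F u"
      using dominated_off_zeros[OF contF Fnn _ _ _ e0, of "\<lambda>u. s * (u ^ d - r ^ d)"] s(3) by blast
    with s that show thesis by blast
  qed
  \<comment> \<open>Dominates \<open>1\<close> and, when \<open>\<kappa> > 0\<close>, also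
    \<open>1 / \<kappa>\<close>: the factors with which \<open>\<eta>\<close> bounds
    \<open>- s * X\<close> for the two signs.\<close>
  define c\<kappa> where "c\<kappa> = (if \<kappa> = 0 then 1 else 1 + 1 / \<kappa>)"
  have c\<kappa>: "c\<kappa> \<ge> 1" "\<kappa> > 0 \<Longrightarrow> 1 / \<kappa> \<le> c\<kappa>" using \<kappa>nn by (auto simp: c\<kappa>_def)
  \<comment> \<open>Chosen so that all terms in \<open>\<eta>\<close> add up to
    \<open>2 * e0\<close>; the two copies of \<open>e0\<close> in the bound for \<open>2 * M\<close>
    supply the rest of \<open>4 * e0 = \<epsilon> * r ^ (d - 1)\<close>.\<close>
  define \<eta> where "\<eta> = 2 * e0 / (c\<kappa> + 2 * C * (1 + \<kappa>))"
  have den: "c\<kappa> + 2 * C * (1 + \<kappa>) > 0" using c\<kappa> C \<kappa>nn by (intro add_pos_nonneg) auto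
  have \<eta>: "\<eta> > 0" using e0 den by (simp add: \<eta>_def)
  have \<eta>_eq: "c\<kappa> * \<eta> + 2 * C * ((1 + \<kappa>) * \<eta>) = 2 * e0"
  proof -
    have "\<eta> * (c\<kappa> + 2 * C * (1 + \<kappa>)) = 2 * e0" using den by (simp add: \<eta>_def)
    then show ?thesis by (simp add: algebra_simps)
  qed
  show thesis
  proof (rule that[OF \<eta>])
    fix K :: "'e set" and w
    assume K: "finite K" "K \<noteq> {}" and w: "\<And>e. e \<in> K \<Longrightarrow> w e \<in> {0..1}"
      and wd: "avg K (\<lambda>e. w e ^ d) \<ge> r ^ d - \<eta>" and cost: "avg K (\<lambda>e. rel_entropy p (w e)) \<le> rel_entropy p r + \<eta>"
    define X where "X = avg K (\<lambda>e. w e ^ d - r ^ d)"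
    have X: "X \<ge> - \<eta>" using wd K by (simp add: X_def avg_diff avg_const)
    have EF: "avg K (\<lambda>e. F (w e)) = avg K (\<lambda>e. rel_entropy p (w e)) - rel_entropy p r - \<kappa> * X"
      unfolding F_def X_def by (simp only: avg_diff avg_cmult avg_const[OF K])
    have "- (\<kappa> * X) \<le> \<kappa> * \<eta>" using mult_left_mono[OF X \<kappa>nn] by simp
    then have EF_le: "avg K (\<lambda>e. F (w e)) \<le> (1 + \<kappa>) * \<eta>" using EF cost by (simp add: algebra_simps)
    have "0 \<le> avg K (\<lambda>e. F (w e))" using avg_mono[of K "\<lambda>_. 0" "\<lambda>e. F (w e)"] Fnn w K by (simp add: avg_const)
    then have \<kappa>X: "\<kappa> * X \<le> \<eta>" using EF cost by simp
    define M where "M = avg K (\<lambda>e. max 0 (s * (w e ^ d - r ^ d)))"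
    have "M \<le> avg K (\<lambda>e. e0 + C * F (w e))" unfolding M_def by (intro avg_mono C(2) w)
    also have "\<dots> = e0 + C * avg K (\<lambda>e. F (w e))" by (simp only: avg_add avg_cmult avg_const[OF K])
    also have "\<dots> \<le> e0 + C * ((1 + \<kappa>) * \<eta>)" using C(1) EF_le by (intro add_left_mono mult_left_mono) auto
    finally have M: "M \<le> e0 + C * ((1 + \<kappa>) * \<eta>)" .
    \<comment> \<open>The absolute value of \<open>x\<close> equals
      \<open>2 * max 0 (s * x) - s * x\<close> for either sign \<open>s\<close>, so only the
      controlled side and the mean enter.\<close>
    have "avg K (\<lambda>e. \<bar>w e ^ d - r ^ d\<bar>) = avg K (\<lambda>e. 2 * max 0 (s * (w e ^ d - r ^ d)) - s * (w e ^ d - r ^ d))"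
      using s(1) by (intro avg_cong) (auto simp: max_def abs_if)
    also have "\<dots> = 2 * M - s * X" unfolding M_def X_def by (simp only: avg_diff avg_cmult)
    also have "\<dots> \<le> 2 * M + c\<kappa> * \<eta>"
    proof -
      have "- s * X \<le> c\<kappa> * \<eta>"
        using s(1)
      proof
        assume "s = 1"
        then have "- s * X \<le> 1 * \<eta>" using X by simp
        also have "\<dots> \<le> c\<kappa> * \<eta>" using c\<kappa> \<eta> by (intro mult_right_mono) auto
        finally show ?thesis .
      next
        assume "s = - 1"
        then have "\<kappa> > 0" using s(2) by simp
        then have "X \<le> 1 / \<kappa> * \<eta>" using \<kappa>X by (simp add: field_simps)
        also have "\<dots> \<le> c\<kappa> * \<eta>" using c\<kappa>(2)[OF \<open>\<kappa> > 0\<close>] \<eta> by (intro mult_right_mono) auto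
        finally show ?thesis using \<open>s = - 1\<close> by simp
      qed
      then show ?thesis by simp
    qed
    also have "\<dots> \<le> 4 * e0" using M \<eta>_eq by linarith
    finally have "avg K (\<lambda>e. \<bar>w e ^ d - r ^ d\<bar>) \<le> \<epsilon> * r ^ (d - 1)" by (simp add: e0_def)
    moreover have "avg K (\<lambda>e. \<bar>w e - r\<bar> * r ^ (d - 1)) \<le> avg K (\<lambda>e. \<bar>w e ^ d - r ^ d\<bar>)"
      using w r0 assms(4) by (intro avg_mono power_diff_ge) auto
    moreover have "avg K (\<lambda>e. \<bar>w e - r\<bar> * r ^ (d - 1)) = r ^ (d - 1) * avg K (\<lambda>e. \<bar>w e - r\<bar>)"
      by (simp only: mult.commute[of _ "r ^ (d - 1)"] avg_cmult)
    ultimately have "r ^ (d - 1) * avg K (\<lambda>e. \<bar>w e - r\<bar>) \<le> r ^ (d - 1) * \<epsilon>" by (simp add: mult.commute)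
    then show "avg K (\<lambda>e. \<bar>w e - r\<bar>) \<le> \<epsilon>" using r0 by simp
  qed
qed

section \<open>The quadratic case\<close>

text \<open>The optimal constant in the quadratic lower bound for \<open>rel_entropy r\<close>, and
  the logarithm of \<open>threshold_base r\<close>. The value at \<open>r = 1/2\<close> is the
  limit, Pinsker's classical constant.\<close>

definition pinsker_const :: "real \<Rightarrow> real" where
  "pinsker_const r = (if r = 1/2 then 2 else ln ((1 - r) / r) / (1 - 2 * r))"

lemma pinsker_const_eq:
  assumes "0 < r" "r < 1"
  shows "(1 - 2 * r) * pinsker_const r = ln (1 - r) - ln r"
proof (cases "r = 1/2")
  case True
  show ?thesis unfolding True by simp
qed (use assms in \<open>simp add: pinsker_const_def ln_div\<close>)

lemma ln_threshold_base:
  assumes "0 < r" "r < 1"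
  shows "threshold_base r > 0" "ln (threshold_base r) = pinsker_const r"
proof -
  have eq: "inverse r - 1 = (1 - r) / r" using assms by (simp add: field_simps)
  have pos: "(1 - r) / r > 0" using assms by simp
  show "threshold_base r > 0" unfolding threshold_base_def eq using pos by auto
  show "ln (threshold_base r) = pinsker_const r"
    unfolding threshold_base_def eq pinsker_const_def using pos by (auto simp: ln_powr)
qed

lemma rel_entropy_flip:
  assumes "0 < r" "r < 1" "u \<in> {0..1}"
  shows "rel_entropy (1 - r) (1 - u) = rel_entropy r u"
  using assms by (simp add: rel_entropy_alt)

text \<open>The difference is symmetric under \<open>u \<mapsto> 1 - u\<close>, and for \<open>r < 1/2\<close> its derivative vanishes
  at \<open>r\<close> and \<open>1/2\<close> and is concave on \<open>(0, 1/2)\<close>.\<close>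

lemma refined_pinsker_half:
  assumes "0 < r" "r \<le> 1/2" "0 \<le> u" "u \<le> 1/2"
  shows "rel_entropy r u \<ge> pinsker_const r * (u - r)\<^sup>2"
proof -
  have r1: "r < 1" using assms by simp
  define c where "c = pinsker_const r"
  define \<Phi> where "\<Phi> u = rel_entropy r u - c * (u - r)\<^sup>2" for u
  define L where "L u = rel_entropy_deriv r u - 2 * c * (u - r)" for u
  have d\<Phi>: "(\<Phi> has_real_derivative L u) (at u)" if "0 < u" "u < 1" for u
    unfolding \<Phi>_def L_def using has_real_derivative_rel_entropy[OF assms(1) r1 that]
    by (auto intro!: derivative_eq_intros)
  have dL: "(L has_real_derivative 1 / (u * (1 - u)) - 2 * c) (at u)" if "0 < u" "u < 1" for u
    unfolding L_def using has_real_derivative_rel_entropy_deriv[OF that, of r]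
    by (auto intro!: derivative_eq_intros)
  have Lr: "L r = 0" by (simp add: L_def rel_entropy_deriv_def)
  have Lhalf: "L (1/2) = 0"
    using pinsker_const_eq[OF assms(1) r1] by (simp add: L_def c_def rel_entropy_deriv_def algebra_simps)
  have mvtL: "\<exists>z>x. z < y \<and> L y - L x = (y - x) * (1 / (z * (1 - z)) - 2 * c)" if "0 < x" "x < y" "y < 1" for x y
    by (rule MVT2[OF that(2)]) (use dL that in auto)
  have anti: "1 / (y * (1 - y)) \<le> 1 / (x * (1 - x))" if "0 < x" "x \<le> y" "y \<le> 1/2" for x y :: real
  proof -
    have "x * (1 - x) \<le> y * (1 - y)"
    proof -
      have "0 \<le> (y - x) * (1 - x - y)" using that by (intro mult_nonneg_nonneg) auto
      then show ?thesis by (simp add: algebra_simps)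
    qed
    then show ?thesis using that by (intro divide_left_mono mult_pos_pos) auto
  qed
  \<comment> \<open>A zero of the derivative of \<open>L\<close> between the two zeros of
    \<open>L\<close>. For \<open>r = 1/2\<close> these coincide, and \<open>\<xi> = 1/2\<close>
    works because \<open>2 * c = 4\<close>.\<close>
  obtain \<xi> where \<xi>: "r \<le> \<xi>" "\<xi> \<le> 1/2" "1 / (\<xi> * (1 - \<xi>)) = 2 * c"
  proof (cases "r = 1/2")
    case True
    then show thesis by (intro that[of "1/2"]) (auto simp: c_def pinsker_const_def)
  next
    case False
    then obtain z where "r < z" "z < 1/2" "L (1/2) - L r = (1/2 - r) * (1 / (z * (1 - z)) - 2 * c)"
      using mvtL[of r "1/2"] assms by auto
    then show thesis using Lr Lhalf False by (intro that[of z]) auto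
  qed
  have up: "L x \<le> L y" if xy: "0 < x" "x \<le> y" "y \<le> \<xi>" for x y
  proof (cases "x = y")
    case False
    then obtain z where z: "x < z" "z < y" "L y - L x = (y - x) * (1 / (z * (1 - z)) - 2 * c)"
      using mvtL[of x y] xy \<xi> by auto
    have "1 / (z * (1 - z)) - 2 * c \<ge> 0" using anti[of z \<xi>] z xy \<xi> by auto
    then have "(y - x) * (1 / (z * (1 - z)) - 2 * c) \<ge> 0" using xy by (intro mult_nonneg_nonneg) auto
    with z show ?thesis by simp
  qed simp
  have down: "L y \<le> L x" if xy: "\<xi> \<le> x" "x \<le> y" "y \<le> 1/2" for x y
  proof (cases "x = y")
    case False
    then obtain z where z: "x < z" "z < y" "L y - L x = (y - x) * (1 / (z * (1 - z)) - 2 * c)"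
      using mvtL[of x y] xy \<xi> assms by auto
    have "1 / (z * (1 - z)) - 2 * c \<le> 0" using anti[of \<xi> z] z xy \<xi> assms by auto
    then have "(y - x) * (1 / (z * (1 - z)) - 2 * c) \<le> 0" using xy by (intro mult_nonneg_nonpos) auto
    with z show ?thesis by simp
  qed simp
  have cont: "continuous_on {0..1} \<Phi>"
    unfolding \<Phi>_def by (intro continuous_intros continuous_on_rel_entropy assms r1)
  \<comment> \<open>\<open>L\<close> rises up to \<open>\<xi>\<close> and falls afterwards, hence is
    nonpositive before \<open>r\<close> and nonnegative from \<open>r\<close> to \<open>1/2\<close>;
    so \<open>\<Phi>\<close> is smallest at \<open>r\<close>.\<close>
  have "\<Phi> u \<ge> \<Phi> r"
  proof (cases "u \<le> r")
    case True
    show ?thesis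
    proof (rule DERIV_nonpos_imp_decreasing_open[OF True])
      fix x assume x: "u < x" "x < r"
      then show "\<exists>y. (\<Phi> has_real_derivative y) (at x) \<and> y \<le> 0"
        using d\<Phi>[of x] up[of x r] Lr \<xi> assms by (intro exI[of _ "L x"]) auto
    qed (use assms in \<open>auto intro: continuous_on_subset[OF cont]\<close>)
  next
    case False
    show ?thesis
    proof (rule DERIV_nonneg_imp_increasing_open[of r u \<Phi>])
      fix x assume x: "r < x" "x < u"
      have "L x \<ge> 0"
        using up[of r x] down[of x "1/2"] Lr Lhalf x assms by (cases "x \<le> \<xi>") auto
      then show "\<exists>y. (\<Phi> has_real_derivative y) (at x) \<and> 0 \<le> y"
        using d\<Phi>[of x] x assms by (intro exI[of _ "L x"]) auto
    qed (use assms False in \<open>auto intro: continuous_on_subset[OF cont]\<close>)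
  qed
  moreover have "\<Phi> r = 0" using assms r1 by (simp add: \<Phi>_def)
  ultimately show ?thesis by (simp add: \<Phi>_def c_def)
qed

text \<open>The choice of \<open>pinsker_const\<close> makes the two sides differ by the same amount
  at \<open>u\<close> and at \<open>1 - u\<close>, which settles \<open>u > 1/2\<close>. For
  \<open>r > 1/2\<close> both \<open>r\<close> and \<open>u\<close> are reflected.\<close>

lemma refined_pinsker:
  assumes "0 < r" "r < 1" "u \<in> {0..1}"
  shows "rel_entropy r u \<ge> pinsker_const r * (u - r)\<^sup>2"
proof -
  have *: "rel_entropy r u \<ge> pinsker_const r * (u - r)\<^sup>2" if r: "0 < r" "r \<le> 1/2" and u: "u \<in> {0..1}" for r u
  proof (cases "u \<le> 1/2")
    case False
    let ?c = "pinsker_const r"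
    have c: "(1 - 2 * r) * ?c = ln (1 - r) - ln r" using r by (intro pinsker_const_eq) auto
    have "rel_entropy r (1 - u) - rel_entropy r u = (1 - 2 * u) * (ln (1 - r) - ln r)"
      using r u by (simp add: rel_entropy_alt algebra_simps)
    also have "\<dots> = (1 - 2 * u) * ((1 - 2 * r) * ?c)" by (simp only: c)
    also have "\<dots> = ?c * ((1 - u) - r)\<^sup>2 - ?c * (u - r)\<^sup>2"
      by (simp add: power2_eq_square algebra_simps)
    finally show ?thesis using refined_pinsker_half[of r "1 - u"] False r u by auto
  qed (use refined_pinsker_half that in auto)
  show ?thesis
  proof (cases "r \<le> 1/2")
    case False
    have "pinsker_const (1 - r) = pinsker_const r"
    proof -
      have "(1 - 2 * (1 - r)) * pinsker_const (1 - r) = (1 - 2 * (1 - r)) * pinsker_const r"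
        using pinsker_const_eq[of r] pinsker_const_eq[of "1 - r"] assms by (simp add: algebra_simps)
      then show ?thesis using False by simp
    qed
    moreover have "((1 - u) - (1 - r))\<^sup>2 = (u - r)\<^sup>2" by (simp add: power2_commute)
    ultimately show ?thesis
      using *[of "1 - r" "1 - u"] False assms rel_entropy_flip[of r u] by auto
  qed (use * assms in auto)
qed

text \<open>At \<open>u = 1 - r\<close> the bound with \<open>pinsker_const r\<close> is an
  equality. For \<open>r = 1/2\<close> this point merges with \<open>u = r\<close>, and the constant
  is read off from the second derivative there, which is \<open>4\<close>.\<close>

lemma refined_pinsker_optimal:
  assumes r: "0 < r" "r < 1" and b: "\<And>u. u \<in> {0..1} \<Longrightarrow> rel_entropy r u \<ge> b * (u - r)\<^sup>2"
  shows "b \<le> pinsker_const r"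
proof (cases "r = 1/2")
  case False
  have "rel_entropy r (1 - r) = (1 - 2 * r) * (ln (1 - r) - ln r)"
    using r by (simp add: rel_entropy_alt algebra_simps)
  also have "\<dots> = pinsker_const r * ((1 - r) - r)\<^sup>2"
    unfolding pinsker_const_eq[OF r, symmetric] by (simp add: power2_eq_square algebra_simps)
  finally have "b * ((1 - r) - r)\<^sup>2 \<le> pinsker_const r * ((1 - r) - r)\<^sup>2"
    using b[of "1 - r"] r by simp
  moreover have "((1 - r) - r)\<^sup>2 > 0" using False by auto
  ultimately show ?thesis by simp
next
  case True
  show ?thesis
  proof (rule ccontr)
    assume "\<not> b \<le> pinsker_const r"
    then have b2: "b > 2" using True by (simp add: pinsker_const_def)
    define F where "F u = rel_entropy r u - b * (u - r)\<^sup>2" for u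
    define L where "L u = rel_entropy_deriv r u - 2 * b * (u - r)" for u
    have dF: "(F has_real_derivative L u) (at u)" if "0 < u" "u < 1" for u
      unfolding F_def L_def using has_real_derivative_rel_entropy[OF r that]
      by (auto intro!: derivative_eq_intros)
    have "(L has_real_derivative 1 / (r * (1 - r)) - 2 * b) (at r)"
      unfolding L_def using has_real_derivative_rel_entropy_deriv[OF r, of r]
      by (auto intro!: derivative_eq_intros)
    moreover have "1 / (r * (1 - r)) - 2 * b < 0" using b2 unfolding True by simp
    ultimately obtain \<delta> where \<delta>: "\<delta> > 0" "\<And>h. 0 < h \<Longrightarrow> h < \<delta> \<Longrightarrow> L (r + h) < L r"
      using DERIV_neg_dec_right by blast
    have Lr: "L r = 0" by (simp add: L_def rel_entropy_deriv_def)
    define y where "y = r + min \<delta> (1/2) / 2"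
    have y: "r < y" "y < 1" "y - r < \<delta>" using \<delta>(1) True by (auto simp: y_def)
    obtain z where z: "r < z" "z < y" "F y - F r = (y - r) * L z"
      using MVT2[OF y(1), of F L] dF r y by auto
    have "L z < 0" using \<delta>(2)[of "z - r"] z y Lr by auto
    then have "(y - r) * L z < 0" using y by (intro mult_pos_neg) auto
    moreover have "F r = 0" using r by (simp add: F_def)
    moreover have "F y \<ge> 0" using b[of y] y r by (simp add: F_def)
    ultimately show False using z by simp
  qed
qed

text \<open>The slope is forced to be \<open>\<beta> / (2 * r)\<close>, and subtracting the line
  leaves \<open>rel_entropy r u - \<beta> / (2 * r) * (u - r)\<^sup>2\<close>. So a supporting line
  exists exactly when \<open>\<beta> / (2 * r)\<close> is at most the optimal constant. As
  \<open>\<beta>\<close> equals \<open>ln ((1 - p) / p) - (1 - 2 * r) * pinsker_const r\<close>,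
  this means that \<open>ln ((1 - p) / p)\<close> is at most
  \<open>ln (threshold_base r)\<close>.\<close>

lemma minorant_quadratic_iff:
  assumes "0 < p" "p \<le> r" "r < 1"
  shows "(\<exists>\<kappa>. \<forall>u\<in>{0..1}. rel_entropy p u \<ge> rel_entropy p r + \<kappa> * (u ^ 2 - r ^ 2))
           \<longleftrightarrow> inverse (1 + threshold_base r) \<le> p" (is "?L \<longleftrightarrow> ?R")
proof -
  have p1: "p < 1" and r0: "0 < r" using assms by auto
  define \<beta> where "\<beta> = rel_entropy_deriv p r"
  let ?T = "threshold_base r" and ?c = "pinsker_const r"
  have T: "?T > 0" "ln ?T = ?c" using ln_threshold_base[OF r0 assms(3)] by auto
  have "?R \<longleftrightarrow> (1 - p) / p \<le> ?T" using T(1) assms(1) by (simp add: field_simps)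
  also have "\<dots> \<longleftrightarrow> ln ((1 - p) / p) \<le> ln ?T" using T(1) assms(1) p1 by simp
  also have "\<dots> \<longleftrightarrow> ln (1 - p) - ln p \<le> ?c" using T(2) assms(1) p1 by (simp add: ln_div)
  also have "\<dots> \<longleftrightarrow> \<beta> / (2 * r) \<le> ?c"
  proof -
    have 1: "\<beta> = (ln (1 - p) - ln p) - (1 - 2 * r) * ?c"
      unfolding pinsker_const_eq[OF r0 assms(3)] by (simp add: \<beta>_def rel_entropy_deriv_def)
    have 2: "\<beta> / (2 * r) \<le> ?c \<longleftrightarrow> \<beta> \<le> ?c * (2 * r)" using r0 by (simp add: pos_divide_le_eq)
    show ?thesis unfolding 2 unfolding 1 by (simp add: algebra_simps)
  qed
  finally have R: "?R \<longleftrightarrow> \<beta> / (2 * r) \<le> ?c" .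
  have key: "rel_entropy p u - rel_entropy p r - \<beta> / (2 * r) * (u ^ 2 - r ^ 2)
      = rel_entropy r u - \<beta> / (2 * r) * (u - r)\<^sup>2" if "u \<in> {0..1}" for u
  proof -
    have "\<beta> * (u - r) = \<beta> / (2 * r) * (u ^ 2 - r ^ 2) - \<beta> / (2 * r) * (u - r)\<^sup>2"
      using r0 by (simp add: power2_eq_square field_simps)
    then show ?thesis
      using rel_entropy_tangent[OF assms(1) p1 r0 assms(3) that] by (simp add: \<beta>_def)
  qed
  show ?thesis
    unfolding R
  proof
    assume ?L
    then obtain \<kappa> where \<kappa>: "\<And>u. u \<in> {0..1} \<Longrightarrow> rel_entropy p u \<ge> rel_entropy p r + \<kappa> * (u ^ 2 - r ^ 2)" by blast
    have "\<kappa> = \<beta> / (2 * r)"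
      using supporting_slope_eq[OF assms(1) p1 r0 assms(3) \<kappa>] r0 by (simp add: \<beta>_def field_simps)
    then have "rel_entropy r u \<ge> \<beta> / (2 * r) * (u - r)\<^sup>2" if "u \<in> {0..1}" for u
      using \<kappa>[OF that] key[OF that] by simp
    then show "\<beta> / (2 * r) \<le> ?c" by (rule refined_pinsker_optimal[OF r0 assms(3)])
  next
    assume le: "\<beta> / (2 * r) \<le> ?c"
    have "rel_entropy p u \<ge> rel_entropy p r + \<beta> / (2 * r) * (u ^ 2 - r ^ 2)" if u: "u \<in> {0..1}" for u
    proof -
      have "\<beta> / (2 * r) * (u - r)\<^sup>2 \<le> ?c * (u - r)\<^sup>2" using le by (intro mult_right_mono) auto
      also have "\<dots> \<le> rel_entropy r u" by (rule refined_pinsker[OF r0 assms(3) u])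
      finally show ?thesis using key[OF u] by linarith
    qed
    then show ?L by blast
  qed
qed

section \<open>Weights on \<open>k\<close>-subsets\<close>

definition ksets :: "nat \<Rightarrow> nat \<Rightarrow> nat set set" where
  "ksets n k = {e. e \<subseteq> {..<n} \<and> card e = k}"

lemma finite_ksets [simp]: "finite (ksets n k)"
  by (rule finite_subset[of _ "Pow {..<n}"]) (auto simp: ksets_def)

lemma card_ksets: "card (ksets n k) = n choose k"
  unfolding ksets_def using n_subsets[of "{..<n}" k] by simp

lemma ksets_finite: "e \<in> ksets n k \<Longrightarrow> finite e"
  by (auto simp: ksets_def intro: finite_subset)

text \<open>Tuples with repeated entries carry no hyperedge and get weight \<open>0\<close>.\<close>

definition skern :: "nat \<Rightarrow> nat \<Rightarrow> (nat set \<Rightarrow> real) \<Rightarrow> nat multiset \<Rightarrow> real" where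
  "skern n k w M = (if set_mset M \<in> ksets n k then w (set_mset M) else 0)"

text \<open>For \<open>e\<close> in \<open>ksets n k\<close> this counts the orderings of
  \<open>e\<close> that lie in the box. As functions of \<open>e\<close> these bounded integers are
  the tests handed to the regularity argument.\<close>

definition tuple_count :: "nat \<Rightarrow> (nat \<Rightarrow> nat set) \<Rightarrow> nat set \<Rightarrow> nat" where
  "tuple_count k A e = card {a \<in> PiE {..<k} A. a ` {..<k} = e}"

definition graph :: "nat \<Rightarrow> nat set set \<Rightarrow> nat hypergraph" where
  "graph n E = \<lparr>verts = {..<n}, hedges = E\<rparr>"

lemma set_mset_mimg: "finite e \<Longrightarrow> set_mset (mimg \<phi> e) = \<phi> ` e"
  by (simp add: mimg_def)

lemma skern_range: "(\<And>e. e \<in> ksets n k \<Longrightarrow> w e \<in> {0..1}) \<Longrightarrow> skern n k w M \<in> {0..1}"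
  by (simp add: skern_def)

text \<open>A map that collapses a hyperedge gives it an image of fewer than \<open>k\<close>
  vertices, which is not in \<open>E\<close>, and \<open>skern\<close> gives weight \<open>0\<close>
  as well; so the agreement is exact.\<close>

lemma (in linear_uniform) hom_density_graph:
  assumes "E \<subseteq> ksets n k"
  shows "hom_density H (graph n E) = hdens n H (skern n k (\<lambda>e. of_bool (e \<in> E)))"
proof -
  have prod: "(\<Prod>e\<in>hedges H. skern n k (\<lambda>e. of_bool (e \<in> E)) (mimg \<phi> e))
      = of_bool (\<forall>e\<in>hedges H. \<phi> ` e \<in> E)" for \<phi>
  proof -
    have "skern n k (\<lambda>e. of_bool (e \<in> E)) (mimg \<phi> e) = of_bool (\<phi> ` e \<in> E)" if "e \<in> hedges H" for e
      using assms finite_hedge[OF that] by (auto simp: skern_def set_mset_mimg)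
    then have "(\<Prod>e\<in>hedges H. skern n k (\<lambda>e. of_bool (e \<in> E)) (mimg \<phi> e))
        = (\<Prod>e\<in>hedges H. of_bool (\<phi> ` e \<in> E))" by (intro prod.cong) auto
    also have "\<dots> = of_bool (\<forall>e\<in>hedges H. \<phi> ` e \<in> E)"
      by (cases "\<forall>e\<in>hedges H. \<phi> ` e \<in> E") (auto simp: prod_zero_iff)
    finally show ?thesis .
  qed
  have fin: "finite (verts H \<rightarrow>\<^sub>E {..<n})" by (intro finite_PiE) auto
  have "(\<Sum>\<phi>\<in>verts H \<rightarrow>\<^sub>E {..<n}. of_bool (\<forall>e\<in>hedges H. \<phi> ` e \<in> E) :: real)
      = real (card {\<phi> \<in> verts H \<rightarrow>\<^sub>E {..<n}. \<forall>e\<in>hedges H. \<phi> ` e \<in> E})"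
    using fin by (simp add: of_bool_def sum.If_cases Int_def)
  then show ?thesis
    by (simp add: hom_density_def hom_count_def graph_def hdens_def prod)
qed

lemma tsum_skern:
  assumes "\<And>i. i < k \<Longrightarrow> A i \<subseteq> {..<n}"
  shows "tsum k A (skern n k w) = (\<Sum>e\<in>ksets n k. real (tuple_count k A e) * w e)"
proof -
  have fin: "finite (PiE {..<k} A)" using assms by (intro finite_PiE) (auto intro: finite_subset)
  let ?T = "{a \<in> PiE {..<k} A. a ` {..<k} \<in> ksets n k}"
  have "tsum k A (skern n k w) = (\<Sum>a\<in>PiE {..<k} A. if a ` {..<k} \<in> ksets n k then w (a ` {..<k}) else 0)"
    unfolding tsum_def skern_def set_mset_mimg[OF finite_lessThan] ..
  also have "\<dots> = (\<Sum>a\<in>?T. w (a ` {..<k}))"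
    using fin by (simp add: sum.inter_filter)
  also have "\<dots> = (\<Sum>e\<in>ksets n k. \<Sum>a\<in>{a \<in> ?T. a ` {..<k} = e}. w (a ` {..<k}))"
    by (rule sum.group[symmetric]) (use fin in auto)
  also have "\<dots> = (\<Sum>e\<in>ksets n k. real (tuple_count k A e) * w e)"
  proof (intro sum.cong refl)
    fix e assume "e \<in> ksets n k"
    then have eq: "{a \<in> ?T. a ` {..<k} = e} = {a \<in> PiE {..<k} A. a ` {..<k} = e}" by auto
    have "(\<Sum>a\<in>{a \<in> ?T. a ` {..<k} = e}. w (a ` {..<k})) = (\<Sum>a\<in>{a \<in> PiE {..<k} A. a ` {..<k} = e}. w e)"
      unfolding eq by (intro sum.cong) auto
    then show "(\<Sum>a\<in>{a \<in> ?T. a ` {..<k} = e}. w (a ` {..<k})) = real (tuple_count k A e) * w e"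
      by (simp add: tuple_count_def)
  qed
  finally show ?thesis .
qed

lemma edge_tuples_graph:
  assumes "E \<subseteq> ksets n k" "\<And>i. i < k \<Longrightarrow> A i \<subseteq> {..<n}"
  shows "real (edge_tuples k (graph n E) A) = tsum k A (skern n k (\<lambda>e. of_bool (e \<in> E)))"
proof -
  have fin: "finite (PiE {..<k} A)" using assms(2) by (intro finite_PiE) (auto intro: finite_subset)
  have "tsum k A (skern n k (\<lambda>e. of_bool (e \<in> E))) = (\<Sum>a\<in>PiE {..<k} A. of_bool (a ` {..<k} \<in> E))"
    unfolding tsum_def using assms(1) by (intro sum.cong) (auto simp: skern_def set_mset_mimg)
  also have "\<dots> = real (card {a \<in> PiE {..<k} A. a ` {..<k} \<in> E})"
    using fin by (simp add: of_bool_def sum.If_cases Int_def)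
  finally show ?thesis by (simp add: edge_tuples_def graph_def)
qed

lemma tuple_count_le:
  assumes "e \<in> ksets n k"
  shows "tuple_count k A e \<le> k ^ k"
proof -
  have "tuple_count k A e \<le> card ({..<k} \<rightarrow>\<^sub>E e)"
    unfolding tuple_count_def using ksets_finite[OF assms]
    by (intro card_mono finite_PiE) (auto simp: PiE_def)
  also have "\<dots> = k ^ k" using assms by (simp add: card_PiE ksets_def)
  finally show ?thesis .
qed

lemma tuple_count_restrict: "tuple_count k (restrict A {..<k}) = tuple_count k A"
proof -
  have "PiE {..<k} (restrict A {..<k}) = PiE {..<k} A" by (rule PiE_cong) simp
  then show ?thesis unfolding tuple_count_def by simp
qed

text \<open>The number of orderings of a \<open>k\<close>-set, that is \<open>k!\<close>. By
  \<open>tuple_count_full\<close> it is the factor between sums over \<open>k\<close>-sets and sums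
  over injective tuples.\<close>

definition inj_tuples :: "nat \<Rightarrow> nat" where
  "inj_tuples k = tuple_count k (\<lambda>_. {..<k}) {..<k}"

lemma tuple_count_full:
  assumes "e \<in> ksets n k"
  shows "tuple_count k (\<lambda>_. {..<n}) e = inj_tuples k"
proof -
  have e: "e \<subseteq> {..<n}" "card e = k" using assms by (auto simp: ksets_def)
  obtain h where "bij_betw h {0..<card e} e"
    using ex_bij_betw_nat_finite[OF ksets_finite[OF assms]] by blast
  then have h: "bij_betw h {..<k} e" by (simp add: e(2) atLeast0LessThan)
  then have inj: "inj_on h {..<k}" and im: "h ` {..<k} = e" by (auto simp: bij_betw_def)
  have img: "restrict (g \<circ> a) {..<k} ` {..<k} = g ` (a ` {..<k})" for g :: "nat \<Rightarrow> nat" and a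
    by (auto simp: image_image)
  have "bij_betw (\<lambda>a. restrict (h \<circ> a) {..<k})
      {a \<in> {..<k} \<rightarrow>\<^sub>E {..<k}. a ` {..<k} = {..<k}} {a \<in> {..<k} \<rightarrow>\<^sub>E {..<n}. a ` {..<k} = e}"
  proof (rule bij_betw_byWitness[where f' = "\<lambda>a. restrict (inv_into {..<k} h \<circ> a) {..<k}"])
    show "\<forall>a\<in>{a \<in> {..<k} \<rightarrow>\<^sub>E {..<k}. a ` {..<k} = {..<k}}.
        restrict (inv_into {..<k} h \<circ> restrict (h \<circ> a) {..<k}) {..<k} = a"
    proof (intro ballI ext)
      fix a i assume a: "a \<in> {a \<in> {..<k} \<rightarrow>\<^sub>E {..<k}. a ` {..<k} = {..<k}}"
      show "restrict (inv_into {..<k} h \<circ> restrict (h \<circ> a) {..<k}) {..<k} i = a i"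
      proof (cases "i < k")
        case True
        then have "a i \<in> {..<k}" using a by auto
        then show ?thesis using True inj by (simp add: inv_into_f_f)
      next
        case False
        then show ?thesis using a PiE_arb[of a "{..<k}" "\<lambda>_. {..<k}" i] by simp
      qed
    qed
    show "\<forall>a\<in>{a \<in> {..<k} \<rightarrow>\<^sub>E {..<n}. a ` {..<k} = e}.
        restrict (h \<circ> restrict (inv_into {..<k} h \<circ> a) {..<k}) {..<k} = a"
    proof (intro ballI ext)
      fix a i assume a: "a \<in> {a \<in> {..<k} \<rightarrow>\<^sub>E {..<n}. a ` {..<k} = e}"
      show "restrict (h \<circ> restrict (inv_into {..<k} h \<circ> a) {..<k}) {..<k} i = a i"
      proof (cases "i < k")
        case True
        then have "a i \<in> h ` {..<k}" using a im by auto
        then show ?thesis using True by (simp add: f_inv_into_f)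
      next
        case False
        then show ?thesis using a PiE_arb[of a "{..<k}" "\<lambda>_. {..<n}" i] by simp
      qed
    qed
    show "(\<lambda>a. restrict (h \<circ> a) {..<k}) ` {a \<in> {..<k} \<rightarrow>\<^sub>E {..<k}. a ` {..<k} = {..<k}}
        \<subseteq> {a \<in> {..<k} \<rightarrow>\<^sub>E {..<n}. a ` {..<k} = e}"
    proof (rule image_subsetI)
      fix a assume "a \<in> {a \<in> {..<k} \<rightarrow>\<^sub>E {..<k}. a ` {..<k} = {..<k}}"
      then have "restrict (h \<circ> a) {..<k} ` {..<k} = e" using im unfolding img by simp
      then show "restrict (h \<circ> a) {..<k} \<in> {a \<in> {..<k} \<rightarrow>\<^sub>E {..<n}. a ` {..<k} = e}" using e(1) by auto
    qed
    show "(\<lambda>a. restrict (inv_into {..<k} h \<circ> a) {..<k}) ` {a \<in> {..<k} \<rightarrow>\<^sub>E {..<n}. a ` {..<k} = e}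
        \<subseteq> {a \<in> {..<k} \<rightarrow>\<^sub>E {..<k}. a ` {..<k} = {..<k}}"
    proof (rule image_subsetI)
      fix a assume "a \<in> {a \<in> {..<k} \<rightarrow>\<^sub>E {..<n}. a ` {..<k} = e}"
      moreover have "inv_into {..<k} h ` e = {..<k}" using inj im inv_into_image_cancel[OF inj, of "{..<k}"] by simp
      ultimately have "restrict (inv_into {..<k} h \<circ> a) {..<k} ` {..<k} = {..<k}" unfolding img by simp
      then show "restrict (inv_into {..<k} h \<circ> a) {..<k} \<in> {a \<in> {..<k} \<rightarrow>\<^sub>E {..<k}. a ` {..<k} = {..<k}}" by auto
    qed
  qed
  then show ?thesis unfolding tuple_count_def inj_tuples_def by (rule bij_betw_same_card[symmetric])
qed

section \<open>Normalisation and collisions\<close>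

lemma tsum_skern_full:
  "tsum k (\<lambda>_. {..<n}) (skern n k w) = real (inj_tuples k) * sum w (ksets n k)"
  by (subst tsum_skern) (simp_all add: tuple_count_full sum_distrib_left)

lemma tsum_one: "tsum k (\<lambda>_. {..<n}) (\<lambda>_. 1) = real n ^ k"
  by (simp add: tsum_def card_PiE)

lemma tsum_mono:
  assumes "\<And>a. a \<in> PiE {..<k} A \<Longrightarrow> U (mimg a {..<k}) \<le> U' (mimg a {..<k})"
  shows "tsum k A U \<le> tsum k A U'"
  unfolding tsum_def by (intro sum_mono assms)

text \<open>A collision at a pair of distinct positions determines one coordinate by another, which
  leaves at most \<open>n ^ (k - 1)\<close> tuples; there are at most \<open>k\<^sup>2\<close>
  pairs.\<close>

lemma card_collisions:
  assumes "n > 0"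
  shows "real (card {a \<in> {..<k} \<rightarrow>\<^sub>E {..<n}. \<not> inj_on a {..<k}}) \<le> (real k)\<^sup>2 / real n * real n ^ k"
proof -
  let ?B = "\<lambda>(i, j). {a \<in> {..<k} \<rightarrow>\<^sub>E {..<n}. a i = a j}"
  let ?I = "{(i, j) \<in> {..<k} \<times> {..<k}. i \<noteq> j}"
  have B: "card (?B z) \<le> n ^ (k - 1)" if z: "z \<in> ?I" for z
  proof -
    obtain i j where ij: "z = (i, j)" "i < k" "j < k" "i \<noteq> j" using z by auto
    have "inj_on (\<lambda>a. restrict a ({..<k} - {i})) (?B z)"
    proof (rule inj_onI, rule ext)
      fix a b x assume ab: "a \<in> ?B z" "b \<in> ?B z" and eq: "restrict a ({..<k} - {i}) = restrict b ({..<k} - {i})"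
      have off: "a y = b y" if "y < k" "y \<noteq> i" for y using fun_cong[OF eq, of y] that by simp
      show "a x = b x"
      proof (cases "x < k")
        case True
        then show ?thesis using off[of x] off[of j] ab ij by (cases "x = i") auto
      next
        case False
        then show ?thesis using ab ij PiE_arb[of a "{..<k}" _ x] PiE_arb[of b "{..<k}" _ x] by auto
      qed
    qed
    moreover have "(\<lambda>a. restrict a ({..<k} - {i})) ` ?B z \<subseteq> ({..<k} - {i}) \<rightarrow>\<^sub>E {..<n}"
      unfolding ij(1) by (auto simp: PiE_def Pi_def)
    moreover have "finite (({..<k} - {i}) \<rightarrow>\<^sub>E {..<n})" by (intro finite_PiE) auto
    ultimately have "card (?B z) \<le> card (({..<k} - {i}) \<rightarrow>\<^sub>E {..<n})" by (rule card_inj_on_le)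
    also have "\<dots> = n ^ (k - 1)" using ij by (simp add: card_PiE)
    finally show ?thesis .
  qed
  have finI: "finite ?I" by (rule finite_subset[of _ "{..<k} \<times> {..<k}"]) auto
  have "{a \<in> {..<k} \<rightarrow>\<^sub>E {..<n}. \<not> inj_on a {..<k}} \<subseteq> (\<Union>z\<in>?I. ?B z)"
    by (auto simp: inj_on_def)
  then have "card {a \<in> {..<k} \<rightarrow>\<^sub>E {..<n}. \<not> inj_on a {..<k}} \<le> card (\<Union>z\<in>?I. ?B z)"
    using finI by (intro card_mono) (auto intro!: finite_PiE)
  also have "\<dots> \<le> (\<Sum>z\<in>?I. card (?B z))" by (rule card_UN_le[OF finI])
  also have "\<dots> \<le> (\<Sum>z\<in>?I. n ^ (k - 1))" by (intro sum_mono B)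
  also have "\<dots> \<le> k\<^sup>2 * n ^ (k - 1)"
  proof -
    have "card ?I \<le> card ({..<k} \<times> {..<k})" by (intro card_mono) auto
    then show ?thesis by (simp add: power2_eq_square)
  qed
  finally have le: "card {a \<in> {..<k} \<rightarrow>\<^sub>E {..<n}. \<not> inj_on a {..<k}} \<le> k\<^sup>2 * n ^ (k - 1)" .
  show ?thesis
  proof (cases k)
    case (Suc k')
    have "real (card {a \<in> {..<k} \<rightarrow>\<^sub>E {..<n}. \<not> inj_on a {..<k}}) \<le> real (k\<^sup>2 * n ^ (k - 1))"
      using le by (simp only: of_nat_le_iff)
    also have "\<dots> = (real k)\<^sup>2 / real n * real n ^ k" using assms Suc by simp
    finally show ?thesis .
  qed simp
qed

text \<open>A kernel and the weight it induces on \<open>k\<close>-sets agree on injective tuples.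
  All other tuples are collisions, a share of at most \<open>k\<^sup>2 / n\<close>.\<close>

lemma tsum_skern_kernel_diff:
  assumes A: "\<And>i. i < k \<Longrightarrow> A i \<subseteq> {..<n}" and n: "n > 0"
    and w: "\<And>e. e \<in> ksets n k \<Longrightarrow> w e = U (mset_set e)"
    and U: "\<And>M. \<bar>U M\<bar> \<le> B" and B: "B \<ge> 0"
  shows "\<bar>tsum k A U - tsum k A (skern n k w)\<bar> \<le> B * ((real k)\<^sup>2 / real n * real n ^ k)"
proof -
  have fin: "finite (PiE {..<k} A)" using A by (intro finite_PiE) (auto intro: finite_subset)
  let ?C = "{a \<in> {..<k} \<rightarrow>\<^sub>E {..<n}. \<not> inj_on a {..<k}}"
  have finC: "finite ?C" by (auto intro!: finite_PiE)
  have "\<bar>tsum k A U - tsum k A (skern n k w)\<bar>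
      \<le> (\<Sum>a\<in>PiE {..<k} A. \<bar>U (mimg a {..<k}) - skern n k w (mimg a {..<k})\<bar>)"
    unfolding tsum_def sum_subtractf[symmetric] by (rule sum_abs)
  also have "\<dots> \<le> (\<Sum>a\<in>PiE {..<k} A. if a \<in> ?C then B else 0)"
  proof (intro sum_mono)
    fix a assume a: "a \<in> PiE {..<k} A"
    then have an: "a \<in> {..<k} \<rightarrow>\<^sub>E {..<n}" using A by (auto simp: PiE_def Pi_def)
    show "\<bar>U (mimg a {..<k}) - skern n k w (mimg a {..<k})\<bar> \<le> (if a \<in> ?C then B else 0)"
    proof (cases "inj_on a {..<k}")
      case True
      then have "a ` {..<k} \<in> ksets n k" using an by (auto simp: ksets_def card_image)
      moreover have "mimg a {..<k} = mset_set (a ` {..<k})" using True by (simp add: mimg_def image_mset_mset_set)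
      ultimately show ?thesis using w True by (simp add: skern_def)
    next
      case False
      then have "card (a ` {..<k}) \<noteq> k" using eq_card_imp_inj_on[of "{..<k}" a] by auto
      then have "skern n k w (mimg a {..<k}) = 0" by (simp add: skern_def set_mset_mimg ksets_def)
      then show ?thesis using U[of "mimg a {..<k}"] False an by simp
    qed
  qed
  also have "\<dots> \<le> B * real (card ?C)"
  proof -
    have "PiE {..<k} A \<inter> ?C \<subseteq> ?C" by auto
    then have "card (PiE {..<k} A \<inter> ?C) \<le> card ?C" using finC by (rule card_mono[rotated])
    then have "B * real (card (PiE {..<k} A \<inter> ?C)) \<le> B * real (card ?C)" using B by (intro mult_left_mono) auto
    moreover have "(\<Sum>a\<in>PiE {..<k} A. if a \<in> ?C then B else 0) = B * real (card (PiE {..<k} A \<inter> ?C))"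
      using fin by (simp only: sum.If_cases) (simp add: Int_def mult.commute)
    ultimately show ?thesis by simp
  qed
  also have "\<dots> \<le> B * ((real k)\<^sup>2 / real n * real n ^ k)"
    by (intro mult_left_mono card_collisions n B)
  finally show ?thesis .
qed

text \<open>The constant kernel dominates its restriction to injective tuples; the bound from below
  compares the same two kernels up to collisions.\<close>

lemma inj_tuples_choose_le: "real (inj_tuples k) * real (n choose k) \<le> real n ^ k"
proof -
  have "tsum k (\<lambda>_. {..<n}) (skern n k (\<lambda>_. 1)) \<le> tsum k (\<lambda>_. {..<n}) (\<lambda>_. 1)"
    by (rule tsum_mono) (simp add: skern_def)
  then show ?thesis by (simp add: tsum_skern_full tsum_one card_ksets)
qed

lemma inj_tuples_choose_ge:
  assumes "n > 0"
  shows "real (inj_tuples k) * real (n choose k) \<ge> (1 - (real k)\<^sup>2 / real n) * real n ^ k"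
proof -
  have "\<bar>tsum k (\<lambda>_. {..<n}) (\<lambda>_. 1) - tsum k (\<lambda>_. {..<n}) (skern n k (\<lambda>_. 1))\<bar> \<le> 1 * ((real k)\<^sup>2 / real n * real n ^ k)"
    by (rule tsum_skern_kernel_diff) (use assms in auto)
  then show ?thesis by (simp add: tsum_skern_full tsum_one card_ksets algebra_simps)
qed

lemma inj_tuples_pos: "inj_tuples k > 0"
proof -
  have "(\<lambda>i\<in>{..<k}. i) \<in> {a \<in> {..<k} \<rightarrow>\<^sub>E {..<k}. a ` {..<k} = {..<k}}" by auto
  moreover have "finite {a \<in> {..<k} \<rightarrow>\<^sub>E {..<k}. a ` {..<k} = {..<k}}" by (auto intro!: finite_PiE)
  ultimately show ?thesis unfolding inj_tuples_def tuple_count_def card_gt_0_iff by blast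
qed

lemma card_ksets_le: "real (card (ksets n k)) \<le> real n ^ k"
proof -
  have "real (n choose k) * 1 \<le> real (n choose k) * real (inj_tuples k)"
    using inj_tuples_pos[of k] by (intro mult_left_mono) auto
  also have "\<dots> \<le> real n ^ k" using inj_tuples_choose_le[of k n] by (simp add: mult.commute)
  finally show ?thesis by (simp add: card_ksets)
qed

text \<open>The bridge from probability mass functions to finite sums. Configurations that are true
  somewhere outside \<open>ksets n k\<close> have mass \<open>0\<close>, so the event may be
  replaced by a finite family of edge sets.\<close>

lemma prob_random_hypergraph:
  assumes "0 \<le> p" "p \<le> 1"
  shows "measure (measure_pmf (random_hypergraph k n p)) {G. X G} = bprob (ksets n k) (\<lambda>_. p) {E. X (graph n E)}"
proof -
  let ?K = "ksets n k"
  let ?M = "Pi_pmf ?K False (\<lambda>_. bernoulli_pmf p)"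
  let ?f = "\<lambda>\<omega>. graph n {e \<in> ?K. \<omega> e}"
  have "random_hypergraph k n p = map_pmf ?f ?M"
    by (simp add: random_hypergraph_def Let_def graph_def ksets_def)
  then have "measure (measure_pmf (random_hypergraph k n p)) {G. X G} = measure (measure_pmf ?M) {\<omega>. X (?f \<omega>)}"
    by (simp add: vimage_def)
  also have "\<dots> = measure (measure_pmf ?M) ((\<lambda>E e. e \<in> E) ` (Pow ?K \<inter> {E. X (graph n E)}))"
  proof (rule measure_prob_cong_0)
    fix \<omega> assume \<omega>: "\<omega> \<in> {\<omega>. X (?f \<omega>)} - (\<lambda>E e. e \<in> E) ` (Pow ?K \<inter> {E. X (graph n E)})"
    have "\<exists>x. x \<notin> ?K \<and> \<omega> x \<noteq> False"
    proof (rule ccontr)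
      assume "\<not> ?thesis"
      then have "\<omega> = (\<lambda>e. e \<in> {e \<in> ?K. \<omega> e})" by auto
      moreover have "{e \<in> ?K. \<omega> e} \<in> Pow ?K \<inter> {E. X (graph n E)}" using \<omega> by auto
      ultimately have "\<omega> \<in> (\<lambda>E e. e \<in> E) ` (Pow ?K \<inter> {E. X (graph n E)})" by (rule image_eqI)
      with \<omega> show False by blast
    qed
    then show "pmf ?M \<omega> = 0" by (intro pmf_Pi_outside) auto
  next
    fix \<omega> assume "\<omega> \<in> (\<lambda>E e. e \<in> E) ` (Pow ?K \<inter> {E. X (graph n E)}) - {\<omega>. X (?f \<omega>)}"
    then obtain E where "E \<subseteq> ?K" "X (graph n E)" "\<omega> = (\<lambda>e. e \<in> E)" "\<not> X (?f \<omega>)" by auto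
    moreover from this have "{e \<in> ?K. \<omega> e} = E" by auto
    ultimately show "pmf ?M \<omega> = 0" by simp
  qed
  also have "\<dots> = (\<Sum>\<omega>\<in>(\<lambda>E e. e \<in> E) ` (Pow ?K \<inter> {E. X (graph n E)}). pmf ?M \<omega>)"
    by (rule measure_measure_pmf_finite) auto
  also have "\<dots> = (\<Sum>E\<in>Pow ?K \<inter> {E. X (graph n E)}. pmf ?M (\<lambda>e. e \<in> E))"
    by (subst sum.reindex) (auto simp: inj_on_def fun_eq_iff)
  also have "\<dots> = (\<Sum>E\<in>Pow ?K \<inter> {E. X (graph n E)}. bern ?K (\<lambda>_. p) E)"
  proof (intro sum.cong refl)
    fix E assume "E \<in> Pow ?K \<inter> {E. X (graph n E)}"
    then have E: "E \<subseteq> ?K" by auto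
    have "pmf ?M (\<lambda>e. e \<in> E) = (\<Prod>e\<in>?K. pmf (bernoulli_pmf p) (e \<in> E))"
      using E by (intro pmf_Pi') auto
    also have "\<dots> = (\<Prod>e\<in>?K - E. pmf (bernoulli_pmf p) (e \<in> E)) * (\<Prod>e\<in>E. pmf (bernoulli_pmf p) (e \<in> E))"
      by (rule prod.subset_diff[OF E]) simp
    also have "\<dots> = bern ?K (\<lambda>_. p) E" using assms by (simp add: bern_def)
    finally show "pmf ?M (\<lambda>e. e \<in> E) = bern ?K (\<lambda>_. p) E" .
  qed
  finally show ?thesis by (simp add: bprob_def)
qed

section \<open>Large deviation bounds for homomorphism densities\<close>

lemma tsum_skern_diff:
  assumes "\<And>i. i < k \<Longrightarrow> A i \<subseteq> {..<n}"
  shows "tsum k A (skern n k g) - tsum k A (skern n k w)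
    = (\<Sum>e\<in>ksets n k. real (tuple_count k A e) * (g e - w e))"
  using tsum_skern[of k A n, OF assms] by (simp add: sum_subtractf right_diff_distrib)

section \<open>Asymptotics of the number of \<open>k\<close>-sets\<close>

lemma choose_ratio_tendsto:
  "(\<lambda>n. real (inj_tuples k) * real (n choose k) / real n ^ k) \<longlonglongrightarrow> 1"
proof (rule tendsto_sandwich)
  show "(\<lambda>n. 1 - (real k)\<^sup>2 / real n) \<longlonglongrightarrow> 1" by real_asymp
  show "\<forall>\<^sub>F n in sequentially. 1 - (real k)\<^sup>2 / real n \<le> real (inj_tuples k) * real (n choose k) / real n ^ k"
    using eventually_gt_at_top[of 0]
  proof eventually_elim
    case (elim n)
    then show ?case using inj_tuples_choose_ge[OF elim, of k] by (simp add: pos_le_divide_eq)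
  qed
  show "\<forall>\<^sub>F n in sequentially. real (inj_tuples k) * real (n choose k) / real n ^ k \<le> 1"
    using eventually_gt_at_top[of 0]
  proof eventually_elim
    case (elim n)
    then show ?case using inj_tuples_choose_le[of k n] by (simp add: pos_divide_le_eq)
  qed
qed simp

lemma choose_ge_eventually:
  "\<forall>\<^sub>F n in sequentially. real (n choose k) \<ge> real n ^ k / (2 * real (inj_tuples k))"
proof -
  have "\<forall>\<^sub>F n in sequentially. 1 / 2 < real (inj_tuples k) * real (n choose k) / real n ^ k"
    by (rule order_tendstoD(1)[OF choose_ratio_tendsto]) simp
  then show ?thesis
    using eventually_gt_at_top[of 0]
  proof eventually_elim
    case (elim n)
    then have "real n ^ k / 2 \<le> real (inj_tuples k) * real (n choose k)" by (simp add: field_simps)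
    then show ?case using inj_tuples_pos[of k] by (simp add: field_simps)
  qed
qed

lemma choose_at_top:
  assumes "k > 0"
  shows "filterlim (\<lambda>n. real (n choose k)) at_top sequentially"
proof (rule filterlim_at_top_mono[OF _ choose_ge_eventually])
  have "filterlim (\<lambda>n. real n ^ k) at_top sequentially"
    using assms by (intro filterlim_pow_at_top filterlim_real_sequentially)
  then show "filterlim (\<lambda>n. real n ^ k / (2 * real (inj_tuples k))) at_top sequentially"
    using inj_tuples_pos[of k] by (subst divide_real_def, intro filterlim_at_top_mult_tendsto_pos[OF tendsto_const]) auto
qed

text \<open>The logarithm of the number of boxes is of order \<open>n\<close> and must be negligible
  at the speed \<open>n choose k\<close>; this is where \<open>k \<ge> 2\<close> enters.\<close>

lemma n_over_choose:
  assumes "k \<ge> 2"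
  shows "(\<lambda>n. real n / real (n choose k)) \<longlonglongrightarrow> 0"
proof (rule tendsto_sandwich[where f = "\<lambda>_. 0" and h = "\<lambda>n. 2 * real (inj_tuples k) / real n"])
  show "\<forall>\<^sub>F n in sequentially. real n / real (n choose k) \<le> 2 * real (inj_tuples k) / real n"
    using choose_ge_eventually[of k] eventually_gt_at_top[of 0]
  proof eventually_elim
    case (elim n)
    have "real n ^ 2 \<le> real n ^ k" using elim assms by (intro power_increasing) auto
    then have a: "real n ^ 2 / (2 * real (inj_tuples k)) \<le> real (n choose k)"
      using elim(1) by (meson divide_right_mono mult_nonneg_nonneg of_nat_0_le_iff order_trans zero_le_numeral)
    have b: "real n ^ 2 / (2 * real (inj_tuples k)) > 0" using elim inj_tuples_pos[of k] by simp
    with a have c: "real (n choose k) > 0" by linarith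
    have "real n / real (n choose k) \<le> real n / (real n ^ 2 / (2 * real (inj_tuples k)))"
      by (intro divide_left_mono mult_pos_pos a b c) simp
    also have "\<dots> = 2 * real (inj_tuples k) / real n" using elim by (simp add: power2_eq_square)
    finally show ?case .
  qed
  show "(\<lambda>n. 2 * real (inj_tuples k) / real n) \<longlonglongrightarrow> 0" by real_asymp
qed auto

text \<open>The event may vary with \<open>n\<close>, so it is quantified inside the filter; this is
  possible because the error term does not depend on it.\<close>

lemma ldp_upper:
  assumes k: "k \<ge> 2" and p: "0 < p" "p < 1" and \<epsilon>: "\<epsilon> > 0"
  shows "\<forall>\<^sub>F n in sequentially. \<forall>A. bprob (ksets n k) (\<lambda>_. p) A > 0 \<longrightarrow>
    (\<exists>E w. E \<subseteq> ksets n k \<and> E \<in> A \<and> (\<forall>e\<in>ksets n k. w e \<in> {0..1}) \<and>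
      (\<forall>B. (\<forall>i<k. B i \<subseteq> {..<n}) \<longrightarrow>
        \<bar>tsum k B (skern n k (\<lambda>e. of_bool (e \<in> E))) - tsum k B (skern n k w)\<bar> \<le> \<epsilon> * real n ^ k) \<and>
      ln (bprob (ksets n k) (\<lambda>_. p) A)
        \<le> - (\<Sum>e\<in>ksets n k. rel_entropy p (w e)) + \<epsilon> * real (n choose k))"
proof -
  define b where "b = k ^ k"
  have b: "b > 0" using k by (simp add: b_def)
  \<comment> \<open>With \<open>N = n ^ k\<close> and accuracy \<open>\<epsilon> * n ^ k\<close> the
    number of steps demanded by the energy argument is independent of \<open>n\<close>.\<close>
  obtain m :: nat where m: "real m > (real b)\<^sup>2 / \<epsilon>\<^sup>2" using reals_Archimedean2 by blast
  define q where "q = card {ys. set ys \<subseteq> {..b} \<and> length ys \<le> m}"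
  let ?N = "\<lambda>n. real (n choose k)"
  \<comment> \<open>The logarithm of the prefactor, per edge: the possible list lengths,
    \<open>2 ^ (n * k)\<close> boxes for each of \<open>m\<close> tests, and one edge count for each
    of \<open>q\<close> labels.\<close>
  let ?err = "\<lambda>n. ln (real (m + 1)) * (1 / ?N n) + (real k * real m * ln 2) * (real n / ?N n) + real q * (ln (?N n + 1) / ?N n)"
  have Ntop: "filterlim ?N at_top sequentially" using k by (intro choose_at_top) auto
  have "((\<lambda>x::real. ln (x + 1) / x) \<longlongrightarrow> 0) at_top" by real_asymp
  then have t1: "(\<lambda>n. ln (?N n + 1) / ?N n) \<longlonglongrightarrow> 0" by (rule filterlim_compose[OF _ Ntop])
  have "((\<lambda>x::real. 1 / x) \<longlongrightarrow> 0) at_top" by real_asymp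
  then have t2: "(\<lambda>n. 1 / ?N n) \<longlonglongrightarrow> 0" by (rule filterlim_compose[OF _ Ntop])
  have "?err \<longlonglongrightarrow> ln (real (m + 1)) * 0 + (real k * real m * ln 2) * 0 + real q * 0"
    by (intro tendsto_intros t1 t2 n_over_choose k)
  then have "\<forall>\<^sub>F n in sequentially. ?err n < \<epsilon>" using \<epsilon> by (intro order_tendstoD(2)) auto
  moreover have "\<forall>\<^sub>F n in sequentially. ?N n > 0"
    using Ntop by (auto simp: filterlim_at_top_dense)
  ultimately show ?thesis
    using eventually_gt_at_top[of 0]
  proof eventually_elim
    case (elim n)
    show ?case
    proof (intro allI impI)
      fix A assume pos: "bprob (ksets n k) (\<lambda>_. p) A > 0"
      define I where "I = {..<k} \<rightarrow>\<^sub>E Pow {..<n}"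
      have finI: "finite I" unfolding I_def by (intro finite_PiE) auto
      have neI: "I \<noteq> {}" unfolding I_def by (auto simp: PiE_eq_empty_iff)
      have cI: "real (card I) = 2 ^ (n * k)" unfolding I_def by (simp add: card_PiE card_Pow power_mult)
      have "(real b)\<^sup>2 < real m * \<epsilon>\<^sup>2" using m \<epsilon> by (simp add: pos_divide_less_eq)
      then have "(real b)\<^sup>2 * (real n ^ k)\<^sup>2 < (real m * \<epsilon>\<^sup>2) * (real n ^ k)\<^sup>2"
        using elim by (intro mult_strict_right_mono) auto
      then have m': "(real b)\<^sup>2 * (real n ^ k)\<^sup>2 < real m * (\<epsilon> * real n ^ k)\<^sup>2"
        by (simp add: power_mult_distrib mult.assoc)
      obtain E w where Ew: "E \<subseteq> ksets n k" "E \<in> A" "\<And>e. e \<in> ksets n k \<Longrightarrow> w e \<in> {0..1}"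
        "\<And>i. i \<in> I \<Longrightarrow> \<bar>\<Sum>e\<in>ksets n k. real (tuple_count k i e) * (of_bool (e \<in> E) - w e)\<bar> \<le> \<epsilon> * real n ^ k"
        "bprob (ksets n k) (\<lambda>_. p) A \<le> real (m + 1) * real (card I) ^ m
           * (real (card (ksets n k)) + 1) ^ q * exp (- (\<Sum>e\<in>ksets n k. rel_entropy p (w e)))"
        unfolding q_def
        by (rule bern_ldp_upper[where s = "tuple_count k" and K = "ksets n k" and N = "real n ^ k" and b = b
              and \<delta> = "\<epsilon> * real n ^ k" and I = I and m = m and p = p and A = A])
          (use elim b \<epsilon> finI neI tuple_count_le m' p pos card_ksets_le in \<open>auto simp: b_def\<close>)
      have close: "\<bar>tsum k B (skern n k (\<lambda>e. of_bool (e \<in> E))) - tsum k B (skern n k w)\<bar> \<le> \<epsilon> * real n ^ k"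
        if B: "\<forall>i<k. B i \<subseteq> {..<n}" for B
      proof -
        have "restrict B {..<k} \<in> I" using B by (auto simp: I_def)
        from Ew(4)[OF this] show ?thesis
          using tsum_skern_diff[of k B n] B by (simp only: tuple_count_restrict)
      qed
      let ?S = "\<Sum>e\<in>ksets n k. rel_entropy p (w e)"
      have "ln (bprob (ksets n k) (\<lambda>_. p) A)
          \<le> ln (real (m + 1) * real (card I) ^ m * (?N n + 1) ^ q * exp (- ?S))"
        using Ew(5) pos by (simp only: card_ksets ln_mono)
      also have "\<dots> = ln (real (m + 1)) + real m * (real (n * k) * ln 2) + real q * ln (?N n + 1) - ?S"
        unfolding cI using elim by (simp add: ln_mult_pos ln_realpow)
      also have "\<dots> = ?err n * ?N n - ?S"
        using elim by (simp add: field_simps)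
      also have "\<dots> \<le> - ?S + \<epsilon> * ?N n"
        using mult_right_mono[of "?err n" \<epsilon> "?N n"] elim by linarith
      finally have "ln (bprob (ksets n k) (\<lambda>_. p) A) \<le> - ?S + \<epsilon> * ?N n" .
      with Ew close show "\<exists>E w. E \<subseteq> ksets n k \<and> E \<in> A \<and> (\<forall>e\<in>ksets n k. w e \<in> {0..1}) \<and>
        (\<forall>B. (\<forall>i<k. B i \<subseteq> {..<n}) \<longrightarrow>
          \<bar>tsum k B (skern n k (\<lambda>e. of_bool (e \<in> E))) - tsum k B (skern n k w)\<bar> \<le> \<epsilon> * real n ^ k) \<and>
        ln (bprob (ksets n k) (\<lambda>_. p) A) \<le> - (\<Sum>e\<in>ksets n k. rel_entropy p (w e)) + \<epsilon> * ?N n"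
        by blast
    qed
  qed
qed

section \<open>Blow-ups along residue classes and the lower bound\<close>

lemma residue_class_density:
  assumes "j < m"
  shows "(\<lambda>n. real (card {i \<in> {..<n}. i mod m = j}) / real n) \<longlonglongrightarrow> 1 / real m"
proof -
  have m: "m > 0" using assms by simp
  have lo: "n div m \<le> card {i \<in> {..<n}. i mod m = j}" for n
  proof -
    have "(\<lambda>t. j + m * t) ` {..<n div m} \<subseteq> {i \<in> {..<n}. i mod m = j}"
    proof (rule image_subsetI)
      fix t assume "t \<in> {..<n div m}"
      then have "m * (t + 1) \<le> m * (n div m)" by (intro mult_le_mono) auto
      also have "\<dots> \<le> n" by simp
      finally show "j + m * t \<in> {i \<in> {..<n}. i mod m = j}" using assms by (auto simp: algebra_simps)
    qed
    then have "card ((\<lambda>t. j + m * t) ` {..<n div m}) \<le> card {i \<in> {..<n}. i mod m = j}"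
      by (intro card_mono) auto
    moreover have "card ((\<lambda>t. j + m * t) ` {..<n div m}) = n div m"
      using m by (subst card_image) (auto simp: inj_on_def)
    ultimately show ?thesis by simp
  qed
  have hi: "card {i \<in> {..<n}. i mod m = j} \<le> n div m + 1" for n
  proof -
    have "{i \<in> {..<n}. i mod m = j} \<subseteq> (\<lambda>t. j + m * t) ` {..n div m}"
    proof
      fix i assume i: "i \<in> {i \<in> {..<n}. i mod m = j}"
      then have "i = j + m * (i div m)" by (metis (mono_tags) mem_Collect_eq mod_mult_div_eq)
      moreover have "i div m \<le> n div m" using i by (intro div_le_mono) auto
      ultimately show "i \<in> (\<lambda>t. j + m * t) ` {..n div m}" by blast
    qed
    then have "card {i \<in> {..<n}. i mod m = j} \<le> card ((\<lambda>t. j + m * t) ` {..n div m})"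
      by (intro card_mono) auto
    also have "\<dots> \<le> card {..n div m}" by (rule card_image_le) simp
    finally show ?thesis by simp
  qed
  have div: "real n / real m - 1 \<le> real (n div m)" "real (n div m) \<le> real n / real m" for n
  proof -
    have "n = m * (n div m) + n mod m" by simp
    then have "real n = real m * real (n div m) + real (n mod m)" by (metis of_nat_add of_nat_mult)
    moreover have "real (n mod m) \<le> real m" using m by (simp add: less_imp_le)
    ultimately show "real n / real m - 1 \<le> real (n div m)" "real (n div m) \<le> real n / real m"
      using m by (simp_all add: field_simps)
  qed
  show ?thesis
  proof (rule tendsto_sandwich)
    show "\<forall>\<^sub>F n in sequentially. 1 / real m - 1 / real n \<le> real (card {i \<in> {..<n}. i mod m = j}) / real n"
      using eventually_gt_at_top[of 0]
    proof eventually_elim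
      case (elim n)
      have "real n / real m - 1 \<le> real (card {i \<in> {..<n}. i mod m = j})" using lo[of n] div(1)[of n] by linarith
      then have "(real n / real m - 1) / real n \<le> real (card {i \<in> {..<n}. i mod m = j}) / real n"
        by (intro divide_right_mono) auto
      then show ?case using elim by (simp add: diff_divide_distrib)
    qed
    show "\<forall>\<^sub>F n in sequentially. real (card {i \<in> {..<n}. i mod m = j}) / real n \<le> 1 / real m + 1 / real n"
      using eventually_gt_at_top[of 0]
    proof eventually_elim
      case (elim n)
      have "real (card {i \<in> {..<n}. i mod m = j}) \<le> real n / real m + 1" using hi[of n] div(2)[of n] by linarith
      then have "real (card {i \<in> {..<n}. i mod m = j}) / real n \<le> (real n / real m + 1) / real n"
        by (intro divide_right_mono) auto
      then show ?case using elim by (simp add: add_divide_distrib)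
    qed
    show "(\<lambda>n. 1 / real m - 1 / real n) \<longlonglongrightarrow> 1 / real m" by real_asymp
    show "(\<lambda>n. 1 / real m + 1 / real n) \<longlonglongrightarrow> 1 / real m" by real_asymp
  qed
qed

lemma sum_push:
  fixes F :: "('v \<Rightarrow> nat) \<Rightarrow> real" and f :: "nat \<Rightarrow> nat" and n m :: nat
  assumes "finite V" "\<And>i. i < n \<Longrightarrow> f i < m"
  shows "(\<Sum>\<phi>\<in>V \<rightarrow>\<^sub>E {..<n}. F (restrict (f \<circ> \<phi>) V))
    = (\<Sum>\<psi>\<in>V \<rightarrow>\<^sub>E {..<m}. F \<psi> * (\<Prod>v\<in>V. real (card {i \<in> {..<n}. f i = \<psi> v})))"
proof -
  have fin: "finite (V \<rightarrow>\<^sub>E {..<n})" "finite (V \<rightarrow>\<^sub>E {..<m})" using assms by (auto intro!: finite_PiE)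
  have "(\<Sum>\<phi>\<in>V \<rightarrow>\<^sub>E {..<n}. F (restrict (f \<circ> \<phi>) V))
    = (\<Sum>\<psi>\<in>V \<rightarrow>\<^sub>E {..<m}. \<Sum>\<phi>\<in>{\<phi> \<in> V \<rightarrow>\<^sub>E {..<n}. restrict (f \<circ> \<phi>) V = \<psi>}. F (restrict (f \<circ> \<phi>) V))"
    by (rule sum.group[symmetric]) (use fin assms(2) in \<open>auto dest: PiE_mem\<close>)
  also have "\<dots> = (\<Sum>\<psi>\<in>V \<rightarrow>\<^sub>E {..<m}. F \<psi> * (\<Prod>v\<in>V. real (card {i \<in> {..<n}. f i = \<psi> v})))"
  proof (intro sum.cong refl)
    fix \<psi> assume \<psi>: "\<psi> \<in> V \<rightarrow>\<^sub>E {..<m}"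
    have eq: "{\<phi> \<in> V \<rightarrow>\<^sub>E {..<n}. restrict (f \<circ> \<phi>) V = \<psi>} = PiE V (\<lambda>v. {i \<in> {..<n}. f i = \<psi> v})"
      using \<psi> by (auto simp: PiE_def Pi_def extensional_def fun_eq_iff)
    have "(\<Sum>\<phi>\<in>{\<phi> \<in> V \<rightarrow>\<^sub>E {..<n}. restrict (f \<circ> \<phi>) V = \<psi>}. F (restrict (f \<circ> \<phi>) V))
        = (\<Sum>\<phi>\<in>PiE V (\<lambda>v. {i \<in> {..<n}. f i = \<psi> v}). F \<psi>)"
    proof (rule sum.cong[OF eq])
      fix \<phi> assume "\<phi> \<in> PiE V (\<lambda>v. {i \<in> {..<n}. f i = \<psi> v})"
      then have "restrict (f \<circ> \<phi>) V = \<psi>" unfolding eq[symmetric] by blast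
      then show "F (restrict (f \<circ> \<phi>) V) = F \<psi>" by (rule arg_cong)
    qed
    then show "(\<Sum>\<phi>\<in>{\<phi> \<in> V \<rightarrow>\<^sub>E {..<n}. restrict (f \<circ> \<phi>) V = \<psi>}. F (restrict (f \<circ> \<phi>) V))
        = F \<psi> * (\<Prod>v\<in>V. real (card {i \<in> {..<n}. f i = \<psi> v}))"
      using assms(1) by (simp add: card_PiE mult.commute)
  qed
  finally show ?thesis .
qed

text \<open>Residue classes modulo \<open>m\<close> have asymptotic share \<open>1 / m\<close>, and
  the maps with prescribed residues form a product of classes. Reduction modulo \<open>m\<close>
  provides a blow-up for every \<open>n\<close>, not just for multiples of \<open>m\<close>.\<close>

lemma blowup_tendsto:
  fixes F :: "('v \<Rightarrow> nat) \<Rightarrow> real"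
  assumes "finite V" "m > 0"
  shows "(\<lambda>n. (\<Sum>\<phi>\<in>V \<rightarrow>\<^sub>E {..<n}. F (restrict ((\<lambda>i. i mod m) \<circ> \<phi>) V)) / real n ^ card V)
    \<longlonglongrightarrow> (\<Sum>\<psi>\<in>V \<rightarrow>\<^sub>E {..<m}. F \<psi>) / real m ^ card V"
proof -
  have eq: "(\<Sum>\<phi>\<in>V \<rightarrow>\<^sub>E {..<n}. F (restrict ((\<lambda>i. i mod m) \<circ> \<phi>) V)) / real n ^ card V
     = (\<Sum>\<psi>\<in>V \<rightarrow>\<^sub>E {..<m}. F \<psi> * (\<Prod>v\<in>V. real (card {i \<in> {..<n}. i mod m = \<psi> v}) / real n))" for n
    using assms by (subst sum_push[where m = m]) (auto simp: sum_divide_distrib prod_dividef)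
  have "(\<lambda>n. \<Sum>\<psi>\<in>V \<rightarrow>\<^sub>E {..<m}. F \<psi> * (\<Prod>v\<in>V. real (card {i \<in> {..<n}. i mod m = \<psi> v}) / real n))
     \<longlonglongrightarrow> (\<Sum>\<psi>\<in>V \<rightarrow>\<^sub>E {..<m}. F \<psi> * (\<Prod>v\<in>V. 1 / real m))"
    by (intro tendsto_sum tendsto_mult tendsto_prod tendsto_const residue_class_density) auto
  moreover have "(\<Sum>\<psi>\<in>V \<rightarrow>\<^sub>E {..<m}. F \<psi> * (\<Prod>v\<in>V. 1 / real m)) = (\<Sum>\<psi>\<in>V \<rightarrow>\<^sub>E {..<m}. F \<psi>) / real m ^ card V"
    by (simp add: power_one_over sum_divide_distrib)
  ultimately show ?thesis unfolding eq by simp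
qed

text \<open>All \<open>k\<close>-tuples are counted, collisions included, because after a blow-up
  equal residues are realised by distinct vertices.\<close>

definition kcost :: "real \<Rightarrow> nat \<Rightarrow> nat \<Rightarrow> (nat multiset \<Rightarrow> real) \<Rightarrow> real" where
  "kcost p k m W = tsum k (\<lambda>_. {..<m}) (\<lambda>M. rel_entropy p (W M)) / real m ^ k"

lemma mimg_comp: "mimg (f \<circ> \<phi>) e = image_mset f (mimg \<phi> e)"
  by (simp add: mimg_def multiset.map_comp)

text \<open>Edges are drawn with the weights \<open>w\<close> of the blown-up kernel. Outside an
  event of probability at most \<open>\<beta> n\<close> all boxes are close to their expectation,
  and the counting lemma keeps the density above \<open>\<rho>\<close>; the strict gap pays for
  sampling, for collisions and for the passage from \<open>m\<close> to \<open>n\<close>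
  vertices.\<close>

lemma (in linear_uniform) ldp_lower:
  assumes k: "k \<ge> 2" and p: "0 < p" "p < 1" and m: "m > 0" and W: "\<And>M. W M \<in> {0..1}"
    and \<rho>: "\<rho> < hdens m H W" and \<eta>: "\<eta> > 0"
  shows "\<forall>\<^sub>F n in sequentially.
    bprob (ksets n k) (\<lambda>_. p) {E. hom_density H (graph n E) \<ge> \<rho>} > 0 \<and>
    ln (bprob (ksets n k) (\<lambda>_. p) {E. hom_density H (graph n E) \<ge> \<rho>}) / real (n choose k) \<ge> - kcost p k m W - \<eta>"
proof -
  define f where "f = (\<lambda>i::nat. i mod m)"
  define U where "U M = W (image_mset f M)" for M
  define w where "w e = U (mset_set e)" for e
  have U01: "U M \<in> {0..1}" for M using W by (simp add: U_def)
  have w01: "w e \<in> {0..1}" for e using U01 by (simp add: w_def)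
  let ?N = "\<lambda>n. real (n choose k)"
  define gap where "gap = hdens m H W - \<rho>"
  define eH where "eH = real (card (hedges H))"
  \<comment> \<open>One \<open>\<delta>\<close> is spent on sampling and one on collisions, together
    at most half of the gap after the counting lemma; the blow-up takes a further quarter. The
    \<open>+ 1\<close> keeps the denominator positive.\<close>
  define \<delta> where "\<delta> = gap / (4 * (eH + 1))"
  have gap: "gap > 0" using \<rho> by (simp add: gap_def)
  have eH: "eH \<ge> 0" by (simp add: eH_def)
  have \<delta>: "\<delta> > 0" unfolding \<delta>_def using gap eH by (intro divide_pos_pos) auto
  have e\<delta>: "eH * (2 * \<delta>) \<le> gap / 2"
    using gap eH unfolding \<delta>_def by (simp add: field_simps)
  define b where "b = real (k ^ k)"
  have b: "b > 0" using k by (simp add: b_def)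
  \<comment> \<open>The number of boxes times the two-sided Hoeffding bound. It tends to
    \<open>0\<close> because \<open>n ^ k\<close> outgrows \<open>n * k\<close>.\<close>
  define \<beta> where "\<beta> n = 2 ^ (n * k) * (2 * exp (- 2 * \<delta>\<^sup>2 * real n ^ k / b\<^sup>2))" for n
  define R where "R n = tsum k (\<lambda>_. {..<n}) (\<lambda>M. rel_entropy p (U M)) / real n ^ k" for n
  \<comment> \<open>Compares all tuples with the injective ones, hence tends to \<open>1\<close>; it
    converts the normalisation of \<open>R\<close> into one per edge.\<close>
  define S where "S n = real n ^ k / (real (inj_tuples k) * ?N n)" for n
  have mimgV: "mimg (restrict (f \<circ> \<phi>) V) e = image_mset f (mimg \<phi> e)" if "e \<subseteq> V" for \<phi> and V e :: "'x set"
  proof -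
    have "mimg (restrict (f \<circ> \<phi>) V) e = mimg (f \<circ> \<phi>) e" using that by (intro mimg_cong) auto
    then show ?thesis by (simp add: mimg_comp)
  qed
  have hd: "(\<lambda>n. hdens n H U) \<longlonglongrightarrow> hdens m H W"
  proof -
    have eq: "hdens n H U = (\<Sum>\<phi>\<in>verts H \<rightarrow>\<^sub>E {..<n}. (\<lambda>\<psi>. \<Prod>e\<in>hedges H. W (mimg \<psi> e)) (restrict (f \<circ> \<phi>) (verts H))) / real n ^ card (verts H)" for n
      unfolding hdens_def U_def using mimgV[OF hedges_subset]
      by (intro arg_cong2[where f = "(/)"] sum.cong prod.cong refl) simp
    show ?thesis
      using blowup_tendsto[OF finite_verts m, of "\<lambda>\<psi>. \<Prod>e\<in>hedges H. W (mimg \<psi> e)"]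
      unfolding eq f_def[symmetric] by (simp add: hdens_def)
  qed
  have RJ: "R \<longlonglongrightarrow> kcost p k m W"
  proof -
    have "R n = (\<Sum>\<phi>\<in>{..<k} \<rightarrow>\<^sub>E {..<n}. (\<lambda>\<psi>. rel_entropy p (W (mimg \<psi> {..<k}))) (restrict (f \<circ> \<phi>) {..<k})) / real n ^ card {..<k}" for n
      unfolding R_def tsum_def U_def using mimgV[of "{..<k}" "{..<k}"] by simp
    then have "R = (\<lambda>n. (\<Sum>\<phi>\<in>{..<k} \<rightarrow>\<^sub>E {..<n}. (\<lambda>\<psi>. rel_entropy p (W (mimg \<psi> {..<k}))) (restrict (f \<circ> \<phi>) {..<k})) / real n ^ card {..<k})" by blast
    then show ?thesis
      using blowup_tendsto[OF finite_lessThan m, of "\<lambda>\<psi>. rel_entropy p (W (mimg \<psi> {..<k}))" k]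
      by (simp add: f_def kcost_def tsum_def)
  qed
  have S1: "S \<longlonglongrightarrow> 1"
  proof -
    have "(\<lambda>n. inverse (real (inj_tuples k) * ?N n / real n ^ k)) \<longlonglongrightarrow> inverse 1"
      by (intro tendsto_inverse choose_ratio_tendsto) simp
    then show ?thesis by (simp add: S_def[abs_def])
  qed
  have \<beta>0: "\<beta> \<longlonglongrightarrow> 0"
  proof -
    define c where "c = 2 * \<delta>\<^sup>2 / b\<^sup>2"
    have c: "c > 0" using \<delta> b by (simp add: c_def)
    show ?thesis
    proof (rule tendsto_sandwich[where f = "\<lambda>_. 0" and h = "\<lambda>n. 2 * exp (real k * ln 2 * real n - c * real n ^ 2)"])
      show "\<forall>\<^sub>F n in sequentially. \<beta> n \<le> 2 * exp (real k * ln 2 * real n - c * real n ^ 2)"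
        using eventually_gt_at_top[of 0]
      proof eventually_elim
        case (elim n)
        have "real n ^ 2 \<le> real n ^ k" using elim k by (intro power_increasing) auto
        then have "c * real n ^ 2 \<le> c * real n ^ k" using c by (intro mult_left_mono) auto
        moreover have "(2::real) ^ (n * k) = exp (real k * ln 2 * real n)"
          by (metis exp_ln exp_of_nat_mult mult.commute mult.left_commute of_nat_mult zero_less_numeral)
        moreover have "- 2 * \<delta>\<^sup>2 * real n ^ k / b\<^sup>2 = - (c * real n ^ k)" by (simp add: c_def)
        ultimately show ?case unfolding \<beta>_def by (simp add: exp_diff exp_minus field_simps)
      qed
      show "(\<lambda>n. 2 * exp (real k * ln 2 * real n - c * real n ^ 2)) \<longlonglongrightarrow> 0"
        using c by real_asymp
      show "\<forall>\<^sub>F n in sequentially. 0 \<le> \<beta> n" by (simp add: \<beta>_def)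
      qed simp
  qed
  have Ntop: "filterlim ?N at_top sequentially" using k by (intro choose_at_top) auto
  have "((\<lambda>x::real. 1 / x) \<longlongrightarrow> 0) at_top" by real_asymp
  then have N0: "(\<lambda>n. 1 / ?N n) \<longlonglongrightarrow> 0" by (rule filterlim_compose[OF _ Ntop])
  have "(\<lambda>n. ln (1 - \<beta> n) * (1 / ?N n) - (R n * S n + 1 / ?N n) / (1 - \<beta> n))
      \<longlonglongrightarrow> ln (1 - 0) * 0 - (kcost p k m W * 1 + 0) / (1 - 0)"
    by (intro tendsto_intros \<beta>0 RJ S1 N0) auto
  then have "\<forall>\<^sub>F n in sequentially. ln (1 - \<beta> n) * (1 / ?N n) - (R n * S n + 1 / ?N n) / (1 - \<beta> n) > - kcost p k m W - \<eta>"
    using \<eta> by (intro order_tendstoD(1)) auto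
  moreover have "\<forall>\<^sub>F n in sequentially. \<beta> n < 1" using \<beta>0 by (intro order_tendstoD(2)) auto
  moreover have "\<forall>\<^sub>F n in sequentially. hdens n H U > hdens m H W - gap / 4"
    using hd gap by (intro order_tendstoD(1)) auto
  moreover have "\<forall>\<^sub>F n in sequentially. (real k)\<^sup>2 / real n < \<delta>"
  proof -
    have "(\<lambda>n. (real k)\<^sup>2 / real n) \<longlonglongrightarrow> 0" by real_asymp
    then show ?thesis using \<delta> by (intro order_tendstoD(2)) auto
  qed
  moreover have "\<forall>\<^sub>F n in sequentially. ?N n > 0"
    using Ntop by (auto simp: filterlim_at_top_dense)
  ultimately show ?thesis
    using eventually_gt_at_top[of 0]
  proof eventually_elim
    case (elim n)
    let ?K = "ksets n k" and ?UT = "{E. hom_density H (graph n E) \<ge> \<rho>}"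
    define I where "I = {..<k} \<rightarrow>\<^sub>E Pow {..<n}"
    have finI: "finite I" unfolding I_def by (intro finite_PiE) auto
    have cI: "real (card I) = 2 ^ (n * k)" unfolding I_def by (simp add: card_PiE card_Pow power_mult)
    define Bad where "Bad A = {E. \<bar>\<Sum>e\<in>?K. real (tuple_count k A e) * (of_bool (e \<in> E) - w e)\<bar> \<ge> \<delta> * real n ^ k}" for A
    have "bprob ?K w (\<Union>A\<in>I. Bad A) \<le> (\<Sum>A\<in>I. bprob ?K w (Bad A))"
      by (rule bprob_UN_le) (use finI w01 in auto)
    also have "\<dots> \<le> (\<Sum>A\<in>I. 2 * exp (- 2 * (\<delta> * real n ^ k)\<^sup>2 / (b\<^sup>2 * real n ^ k)))"
    proof (intro sum_mono)
      fix A
      have "\<bar>real (tuple_count k A e)\<bar> \<le> b" if "e \<in> ?K" for e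
        using tuple_count_le[OF that, of A] unfolding b_def by (simp only: abs_of_nat of_nat_le_iff)
      then show "bprob ?K w (Bad A) \<le> 2 * exp (- 2 * (\<delta> * real n ^ k)\<^sup>2 / (b\<^sup>2 * real n ^ k))"
        unfolding Bad_def by (intro bern_hoeffding w01 card_ksets_le b) (use elim \<delta> in auto)
    qed
    also have "\<dots> = \<beta> n"
      using elim by (simp add: \<beta>_def cI power2_eq_square)
    finally have bad: "bprob ?K w (\<Union>A\<in>I. Bad A) \<le> \<beta> n" .
    have good: "E \<in> ?UT" if E: "E \<subseteq> ?K" "E \<notin> (\<Union>A\<in>I. Bad A)" for E
    proof -
      let ?G = "skern n k (\<lambda>e. of_bool (e \<in> E))"
      have "\<bar>tsum k A ?G - tsum k A U\<bar> \<le> (2 * \<delta>) * real n ^ k" if A: "\<And>i. i < k \<Longrightarrow> A i \<subseteq> {..<n}" for A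
      proof -
        have "restrict A {..<k} \<in> I" using A by (auto simp: I_def)
        then have "E \<notin> Bad (restrict A {..<k})" using E(2) by blast
        then have "\<bar>\<Sum>e\<in>?K. real (tuple_count k A e) * (of_bool (e \<in> E) - w e)\<bar> \<le> \<delta> * real n ^ k"
          by (simp add: Bad_def tuple_count_restrict)
        then have "\<bar>tsum k A ?G - tsum k A (skern n k w)\<bar> \<le> \<delta> * real n ^ k"
          using tsum_skern_diff[of k A n] A by simp
        moreover have "\<bar>tsum k A U - tsum k A (skern n k w)\<bar> \<le> 1 * ((real k)\<^sup>2 / real n * real n ^ k)"
        proof (rule tsum_skern_kernel_diff[OF A])
          show "\<bar>U M\<bar> \<le> 1" for M using U01[of M] by auto
        qed (use elim in \<open>auto simp: w_def\<close>)
        moreover have "(real k)\<^sup>2 / real n * real n ^ k \<le> \<delta> * real n ^ k"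
          using elim by (intro mult_right_mono) auto
        ultimately show ?thesis by linarith
      qed
      then have "\<bar>hdens n H ?G - hdens n H U\<bar> \<le> eH * (2 * \<delta>)"
        unfolding eH_def using elim U01
        by (intro counting_lemma) (auto simp: skern_def)
      then have "hdens n H ?G \<ge> \<rho>"
      proof -
        assume "\<bar>hdens n H ?G - hdens n H U\<bar> \<le> eH * (2 * \<delta>)"
        then have "\<bar>hdens n H ?G - hdens n H U\<bar> \<le> gap / 2" using e\<delta> by (rule order_trans)
        then have "hdens n H U - hdens n H ?G \<le> gap / 2" by linarith
        moreover have "hdens m H W = \<rho> + gap" by (simp add: gap_def)
        ultimately show ?thesis using elim(3) gap by linarith
      qed
      then show ?thesis using hom_density_graph[OF E(1)] by simp
    qed
    define Q where "Q = bprob ?K w ?UT"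
    have "bprob ?K w (- (\<Union>A\<in>I. Bad A)) \<le> Q"
      unfolding Q_def by (rule bprob_mono) (use w01 good in auto)
    then have Q: "Q \<ge> 1 - \<beta> n" using bad bprob_Compl[of ?K w "\<Union>A\<in>I. Bad A"] by simp
    have Qpos: "Q > 0" using Q elim by simp
    let ?P = "bprob ?K (\<lambda>_. p) ?UT" and ?I = "\<Sum>e\<in>?K. rel_entropy p (w e)"
    have P: "?P > 0" "ln ?P \<ge> ln Q - (?I + 1) / Q"
      using bprob_tilt_lower[of ?K w p ?UT] w01 p Qpos unfolding Q_def by auto
    have I0: "?I \<ge> 0" using rel_entropy_nonneg(1)[OF p w01] by (intro sum_nonneg) auto
    have "real (inj_tuples k) * ?I = tsum k (\<lambda>_. {..<n}) (skern n k (\<lambda>e. rel_entropy p (w e)))"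
      by (rule tsum_skern_full[symmetric])
    also have "\<dots> \<le> tsum k (\<lambda>_. {..<n}) (\<lambda>M. rel_entropy p (U M))"
    proof (rule tsum_mono)
      fix a assume "a \<in> {..<k} \<rightarrow>\<^sub>E {..<n}"
      show "skern n k (\<lambda>e. rel_entropy p (w e)) (mimg a {..<k}) \<le> rel_entropy p (U (mimg a {..<k}))"
      proof (cases "a ` {..<k} \<in> ksets n k")
        case True
        then have "inj_on a {..<k}" by (intro eq_card_imp_inj_on) (auto simp: ksets_def)
        then have "mimg a {..<k} = mset_set (a ` {..<k})" by (simp add: mimg_def image_mset_mset_set)
        then show ?thesis using True by (simp add: skern_def w_def)
      next
        case False
        then show ?thesis using rel_entropy_nonneg(1)[OF p U01] by (simp add: skern_def set_mset_mimg)
      qed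
    qed
    also have "\<dots> = R n * real n ^ k" using elim by (simp add: R_def)
    finally have "?I \<le> (R n * S n) * ?N n"
      using elim inj_tuples_pos[of k] by (simp add: S_def field_simps)
    then have I1: "?I / ?N n \<le> R n * S n" using elim by (simp add: pos_divide_le_eq)
    have "ln (1 - \<beta> n) * (1 / ?N n) - (R n * S n + 1 / ?N n) / (1 - \<beta> n) \<le> ln Q * (1 / ?N n) - (?I / ?N n + 1 / ?N n) / Q"
    proof (intro diff_mono mult_right_mono frac_le)
      show "0 \<le> R n * S n + 1 / ?N n" using I1 I0 elim by (smt (verit) divide_nonneg_pos)
    qed (use Q Qpos elim I1 in auto)
    also have "\<dots> = (ln Q - (?I + 1) / Q) / ?N n"
      by (simp add: diff_divide_distrib add_divide_distrib mult.commute)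
    also have "\<dots> \<le> ln ?P / ?N n" using P(2) elim by (intro divide_right_mono) auto
    finally show ?case using P(1) elim by simp
  qed
qed

section \<open>The upper tail rate\<close>

text \<open>Replace each factor independently by \<open>1\<close> with probability \<open>t\<close>:
  the left-hand side is the expected product. With probability \<open>t ^ card S\<close> all factors
  become \<open>1\<close>, and otherwise the product is at least the original one.\<close>

lemma prod_boost_ge:
  fixes x :: "'e \<Rightarrow> real"
  assumes "finite S" "\<And>e. e \<in> S \<Longrightarrow> x e \<in> {0..1}" "0 \<le> t" "t \<le> 1"
  shows "(\<Prod>e\<in>S. (1 - t) * x e + t) \<ge> (1 - t ^ card S) * (\<Prod>e\<in>S. x e) + t ^ card S"
  using assms(1,2)
proof (induction S rule: finite_induct)
  case (insert e S)
  define X y s where "X = (\<Prod>e\<in>S. x e)" and "y = x e" and "s = t ^ card S"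
  have y: "0 \<le> y" "y \<le> 1" using insert.prems[of e] by (auto simp: y_def)
  have X: "0 \<le> X" "X \<le> 1" unfolding X_def using insert.prems by (auto intro!: prod_nonneg prod_le_1)
  have s: "0 \<le> s" "s \<le> 1" using assms(3,4) by (auto simp: s_def power_le_one)
  have "(1 - s) * t * X * (1 - y) + s * (1 - t) * y * (1 - X) \<ge> 0"
    using X y s assms(3,4) by (intro add_nonneg_nonneg mult_nonneg_nonneg) auto
  then have "(1 - t * s) * (y * X) + t * s \<le> ((1 - t) * y + t) * ((1 - s) * X + s)"
    by (simp add: algebra_simps)
  also have "\<dots> \<le> ((1 - t) * y + t) * (\<Prod>e\<in>S. (1 - t) * x e + t)"
    using insert y assms(3,4) unfolding X_def s_def by (intro mult_left_mono) auto
  finally show ?case using insert.hyps by (simp add: X_def y_def s_def)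
qed simp

lemma (in linear_uniform) hdens_boost_ge:
  assumes "m > 0" "\<And>M. W M \<in> {0..1}" "0 \<le> t" "t \<le> 1"
  shows "hdens m H (\<lambda>M. (1 - t) * W M + t)
    \<ge> (1 - t ^ card (hedges H)) * hdens m H W + t ^ card (hedges H)"
proof -
  let ?\<Phi> = "verts H \<rightarrow>\<^sub>E {..<m}" and ?s = "t ^ card (hedges H)"
  have c: "real (card ?\<Phi>) = real m ^ card (verts H)" by (simp add: card_PiE)
  have "(\<Sum>\<phi>\<in>?\<Phi>. (1 - ?s) * (\<Prod>e\<in>hedges H. W (mimg \<phi> e)) + ?s)
      \<le> (\<Sum>\<phi>\<in>?\<Phi>. \<Prod>e\<in>hedges H. (1 - t) * W (mimg \<phi> e) + t)"
    by (intro sum_mono prod_boost_ge) (use assms in auto)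
  then have "(1 - ?s) * (\<Sum>\<phi>\<in>?\<Phi>. \<Prod>e\<in>hedges H. W (mimg \<phi> e)) + ?s * real m ^ card (verts H)
      \<le> (\<Sum>\<phi>\<in>?\<Phi>. \<Prod>e\<in>hedges H. (1 - t) * W (mimg \<phi> e) + t)"
    by (simp add: sum.distrib sum_distrib_left c mult.commute)
  then have "((1 - ?s) * (\<Sum>\<phi>\<in>?\<Phi>. \<Prod>e\<in>hedges H. W (mimg \<phi> e)) + ?s * real m ^ card (verts H)) / real m ^ card (verts H)
      \<le> hdens m H (\<lambda>M. (1 - t) * W M + t)"
    unfolding hdens_def by (intro divide_right_mono) auto
  then show ?thesis using assms(1) by (simp add: hdens_def add_divide_distrib)
qed

lemma (in linear_uniform) hdens_const: "m > 0 \<Longrightarrow> hdens m H (\<lambda>_. c) = c ^ card (hedges H)"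
  by (simp add: hdens_def card_PiE)

lemma kcost_const: "m > 0 \<Longrightarrow> kcost p k m (\<lambda>_. c) = rel_entropy p c"
  by (simp add: kcost_def tsum_def card_PiE)

text \<open>The limit is the supremum of the eventual lower bounds. Almost monotonicity says that
  \<open>a m - \<eta>\<close> is such a bound for all large \<open>m\<close>, which caps
  \<open>a m\<close> by the supremum plus \<open>\<eta>\<close>.\<close>

lemma almost_mono_convergent:
  fixes a :: "nat \<Rightarrow> real"
  assumes lo: "\<forall>\<^sub>F n in sequentially. a n \<ge> B" and hi: "\<forall>\<^sub>F n in sequentially. a n \<le> C"
    and mono: "\<And>\<eta>. \<eta> > 0 \<Longrightarrow> \<forall>\<^sub>F m in sequentially. \<forall>\<^sub>F n in sequentially. a n \<ge> a m - \<eta>"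
  obtains L where "a \<longlonglongrightarrow> L"
proof -
  define S where "S = {x. \<forall>\<^sub>F n in sequentially. a n \<ge> x}"
  have ne: "S \<noteq> {}" using lo by (auto simp: S_def)
  have bdd: "bdd_above S"
  proof (rule bdd_aboveI)
    fix x assume "x \<in> S"
    then have "\<forall>\<^sub>F n in sequentially. a n \<ge> x" by (simp add: S_def)
    with hi have "\<forall>\<^sub>F n in sequentially. x \<le> C" by eventually_elim auto
    then show "x \<le> C" by simp
  qed
  have "a \<longlonglongrightarrow> Sup S"
  proof (rule tendstoI)
    fix \<eta> :: real assume \<eta>: "\<eta> > 0"
    obtain x where x: "x \<in> S" "x > Sup S - \<eta>"
      using less_cSup_iff[OF ne bdd, of "Sup S - \<eta>"] \<eta> by auto
    have "\<forall>\<^sub>F m in sequentially. a m - \<eta> / 2 \<in> S" using mono[of "\<eta> / 2"] \<eta> by (simp add: S_def)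
    then have up: "\<forall>\<^sub>F m in sequentially. a m - \<eta> / 2 \<le> Sup S"
      by eventually_elim (rule cSup_upper[OF _ bdd])
    have "\<forall>\<^sub>F n in sequentially. a n \<ge> x" using x by (simp add: S_def)
    then show "\<forall>\<^sub>F n in sequentially. dist (a n) (Sup S) < \<eta>"
      using up
    proof eventually_elim
      case (elim n)
      then show ?case using x \<eta> by (simp add: dist_real_def abs_less_iff)
    qed
  qed
  then show thesis by (rule that)
qed

locale tail_setup = linear_uniform k H for k :: nat and H :: "'v hypergraph" +
  fixes d :: nat and p r :: real
  assumes d2: "d \<ge> 2" and k2: "k \<ge> 2" and p0: "0 < p" and pr: "p \<le> r" and r1: "r < 1"
    and ne: "verts H \<noteq> {}" and reg: "regular_hypergraph d H"
begin

definition UT :: "nat \<Rightarrow> nat set set set" where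
  "UT n = {E. hom_density H (graph n E) \<ge> r ^ card (hedges H)}"

definition P :: "nat \<Rightarrow> nat set set set \<Rightarrow> real" where
  "P n A = bprob (ksets n k) (\<lambda>_. p) A"

abbreviation N :: "nat \<Rightarrow> real" where "N n \<equiv> real (n choose k)"

abbreviation eH :: real where "eH \<equiv> real (card (hedges H))"

definition rate :: "nat \<Rightarrow> real" where "rate n = ln (P n (UT n)) / N n"

lemma p1: "p < 1" and r0: "0 < r"
  using p0 pr r1 by auto

lemma degree_le: "d \<le> card (hedges H)"
proof -
  obtain v where "v \<in> verts H" using ne by auto
  then have "d = card {e \<in> hedges H. v \<in> e}" using reg by (simp add: regular_hypergraph_def)
  also have "\<dots> \<le> card (hedges H)" by (intro card_mono) auto
  finally show ?thesis .
qed

lemma hedges_nonempty: "card (hedges H) > 0"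
  using degree_le d2 by simp

text \<open>A vertex of degree \<open>d \<ge> 2\<close> provides hyperedges, so the threshold lies
  strictly below \<open>1\<close> and leaves room for an increase of density.\<close>

lemma rH: "0 < r ^ card (hedges H)" "r ^ card (hedges H) < 1"
  using r0 r1 hedges_nonempty by (auto simp: power_less_one_iff)

lemma N_pos: "\<forall>\<^sub>F n in sequentially. N n > 0"
  using choose_at_top[of k] k2 by (auto simp: filterlim_at_top_dense)

lemma P_mono: "(\<And>E. E \<subseteq> ksets n k \<Longrightarrow> E \<in> A \<Longrightarrow> E \<in> B) \<Longrightarrow> P n A \<le> P n B"
  unfolding P_def using p0 p1 by (intro bprob_mono) auto

lemma P_nonneg: "P n A \<ge> 0" and P_le_1: "P n A \<le> 1"
  unfolding P_def using p0 p1 by (auto intro!: bprob_nonneg bprob_le_1)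

lemma ldp_lower_UT:
  assumes "m > 0" "\<And>M. W M \<in> {0..1}" "r ^ card (hedges H) < hdens m H W" "\<eta> > 0"
  shows "\<forall>\<^sub>F n in sequentially. P n (UT n) > 0 \<and> rate n \<ge> - kcost p k m W - \<eta>"
  using ldp_lower[OF k2 p0 p1 assms] unfolding P_def UT_def rate_def .

text \<open>Collects what the upper bound delivers for a subevent \<open>A\<close> of the upper
  tail: a graph \<open>E\<close> of the event, its cut-close structured part \<open>w\<close>, and
  the cost of \<open>w\<close> as a bound for the probability. Constraints imposed by
  \<open>A\<close> pass to \<open>w\<close> through \<open>E\<close>.\<close>

definition approximates :: "real \<Rightarrow> nat \<Rightarrow> nat set set set \<Rightarrow> nat set set \<Rightarrow> (nat set \<Rightarrow> real) \<Rightarrow> bool" where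
  "approximates \<epsilon> n A E w \<longleftrightarrow> E \<subseteq> ksets n k \<and> E \<in> UT n \<inter> A \<and> (\<forall>e\<in>ksets n k. w e \<in> {0..1}) \<and>
      (\<forall>B. (\<forall>i<k. B i \<subseteq> {..<n}) \<longrightarrow>
        \<bar>tsum k B (skern n k (\<lambda>e. of_bool (e \<in> E))) - tsum k B (skern n k w)\<bar> \<le> \<epsilon> * real n ^ k) \<and>
      ln (P n (UT n \<inter> A)) \<le> - (\<Sum>e\<in>ksets n k. rel_entropy p (w e)) + \<epsilon> * N n"

lemma ldp_upper_UT:
  assumes "\<epsilon> > 0"
  shows "\<forall>\<^sub>F n in sequentially. \<forall>A. P n (UT n \<inter> A) > 0 \<longrightarrow> (\<exists>E w. approximates \<epsilon> n A E w)"
  using ldp_upper[OF k2 p0 p1 assms]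
proof eventually_elim
  case (elim n)
  show ?case
  proof (intro allI impI)
    fix A assume "P n (UT n \<inter> A) > 0"
    then show "\<exists>E w. approximates \<epsilon> n A E w"
      unfolding approximates_def P_def by (rule mp[OF spec[OF elim]])
  qed
qed

lemma approximates_UT: "approximates \<epsilon> n A E w \<Longrightarrow> hdens n H (skern n k (\<lambda>e. of_bool (e \<in> E))) \<ge> r ^ card (hedges H)"
  using hom_density_graph[of E n] by (simp add: UT_def approximates_def)

lemma approximates_range: "approximates \<epsilon> n A E w \<Longrightarrow> e \<in> ksets n k \<Longrightarrow> w e \<in> {0..1}"
  unfolding approximates_def by blast

lemma approximates_cut:
  "approximates \<epsilon> n A E w \<Longrightarrow> (\<And>i. i < k \<Longrightarrow> B i \<subseteq> {..<n}) \<Longrightarrow>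
    \<bar>tsum k B (skern n k (\<lambda>e. of_bool (e \<in> E))) - tsum k B (skern n k w)\<bar> \<le> \<epsilon> * real n ^ k"
  unfolding approximates_def by blast

lemma approximates_hdens:
  assumes "approximates \<epsilon> n A E w" "n > 0"
  shows "hdens n H (skern n k w) \<ge> r ^ card (hedges H) - eH * \<epsilon>"
proof -
  let ?G = "skern n k (\<lambda>e. of_bool (e \<in> E))"
  have "\<bar>hdens n H ?G - hdens n H (skern n k w)\<bar> \<le> eH * \<epsilon>"
  proof (rule counting_lemma[OF assms(2)])
    show "skern n k w M \<in> {0..1}" for M by (rule skern_range) (rule approximates_range[OF assms(1)])
    show "?G M \<in> {0..1}" for M by (rule skern_range) simp
  qed (rule approximates_cut[OF assms(1)])
  then show ?thesis using approximates_UT[OF assms(1)] by linarith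
qed

lemma approximates_cost:
  assumes "approximates \<epsilon> n A E w" "N n > 0"
  shows "ln (P n (UT n \<inter> A)) / N n \<le> - avg (ksets n k) (\<lambda>e. rel_entropy p (w e)) + \<epsilon>"
proof -
  have "ln (P n (UT n \<inter> A)) \<le> - (\<Sum>e\<in>ksets n k. rel_entropy p (w e)) + \<epsilon> * N n"
    using assms(1) unfolding approximates_def by blast
  then have "ln (P n (UT n \<inter> A)) / N n \<le> (- (\<Sum>e\<in>ksets n k. rel_entropy p (w e)) + \<epsilon> * N n) / N n"
    using assms(2) by (intro divide_right_mono) auto
  also have "\<dots> = - avg (ksets n k) (\<lambda>e. rel_entropy p (w e)) + \<epsilon>"
    using assms(2) by (simp add: avg_def card_ksets diff_divide_distrib)
  finally show ?thesis .
qed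

lemma UT_pos: "\<forall>\<^sub>F n in sequentially. P n (UT n) > 0 \<and> rate n \<ge> - rel_entropy p 1 - 1"
  using ldp_lower_UT[of 1 "\<lambda>_. 1" 1] rH by (simp add: hdens_const kcost_const)

text \<open>Tuples with a repetition have weight \<open>0\<close> and hence cost
  \<open>rel_entropy p 0\<close>; their share is at most \<open>k\<^sup>2 / n\<close>.\<close>

lemma kcost_skern_le:
  assumes n: "n > 0" and N: "N n > 0" and w: "\<And>e. e \<in> ksets n k \<Longrightarrow> w e \<in> {0..1}"
  shows "kcost p k n (skern n k w) \<le> avg (ksets n k) (\<lambda>e. rel_entropy p (w e)) + (real k)\<^sup>2 / real n * rel_entropy p 0"
proof -
  let ?h = "rel_entropy p" and ?K = "ksets n k"
  let ?c = "real (inj_tuples k)"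
  have h0: "?h 0 \<ge> 0" using rel_entropy_nonneg(1)[of p 0] p0 p1 by simp
  have S0: "(\<Sum>e\<in>?K. ?h (w e)) \<ge> 0" using rel_entropy_nonneg(1)[OF p0 p1 w] by (intro sum_nonneg) auto
  have eq: "?h (skern n k w M) = skern n k (\<lambda>e. ?h (w e)) M + ?h 0 * (1 - skern n k (\<lambda>_. 1) M)" for M
    by (simp add: skern_def)
  have "tsum k (\<lambda>_. {..<n}) (\<lambda>M. ?h (skern n k w M))
      = tsum k (\<lambda>_. {..<n}) (skern n k (\<lambda>e. ?h (w e)))
        + ?h 0 * (tsum k (\<lambda>_. {..<n}) (\<lambda>_. 1) - tsum k (\<lambda>_. {..<n}) (skern n k (\<lambda>_. 1)))"
    unfolding eq tsum_def by (simp add: sum.distrib sum_distrib_left sum_subtractf right_diff_distrib)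
  also have "\<dots> = ?c * (\<Sum>e\<in>?K. ?h (w e)) + ?h 0 * (real n ^ k - ?c * N n)"
    by (simp add: tsum_skern_full tsum_one card_ksets)
  also have "\<dots> \<le> real n ^ k / N n * (\<Sum>e\<in>?K. ?h (w e)) + ?h 0 * ((real k)\<^sup>2 / real n * real n ^ k)"
  proof (intro add_mono mult_mono mult_left_mono)
    show "?c \<le> real n ^ k / N n" using inj_tuples_choose_le[of k n] N by (simp add: pos_le_divide_eq)
    show "real n ^ k - ?c * N n \<le> (real k)\<^sup>2 / real n * real n ^ k"
      using inj_tuples_choose_ge[OF n, of k] by (simp add: left_diff_distrib)
  qed (use h0 S0 N inj_tuples_choose_le[of k n] in auto)
  finally have "kcost p k n (skern n k w) \<le> (real n ^ k / N n * (\<Sum>e\<in>?K. ?h (w e)) + ?h 0 * ((real k)\<^sup>2 / real n * real n ^ k)) / real n ^ k"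
    unfolding kcost_def by (intro divide_right_mono) auto
  also have "\<dots> = avg ?K (\<lambda>e. ?h (w e)) + (real k)\<^sup>2 / real n * ?h 0"
    using n N by (simp add: avg_def card_ksets add_divide_distrib)
  finally show ?thesis .
qed

lemma kcost_boost_le:
  assumes "n > 0" "\<And>M. W M \<in> {0..1}" "0 < t" "t < 1"
  shows "kcost p k n (\<lambda>M. (1 - t) * W M + t) \<le> kcost p k n W + t * rel_entropy p 1"
proof -
  have "tsum k (\<lambda>_. {..<n}) (\<lambda>M. rel_entropy p ((1 - t) * W M + t))
      \<le> tsum k (\<lambda>_. {..<n}) (\<lambda>M. rel_entropy p (W M) + t * rel_entropy p 1)"
    by (intro tsum_mono rel_entropy_boost p0 p1 assms)
  also have "\<dots> = tsum k (\<lambda>_. {..<n}) (\<lambda>M. rel_entropy p (W M)) + t * rel_entropy p 1 * real n ^ k"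
    by (simp add: tsum_def sum.distrib card_PiE)
  finally have "kcost p k n (\<lambda>M. (1 - t) * W M + t)
      \<le> (tsum k (\<lambda>_. {..<n}) (\<lambda>M. rel_entropy p (W M)) + t * rel_entropy p 1 * real n ^ k) / real n ^ k"
    unfolding kcost_def by (intro divide_right_mono) auto
  also have "\<dots> = kcost p k n W + t * rel_entropy p 1"
    using assms(1) by (simp add: kcost_def add_divide_distrib)
  finally show ?thesis .
qed

text \<open>A typical upper-tail graph on \<open>m\<close> vertices yields, after a small boost, a kernel that can be blown
  up to all larger vertex sets.\<close>

lemma rate_almost_mono:
  assumes "\<eta> > 0"
  shows "\<forall>\<^sub>F m in sequentially. \<forall>\<^sub>F n in sequentially. rate n \<ge> rate m - \<eta>"
proof -
  define h1 where "h1 = rel_entropy p 1"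
  have h1: "h1 \<ge> 0" using rel_entropy_nonneg(1)[of p 1] p0 p1 by (simp add: h1_def)
  \<comment> \<open>The boost costs at most \<open>t * rel_entropy p 1\<close>, here a quarter of
    \<open>\<eta>\<close>.\<close>
  define t where "t = min (1/2) (\<eta> / (4 * (h1 + 1)))"
  have t: "0 < t" "t < 1" using assms h1 by (auto simp: t_def)
  have th: "t * h1 \<le> \<eta> / 4"
  proof -
    have "t * h1 \<le> t * (h1 + 1)" using t by simp
    also have "\<dots> \<le> \<eta> / (4 * (h1 + 1)) * (h1 + 1)" using h1 by (intro mult_right_mono) (auto simp: t_def)
    also have "\<dots> = \<eta> / 4" using h1 by (simp add: field_simps)
    finally show ?thesis .
  qed
  define s where "s = t ^ card (hedges H)"
  have s: "0 < s" "s < 1" using t hedges_nonempty by (auto simp: s_def power_less_one_iff)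
  have eH: "eH > 0" using hedges_nonempty by simp
  \<comment> \<open>The boost lifts a density \<open>R\<close> at the threshold to
    \<open>R + s * (1 - R)\<close>; the counting lemma may lose at most half of this gain.\<close>
  define \<epsilon> where "\<epsilon> = min (\<eta> / 4) (s * (1 - r ^ card (hedges H)) / (2 * eH))"
  have \<epsilon>: "\<epsilon> > 0" using assms s rH eH by (auto simp: \<epsilon>_def)
  have e\<epsilon>: "eH * \<epsilon> \<le> s * (1 - r ^ card (hedges H)) / 2"
  proof -
    have "eH * \<epsilon> \<le> eH * (s * (1 - r ^ card (hedges H)) / (2 * eH))" using eH by (intro mult_left_mono) (auto simp: \<epsilon>_def)
    also have "\<dots> = s * (1 - r ^ card (hedges H)) / 2" using eH by simp
    finally show ?thesis .
  qed
  have "(\<lambda>n. (real k)\<^sup>2 / real n * rel_entropy p 0) \<longlonglongrightarrow> 0" by real_asymp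
  then have "\<forall>\<^sub>F n in sequentially. (real k)\<^sup>2 / real n * rel_entropy p 0 < \<eta> / 4"
    using assms by (intro order_tendstoD(2)) auto
  then show ?thesis
    using ldp_upper_UT[OF \<epsilon>] UT_pos N_pos eventually_gt_at_top[of 0]
  proof eventually_elim
    case (elim m)
    have "P m (UT m \<inter> UNIV) > 0" using elim by simp
    with elim(2) obtain E w where app: "approximates \<epsilon> m UNIV E w" by blast
    note w01 = approximates_range[OF app]
    have hd: "hdens m H (skern m k w) \<ge> r ^ card (hedges H) - eH * \<epsilon>"
      by (rule approximates_hdens[OF app]) (use elim in auto)
    have lnP: "rate m \<le> - avg (ksets m k) (\<lambda>e. rel_entropy p (w e)) + \<epsilon>"
      using approximates_cost[OF app] elim by (simp add: rate_def)
    let ?W = "skern m k w"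
    define W where "W M = (1 - t) * ?W M + t" for M
    have W01: "?W M \<in> {0..1}" for M by (rule skern_range) (rule w01)
    have W: "W M \<in> {0..1}" for M
    proof -
      have "(1 - t) * ?W M \<le> 1 - t" using mult_left_mono[of "?W M" 1 "1 - t"] W01[of M] t by auto
      moreover have "0 \<le> (1 - t) * ?W M" using W01[of M] t by auto
      ultimately show ?thesis using t unfolding W_def atLeastAtMost_iff by linarith
    qed
    have "hdens m H W \<ge> (1 - s) * hdens m H ?W + s"
      unfolding W_def s_def using elim W01 t by (intro hdens_boost_ge) auto
    moreover have "(1 - s) * hdens m H ?W \<ge> (1 - s) * (r ^ card (hedges H) - eH * \<epsilon>)"
      using hd s by (intro mult_left_mono) auto
    moreover have "(1 - s) * (r ^ card (hedges H) - eH * \<epsilon>) + s > r ^ card (hedges H)"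
    proof -
      have "(1 - s) * (eH * \<epsilon>) \<le> 1 * (eH * \<epsilon>)" using s eH \<epsilon> by (intro mult_right_mono) auto
      also have "\<dots> < s * (1 - r ^ card (hedges H))"
      proof -
        have "s * (1 - r ^ card (hedges H)) > 0" using s rH by simp
        then show ?thesis using e\<epsilon> by simp
      qed
      finally show ?thesis by (simp add: algebra_simps)
    qed
    ultimately have "r ^ card (hedges H) < hdens m H W" by linarith
    then have ev: "\<forall>\<^sub>F n in sequentially. P n (UT n) > 0 \<and> rate n \<ge> - kcost p k m W - \<eta> / 4"
      by (intro ldp_lower_UT W) (use elim assms in auto)
    have "kcost p k m W \<le> kcost p k m ?W + t * rel_entropy p 1"
      unfolding W_def by (rule kcost_boost_le) (use elim W01 t in auto)
    also have "\<dots> \<le> avg (ksets m k) (\<lambda>e. rel_entropy p (w e)) + (real k)\<^sup>2 / real m * rel_entropy p 0 + t * rel_entropy p 1"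
      using kcost_skern_le[of m w] elim w01 by auto
    also have "\<dots> \<le> (- rate m + \<epsilon>) + \<eta> / 4 + \<eta> / 4"
      using lnP elim(1) th unfolding h1_def by linarith
    also have "\<dots> \<le> - rate m + \<eta> / 4 + \<eta> / 4 + \<eta> / 4" by (simp add: \<epsilon>_def)
    finally have cost: "kcost p k m W \<le> - rate m + \<eta> / 4 + \<eta> / 4 + \<eta> / 4" .
    from ev show ?case
    proof eventually_elim
      case (elim n)
      then show ?case using cost by linarith
    qed
  qed
qed

lemma rate_convergent:
  obtains L where "rate \<longlonglongrightarrow> L"
proof (rule almost_mono_convergent[of "- rel_entropy p 1 - 1" rate 0])
  show "\<forall>\<^sub>F n in sequentially. - rel_entropy p 1 - 1 \<le> rate n"
    using UT_pos by eventually_elim auto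
  show "\<forall>\<^sub>F n in sequentially. rate n \<le> 0"
    using UT_pos
  proof eventually_elim
    case (elim n)
    then have "ln (P n (UT n)) \<le> 0" using P_le_1[of n "UT n"] by simp
    then show ?case by (simp add: rate_def divide_nonpos_nonneg)
  qed
qed (use rate_almost_mono that in blast)+

text \<open>The whole upper tail eventually has exponent above \<open>L - c / 2\<close> and its bad
  part at most \<open>L - c\<close>. The quotient is at most \<open>exp (- c / 2 * N n)\<close>, and
  half of the leading term of \<open>N n\<close> gives the constant
  \<open>c / (4 * real (inj_tuples k))\<close>.\<close>

lemma cond_exponential:
  assumes L: "rate \<longlonglongrightarrow> L" and c: "c > 0"
    and bad: "\<forall>\<^sub>F n in sequentially. P n (UT n \<inter> Bad n) \<le> exp ((L - c) * N n)"
  obtains C where "C > 0"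
    "\<forall>\<^sub>F n in sequentially. P n (UT n) > 0 \<and> P n (UT n \<inter> Bad n) / P n (UT n) \<le> exp (- C * real n ^ k)"
proof (rule that[of "c / (4 * real (inj_tuples k))"])
  show "c / (4 * real (inj_tuples k)) > 0" using c inj_tuples_pos[of k] by simp
  have "\<forall>\<^sub>F n in sequentially. rate n > L - c / 2" using L c by (intro order_tendstoD(1)) auto
  then show "\<forall>\<^sub>F n in sequentially. P n (UT n) > 0 \<and>
      P n (UT n \<inter> Bad n) / P n (UT n) \<le> exp (- (c / (4 * real (inj_tuples k))) * real n ^ k)"
    using bad UT_pos N_pos choose_ge_eventually[of k]
  proof eventually_elim
    case (elim n)
    have "ln (P n (UT n)) \<ge> (L - c / 2) * N n" using elim by (simp add: rate_def pos_less_divide_eq less_imp_le)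
    then have ge: "P n (UT n) \<ge> exp ((L - c / 2) * N n)" using elim by (metis exp_le_cancel_iff exp_ln)
    have "P n (UT n \<inter> Bad n) / P n (UT n) \<le> exp ((L - c) * N n) / exp ((L - c / 2) * N n)"
      using ge elim P_nonneg by (intro frac_le) auto
    also have "\<dots> = exp (- (c / 2 * N n))" by (simp add: algebra_simps flip: exp_diff)
    also have "\<dots> \<le> exp (- (c / (4 * real (inj_tuples k))) * real n ^ k)"
    proof -
      have "c / 2 * (real n ^ k / (2 * real (inj_tuples k))) \<le> c / 2 * N n"
        using elim c by (intro mult_left_mono) auto
      then show ?thesis by simp
    qed
    finally show ?case using elim by simp
  qed
qed

section \<open>Cut distance to a constant\<close>

lemma cut_dist_ge:
  assumes "E \<subseteq> ksets n k" "\<And>i. i < k \<Longrightarrow> B i \<subseteq> {..<n}"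
  shows "\<bar>tsum k B (skern n k (\<lambda>e. of_bool (e \<in> E))) - tsum k B (\<lambda>_. s)\<bar> / real n ^ k \<le> cut_dist k (graph n E) s"
proof -
  let ?F = "\<lambda>A. \<bar>real (edge_tuples k (graph n E) A) - s * (\<Prod>i<k. real (card (A i)))\<bar> / real (card (verts (graph n E))) ^ k"
  let ?B = "restrict B {..<k}"
  have fin: "finite ({..<k} \<rightarrow>\<^sub>E Pow (verts (graph n E)))"
    by (intro finite_PiE) (auto simp: graph_def)
  have "?B \<in> {..<k} \<rightarrow>\<^sub>E Pow (verts (graph n E))" using assms(2) by (auto simp: graph_def)
  then have "?F ?B \<le> cut_dist k (graph n E) s"
    unfolding cut_dist_def by (rule cSUP_upper) (intro bdd_above_finite finite_imageI fin)
  moreover have "tsum k ?B U = tsum k B U" for U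
  proof -
    have "PiE {..<k} ?B = PiE {..<k} B" by (rule PiE_cong) simp
    then show ?thesis by (simp add: tsum_def)
  qed
  moreover have "tsum k ?B (\<lambda>_. s) = s * (\<Prod>i<k. real (card (?B i)))"
    by (simp add: tsum_def card_PiE)
  moreover have "real (edge_tuples k (graph n E) ?B) = tsum k ?B (skern n k (\<lambda>e. of_bool (e \<in> E)))"
    using assms by (intro edge_tuples_graph) auto
  ultimately show ?thesis by (simp add: graph_def)
qed

lemma cut_dist_attained:
  assumes "E \<subseteq> ksets n k"
  obtains B where "\<And>i. i < k \<Longrightarrow> B i \<subseteq> {..<n}"
    "cut_dist k (graph n E) s = \<bar>tsum k B (skern n k (\<lambda>e. of_bool (e \<in> E))) - tsum k B (\<lambda>_. s)\<bar> / real n ^ k"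
proof -
  let ?F = "\<lambda>A. \<bar>real (edge_tuples k (graph n E) A) - s * (\<Prod>i<k. real (card (A i)))\<bar> / real (card (verts (graph n E))) ^ k"
  let ?I = "{..<k} \<rightarrow>\<^sub>E Pow (verts (graph n E))"
  have fin: "finite ?I" by (intro finite_PiE) (auto simp: graph_def)
  have ne: "?I \<noteq> {}" by (auto simp: PiE_eq_empty_iff)
  have "cut_dist k (graph n E) s \<in> ?F ` ?I"
    unfolding cut_dist_def using fin ne by (metis (no_types, lifting) Max_in cSup_eq_Max finite_imageI image_is_empty)
  then obtain B where B: "B \<in> ?I" "cut_dist k (graph n E) s = ?F B" by blast
  have sub: "B i \<subseteq> {..<n}" if "i < k" for i using B(1) that by (auto simp: graph_def)
  have "tsum k B (\<lambda>_. s) = s * (\<Prod>i<k. real (card (B i)))"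
    by (simp add: tsum_def card_PiE)
  then have "cut_dist k (graph n E) s = \<bar>tsum k B (skern n k (\<lambda>e. of_bool (e \<in> E))) - tsum k B (\<lambda>_. s)\<bar> / real n ^ k"
    using B(2) edge_tuples_graph[OF assms sub] by (simp add: graph_def)
  with sub show thesis by (rule that)
qed

end

lemma ln_le_imp_le_exp:
  assumes "0 < x" "ln x \<le> (y::real)"
  shows "x \<le> exp y"
proof -
  have "exp (ln x) \<le> exp y" using assms(2) by simp
  then show ?thesis using assms(1) by simp
qed

lemma power_ge_continuous:
  fixes r :: real
  assumes "0 < r" "e > 0" "\<delta> > 0"
  obtains x where "x > 0" "\<And>s. s \<ge> 0 \<Longrightarrow> s ^ e \<ge> r ^ e - x \<Longrightarrow> s \<ge> r - \<delta>"
proof -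
  define y where "y = max 0 (r - \<delta>)"
  have y: "0 \<le> y" "y < r" using assms by (auto simp: y_def)
  then have lt: "y ^ e < r ^ e" using assms by (intro power_strict_mono) auto
  define x where "x = (r ^ e - y ^ e) / 2"
  have x: "x > 0" "r ^ e - x = y ^ e + x" using lt by (auto simp: x_def field_simps)
  show thesis
  proof (rule that[OF x(1)])
    fix s :: real assume s: "s \<ge> 0" "s ^ e \<ge> r ^ e - x"
    show "s \<ge> r - \<delta>"
    proof (rule ccontr)
      assume "\<not> s \<ge> r - \<delta>"
      then have "s \<le> y" by (auto simp: y_def)
      then have "s ^ e \<le> y ^ e" using s by (intro power_mono) auto
      then show False using s(2) x by linarith
    qed
  qed
qed

lemma tuple_count_le_inj:
  assumes "\<And>i. i < k \<Longrightarrow> B i \<subseteq> {..<n}" "e \<in> ksets n k"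
  shows "tuple_count k B e \<le> inj_tuples k"
proof -
  have "tuple_count k B e \<le> tuple_count k (\<lambda>_. {..<n}) e"
    unfolding tuple_count_def
  proof (rule card_mono)
    show "finite {a \<in> {..<k} \<rightarrow>\<^sub>E {..<n}. a ` {..<k} = e}"
      by (rule finite_subset[of _ "{..<k} \<rightarrow>\<^sub>E {..<n}"]) (auto intro!: finite_PiE)
    have "PiE {..<k} B \<subseteq> {..<k} \<rightarrow>\<^sub>E {..<n}" using assms(1) by (intro PiE_mono) auto
    then show "{a \<in> PiE {..<k} B. a ` {..<k} = e} \<subseteq> {a \<in> {..<k} \<rightarrow>\<^sub>E {..<n}. a ` {..<k} = e}" by blast
  qed
  then show ?thesis using tuple_count_full[OF assms(2)] by simp
qed

context tail_setup
begin

lemma ksets_nonempty: "N n > 0 \<Longrightarrow> ksets n k \<noteq> {}"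
  using card_ksets[of n k] by auto

lemma avg_power_ge:
  assumes n: "n > 0" and N: "N n > 0" and w: "\<And>e. e \<in> ksets n k \<Longrightarrow> w e \<in> {0..1}"
    and s: "s \<ge> 0" "hdens n H (skern n k w) \<ge> s"
  shows "avg (ksets n k) (\<lambda>e. w e ^ d) ^ card (hedges H) \<ge> s ^ d"
proof -
  have W: "skern n k w M \<in> {0..1}" for M by (rule skern_range) (rule w)
  have S0: "(\<Sum>e\<in>ksets n k. w e ^ d) \<ge> 0" using w by (intro sum_nonneg) auto
  have pw: "(\<lambda>M. skern n k w M ^ d) = skern n k (\<lambda>e. w e ^ d)" using d2 by (auto simp: skern_def)
  have "s ^ d \<le> hdens n H (skern n k w) ^ d" using s by (intro power_mono) auto
  also have "\<dots> \<le> (tsum k (\<lambda>_. {..<n}) (\<lambda>M. skern n k w M ^ d) / real n ^ k) ^ card (hedges H)"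
    by (rule hdens_finner[OF reg]) (use d2 n W in auto)
  also have "\<dots> \<le> avg (ksets n k) (\<lambda>e. w e ^ d) ^ card (hedges H)"
  proof (rule power_mono)
    have "tsum k (\<lambda>_. {..<n}) (\<lambda>M. skern n k w M ^ d) = real (inj_tuples k) * (\<Sum>e\<in>ksets n k. w e ^ d)"
      unfolding pw by (rule tsum_skern_full)
    also have "\<dots> \<le> real n ^ k / N n * (\<Sum>e\<in>ksets n k. w e ^ d)"
      using inj_tuples_choose_le[of k n] N S0 by (intro mult_right_mono) (auto simp: pos_le_divide_eq)
    also have "\<dots> = real n ^ k * avg (ksets n k) (\<lambda>e. w e ^ d)" by (simp add: avg_def card_ksets)
    finally show "tsum k (\<lambda>_. {..<n}) (\<lambda>M. skern n k w M ^ d) / real n ^ k \<le> avg (ksets n k) (\<lambda>e. w e ^ d)"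
      using n by (simp add: pos_divide_le_eq mult.commute)
    show "0 \<le> tsum k (\<lambda>_. {..<n}) (\<lambda>M. skern n k w M ^ d) / real n ^ k"
      unfolding tsum_def using W by (intro divide_nonneg_nonneg sum_nonneg) auto
  qed
  finally show ?thesis .
qed

text \<open>Finner's inequality bounds a power of the mean of \<open>w ^ d\<close>, with exponent
  the number of hyperedges, by the \<open>d\<close>-th power of the density. At the exact threshold
  both sides are the same power of \<open>r\<close>, so continuity absorbs the loss
  \<open>eH * \<epsilon>\<close>.\<close>

lemma avg_power_near:
  assumes "\<eta> > 0"
  obtains \<epsilon>0 where "\<epsilon>0 > 0"
    "\<And>\<epsilon> n A E w. \<epsilon> \<le> \<epsilon>0 \<Longrightarrow> n > 0 \<Longrightarrow> N n > 0 \<Longrightarrow> approximates \<epsilon> n A E w \<Longrightarrow>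
       avg (ksets n k) (\<lambda>e. w e ^ d) \<ge> r ^ d - \<eta>"
proof -
  obtain x where x: "x > 0" "\<And>Y. Y \<ge> 0 \<Longrightarrow> Y ^ card (hedges H) \<ge> (r ^ d) ^ card (hedges H) - x \<Longrightarrow> Y \<ge> r ^ d - \<eta>"
    using power_ge_continuous[of "r ^ d" "card (hedges H)" \<eta>] r0 hedges_nonempty assms by auto
  let ?R = "r ^ card (hedges H)"
  have Rd: "?R ^ d = (r ^ d) ^ card (hedges H)" by (simp flip: power_mult add: mult.commute)
  have "((\<lambda>\<epsilon>. (?R - eH * \<epsilon>) ^ d) \<longlongrightarrow> (?R - eH * 0) ^ d) (at_right 0)" by (intro tendsto_intros)
  then have "\<forall>\<^sub>F \<epsilon> in at_right 0. (?R - eH * \<epsilon>) ^ d > ?R ^ d - x" using x by (intro order_tendstoD(1)) auto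
  moreover have "((\<lambda>\<epsilon>. ?R - eH * \<epsilon>) \<longlongrightarrow> ?R - eH * 0) (at_right 0)" by (intro tendsto_intros)
  then have "\<forall>\<^sub>F \<epsilon> in at_right 0. ?R - eH * \<epsilon> > 0" using rH by (intro order_tendstoD(1)) auto
  moreover have "\<forall>\<^sub>F \<epsilon> in at_right 0. (\<epsilon>::real) > 0" by (simp add: eventually_at_right_less)
  ultimately have "\<forall>\<^sub>F \<epsilon> in at_right 0. (?R - eH * \<epsilon>) ^ d > ?R ^ d - x \<and> ?R - eH * \<epsilon> > 0 \<and> \<epsilon> > 0"
    by eventually_elim auto
  then obtain \<epsilon>0 where \<epsilon>0: "(?R - eH * \<epsilon>0) ^ d > ?R ^ d - x" "?R - eH * \<epsilon>0 > 0" "\<epsilon>0 > 0"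
    using eventually_happens trivial_limit_at_right_real by blast
  show thesis
  proof (rule that[OF \<epsilon>0(3)])
    fix \<epsilon> n A E w assume \<epsilon>: "\<epsilon> \<le> \<epsilon>0" and n: "n > 0" "N n > 0" and app: "approximates \<epsilon> n A E w"
    have "eH * \<epsilon> \<le> eH * \<epsilon>0" using \<epsilon> by (intro mult_left_mono) auto
    then have "hdens n H (skern n k w) \<ge> ?R - eH * \<epsilon>0" using approximates_hdens[OF app n(1)] by linarith
    then have "avg (ksets n k) (\<lambda>e. w e ^ d) ^ card (hedges H) \<ge> (?R - eH * \<epsilon>0) ^ d"
      using \<epsilon>0(2) by (intro avg_power_ge n approximates_range[OF app]) auto
    then have "avg (ksets n k) (\<lambda>e. w e ^ d) ^ card (hedges H) \<ge> (r ^ d) ^ card (hedges H) - x"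
      using \<epsilon>0(1) unfolding Rd by linarith
    moreover have "avg (ksets n k) (\<lambda>e. w e ^ d) \<ge> 0"
      unfolding avg_def using approximates_range[OF app] by (intro divide_nonneg_nonneg sum_nonneg) auto
    ultimately show "avg (ksets n k) (\<lambda>e. w e ^ d) \<ge> r ^ d - \<eta>" by (intro x(2))
  qed
qed

text \<open>A constant kernel with value \<open>s > r\<close>, taken on a single vertex, has density
  strictly above the threshold; its cost tends to that of \<open>r\<close> as \<open>s\<close>
  decreases to \<open>r\<close>.\<close>

lemma rate_ge_const:
  assumes "\<eta> > 0"
  shows "\<forall>\<^sub>F n in sequentially. rate n \<ge> - rel_entropy p r - \<eta>"
proof -
  have "isCont (rel_entropy p) r"
    using has_real_derivative_rel_entropy[OF p0 p1 r0 r1] by (rule DERIV_isCont)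
  then have "(rel_entropy p \<longlongrightarrow> rel_entropy p r) (at_right r)"
    by (auto simp: isCont_def intro: tendsto_within_subset)
  then have "\<forall>\<^sub>F s in at_right r. rel_entropy p s < rel_entropy p r + \<eta> / 2"
    using assms by (intro order_tendstoD(2)) auto
  moreover have "\<forall>\<^sub>F s in at_right r. s > r" by (simp add: eventually_at_right_less)
  moreover have "\<forall>\<^sub>F s in at_right r. s < 1" using r1 eventually_at_right by blast
  ultimately have "\<forall>\<^sub>F s in at_right r. rel_entropy p s < rel_entropy p r + \<eta> / 2 \<and> s > r \<and> s < 1"
    by eventually_elim auto
  then obtain s where s: "rel_entropy p s < rel_entropy p r + \<eta> / 2" "s > r" "s < 1"
    using eventually_happens trivial_limit_at_right_real by blast
  have "r ^ card (hedges H) < hdens 1 H (\<lambda>_. s)"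
    using s r0 hedges_nonempty by (simp add: hdens_const power_strict_mono)
  then have "\<forall>\<^sub>F n in sequentially. P n (UT n) > 0 \<and> rate n \<ge> - kcost p k 1 (\<lambda>_. s) - \<eta> / 2"
    using s r0 assms by (intro ldp_lower_UT) auto
  then show ?thesis
  proof eventually_elim
    case (elim n)
    then show ?case using s(1) by (simp add: kcost_const)
  qed
qed

text \<open>The exponent \<open>e\<close> is kept general: \<open>d\<close> for the supporting line
  in the symmetric phase, \<open>1\<close> for the ordinary tangent when a graph is close to a
  constant.\<close>

lemma avg_cost_ge:
  assumes \<kappa>: "\<And>u. u \<in> {0..1} \<Longrightarrow> rel_entropy p u \<ge> rel_entropy p r + \<kappa> * (u ^ e - r ^ e)"
    and N: "N n > 0" and w: "\<And>e. e \<in> ksets n k \<Longrightarrow> w e \<in> {0..1}"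
  shows "avg (ksets n k) (\<lambda>e. rel_entropy p (w e)) \<ge> rel_entropy p r + \<kappa> * (avg (ksets n k) (\<lambda>x. w x ^ e) - r ^ e)"
proof -
  note K = finite_ksets[of n k] ksets_nonempty[OF N]
  have "avg (ksets n k) (\<lambda>x. rel_entropy p r + \<kappa> * (w x ^ e - r ^ e)) \<le> avg (ksets n k) (\<lambda>e. rel_entropy p (w e))"
    by (intro avg_mono \<kappa> w)
  then show ?thesis by (simp only: avg_add avg_cmult avg_diff avg_const[OF K])
qed

context
  fixes \<kappa> :: real
  assumes \<kappa>: "\<And>u. u \<in> {0..1} \<Longrightarrow> rel_entropy p u \<ge> rel_entropy p r + \<kappa> * (u ^ d - r ^ d)"
begin

lemma \<kappa>_nonneg: "\<kappa> \<ge> 0"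
proof -
  have "real d * r ^ (d - 1) > 0" using r0 d2 by auto
  moreover have "\<kappa> * (real d * r ^ (d - 1)) = rel_entropy_deriv p r"
    by (rule supporting_slope_eq[OF p0 p1 r0 r1 \<kappa>])
  then have "\<kappa> * (real d * r ^ (d - 1)) \<ge> 0"
    using rel_entropy_deriv_nonneg[OF p0 pr r1] by simp
  ultimately show ?thesis by (metis not_le zero_le_mult_iff)
qed

lemma rate_symmetric: "rate \<longlonglongrightarrow> - rel_entropy p r"
proof (rule tendstoI)
  fix \<eta> :: real assume \<eta>: "\<eta> > 0"
  define \<eta>' where "\<eta>' = \<eta> / (4 * (\<kappa> + 1))"
  have \<eta>': "\<eta>' > 0" using \<eta> \<kappa>_nonneg by (simp add: \<eta>'_def)
  have \<kappa>\<eta>: "\<kappa> * \<eta>' \<le> \<eta> / 4"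
  proof -
    have "\<kappa> * \<eta>' \<le> (\<kappa> + 1) * \<eta>'" using \<eta>' by simp
    also have "\<dots> = \<eta> / 4" using \<kappa>_nonneg by (simp add: \<eta>'_def field_simps)
    finally show ?thesis .
  qed
  obtain \<epsilon>0 where \<epsilon>0: "\<epsilon>0 > 0"
    "\<And>\<epsilon> n A E w. \<epsilon> \<le> \<epsilon>0 \<Longrightarrow> n > 0 \<Longrightarrow> N n > 0 \<Longrightarrow> approximates \<epsilon> n A E w \<Longrightarrow>
       avg (ksets n k) (\<lambda>e. w e ^ d) \<ge> r ^ d - \<eta>'" by (rule avg_power_near[OF \<eta>']) blast
  define \<epsilon> where "\<epsilon> = min \<epsilon>0 (\<eta> / 4)"
  have \<epsilon>: "\<epsilon> > 0" "\<epsilon> \<le> \<epsilon>0" "\<epsilon> \<le> \<eta> / 4" using \<epsilon>0(1) \<eta> by (auto simp: \<epsilon>_def)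
  have "\<eta> / 2 > 0" using \<eta> by simp
  from ldp_upper_UT[OF \<epsilon>(1)] rate_ge_const[OF this] UT_pos N_pos eventually_gt_at_top[of 0]
  show "\<forall>\<^sub>F n in sequentially. dist (rate n) (- rel_entropy p r) < \<eta>"
  proof eventually_elim
    case (elim n)
    then have "P n (UT n \<inter> UNIV) > 0" by simp
    with elim(1) obtain E w where app: "approximates \<epsilon> n UNIV E w" by blast
    have "\<kappa> * (avg (ksets n k) (\<lambda>e. w e ^ d) - r ^ d) \<ge> \<kappa> * (- \<eta>')"
      using \<epsilon>0(2)[OF \<epsilon>(2) elim(5,4) app] \<kappa>_nonneg by (intro mult_left_mono) auto
    then have "avg (ksets n k) (\<lambda>e. rel_entropy p (w e)) \<ge> rel_entropy p r - \<eta> / 4"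
      using avg_cost_ge[OF \<kappa> elim(4), where w = w] approximates_range[OF app] \<kappa>\<eta> by simp
    then have "rate n \<le> - rel_entropy p r + \<eta> / 2"
      using approximates_cost[OF app elim(4)] \<epsilon>(3) by (simp add: rate_def)
    then show ?case using elim(2) \<eta> by (simp add: dist_real_def abs_less_iff)
  qed
qed

text \<open>A graph far from \<open>r\<close> in cut distance has a structured part far from
  \<open>r\<close> in mean. Since its \<open>d\<close>-th powers still have mean almost
  \<open>r ^ d\<close>, stability leaves only one way out: the cost exceeds that of \<open>r\<close>
  by \<open>\<eta>\<close>, half of which survives the approximation error.\<close>

lemma symmetric_bad:
  assumes \<epsilon>0: "\<epsilon>0 > 0"
  obtains c where "c > 0"
    "\<forall>\<^sub>F n in sequentially. P n (UT n \<inter> {E. cut_dist k (graph n E) r \<ge> \<epsilon>0}) \<le> exp ((- rel_entropy p r - c) * N n)"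
proof -
  have \<epsilon>4: "\<epsilon>0 / 4 > 0" using \<epsilon>0 by simp
  show thesis
  proof (rule replica_stability[OF p0 pr r1 d2 \<kappa> \<epsilon>4])
    fix \<eta> assume \<eta>: "\<eta> > 0"
      "\<And>(K :: nat set set) w. finite K \<Longrightarrow> K \<noteq> {} \<Longrightarrow> (\<And>e. e \<in> K \<Longrightarrow> w e \<in> {0..1}) \<Longrightarrow>
         avg K (\<lambda>e. w e ^ d) \<ge> r ^ d - \<eta> \<Longrightarrow> avg K (\<lambda>e. rel_entropy p (w e)) \<le> rel_entropy p r + \<eta> \<Longrightarrow>
         avg K (\<lambda>e. \<bar>w e - r\<bar>) \<le> \<epsilon>0 / 4"
    obtain \<epsilon>1 where \<epsilon>1: "\<epsilon>1 > 0"
      "\<And>\<epsilon> n A E w. \<epsilon> \<le> \<epsilon>1 \<Longrightarrow> n > 0 \<Longrightarrow> N n > 0 \<Longrightarrow> approximates \<epsilon> n A E w \<Longrightarrow>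
         avg (ksets n k) (\<lambda>e. w e ^ d) \<ge> r ^ d - \<eta>" by (rule avg_power_near[OF \<eta>(1)]) blast
    define \<epsilon> where "\<epsilon> = min \<epsilon>1 (min (\<epsilon>0 / 4) (\<eta> / 2))"
    have \<epsilon>: "\<epsilon> > 0" "\<epsilon> \<le> \<epsilon>1" "\<epsilon> \<le> \<epsilon>0 / 4" "\<epsilon> \<le> \<eta> / 2" using \<epsilon>1(1) \<eta>(1) \<epsilon>0 by (auto simp: \<epsilon>_def)
    show thesis
    proof (rule that[of "\<eta> / 2"])
      have "(\<lambda>n. (real k)\<^sup>2 / real n) \<longlonglongrightarrow> 0" by real_asymp
      then have "\<forall>\<^sub>F n in sequentially. (real k)\<^sup>2 / real n < \<epsilon>0 / 4" using \<epsilon>0 by (intro order_tendstoD(2)) auto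
      then show "\<forall>\<^sub>F n in sequentially. P n (UT n \<inter> {E. cut_dist k (graph n E) r \<ge> \<epsilon>0}) \<le> exp ((- rel_entropy p r - \<eta> / 2) * N n)"
        using ldp_upper_UT[OF \<epsilon>(1)] N_pos eventually_gt_at_top[of 0]
      proof eventually_elim
        case (elim n)
        let ?A = "{E. cut_dist k (graph n E) r \<ge> \<epsilon>0}" and ?K = "ksets n k"
        show ?case
        proof (cases "P n (UT n \<inter> ?A) > 0")
          case False
          then have "P n (UT n \<inter> ?A) = 0" using P_nonneg[of n "UT n \<inter> ?A"] by linarith
          then show ?thesis by simp
        next
          case True
          with elim(2) obtain E w where app: "approximates \<epsilon> n ?A E w" by blast
          note w01 = approximates_range[OF app]
          have E: "E \<subseteq> ?K" "cut_dist k (graph n E) r \<ge> \<epsilon>0" using app by (auto simp: approximates_def)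
          obtain B where B: "\<And>i. i < k \<Longrightarrow> B i \<subseteq> {..<n}"
            "cut_dist k (graph n E) r = \<bar>tsum k B (skern n k (\<lambda>e. of_bool (e \<in> E))) - tsum k B (\<lambda>_. r)\<bar> / real n ^ k"
            using cut_dist_attained[OF E(1)] by blast
          have nk: "real n ^ k > 0" using elim by simp
          have 1: "\<epsilon>0 * real n ^ k \<le> \<bar>tsum k B (skern n k (\<lambda>e. of_bool (e \<in> E))) - tsum k B (\<lambda>_. r)\<bar>"
            using E(2) nk unfolding B(2) by (simp add: pos_le_divide_eq)
          have "\<epsilon> * real n ^ k \<le> \<epsilon>0 / 4 * real n ^ k" using \<epsilon>(3) nk by (intro mult_right_mono) auto
          moreover have "\<bar>tsum k B (skern n k (\<lambda>e. of_bool (e \<in> E))) - tsum k B (skern n k w)\<bar> \<le> \<epsilon> * real n ^ k"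
            by (rule approximates_cut[OF app]) (rule B(1))
          ultimately have 2: "\<bar>tsum k B (skern n k (\<lambda>e. of_bool (e \<in> E))) - tsum k B (skern n k w)\<bar> \<le> \<epsilon>0 / 4 * real n ^ k"
            by linarith
          have "\<bar>tsum k B (\<lambda>_. r) - tsum k B (skern n k (\<lambda>_. r))\<bar> \<le> 1 * ((real k)\<^sup>2 / real n * real n ^ k)"
            by (rule tsum_skern_kernel_diff) (use elim r0 r1 B(1) in auto)
          moreover have "(real k)\<^sup>2 / real n * real n ^ k \<le> \<epsilon>0 / 4 * real n ^ k"
            using elim(1) nk by (intro mult_right_mono) auto
          ultimately have 3: "\<bar>tsum k B (\<lambda>_. r) - tsum k B (skern n k (\<lambda>_. r))\<bar> \<le> \<epsilon>0 / 4 * real n ^ k" by linarith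
          have "\<bar>tsum k B (skern n k w) - tsum k B (skern n k (\<lambda>_. r))\<bar> \<le> real n ^ k * avg ?K (\<lambda>e. \<bar>w e - r\<bar>)"
          proof -
            have "\<bar>tsum k B (skern n k w) - tsum k B (skern n k (\<lambda>_. r))\<bar> = \<bar>\<Sum>e\<in>?K. real (tuple_count k B e) * (w e - r)\<bar>"
              by (subst tsum_skern_diff) (use B(1) in auto)
            also have "\<dots> \<le> (\<Sum>e\<in>?K. \<bar>real (tuple_count k B e) * (w e - r)\<bar>)" by (rule sum_abs)
            also have "\<dots> \<le> (\<Sum>e\<in>?K. real (inj_tuples k) * \<bar>w e - r\<bar>)"
            proof (intro sum_mono)
              fix e assume e: "e \<in> ?K"
              have "tuple_count k B e \<le> inj_tuples k" by (rule tuple_count_le_inj[OF _ e]) (rule B(1))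
              then have "real (tuple_count k B e) * \<bar>w e - r\<bar> \<le> real (inj_tuples k) * \<bar>w e - r\<bar>"
                by (intro mult_right_mono) auto
              then show "\<bar>real (tuple_count k B e) * (w e - r)\<bar> \<le> real (inj_tuples k) * \<bar>w e - r\<bar>"
                by (simp add: abs_mult)
            qed
            also have "\<dots> = real (inj_tuples k) * (\<Sum>e\<in>?K. \<bar>w e - r\<bar>)" by (simp add: sum_distrib_left)
            also have "\<dots> \<le> real n ^ k / N n * (\<Sum>e\<in>?K. \<bar>w e - r\<bar>)"
              using inj_tuples_choose_le[of k n] elim(3) by (intro mult_right_mono sum_nonneg) (auto simp: pos_le_divide_eq)
            also have "\<dots> = real n ^ k * avg ?K (\<lambda>e. \<bar>w e - r\<bar>)" by (simp add: avg_def card_ksets)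
            finally show ?thesis .
          qed
          \<comment> \<open>Of the distance \<open>\<epsilon>0\<close> one quarter goes to passing
            from \<open>E\<close> to \<open>w\<close> and one quarter to collisions; the remaining
            half exceeds the \<open>\<epsilon>0 / 4\<close> of the stability bound.\<close>
          with 1 2 3 have "\<epsilon>0 / 2 * real n ^ k \<le> real n ^ k * avg ?K (\<lambda>e. \<bar>w e - r\<bar>)" by linarith
          then have "\<epsilon>0 / 2 \<le> avg ?K (\<lambda>e. \<bar>w e - r\<bar>)" using nk by (simp add: mult.commute)
          then have "\<not> avg ?K (\<lambda>e. \<bar>w e - r\<bar>) \<le> \<epsilon>0 / 4" using \<epsilon>0 by linarith
          moreover have "avg ?K (\<lambda>e. w e ^ d) \<ge> r ^ d - \<eta>" by (rule \<epsilon>1(2)[OF \<epsilon>(2) elim(4,3) app])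
          ultimately have "\<not> avg ?K (\<lambda>e. rel_entropy p (w e)) \<le> rel_entropy p r + \<eta>"
            using \<eta>(2)[where w = w, OF finite_ksets ksets_nonempty[OF elim(3)]] w01 by blast
          then have "ln (P n (UT n \<inter> ?A)) / N n \<le> - rel_entropy p r - \<eta> / 2"
            using approximates_cost[OF app elim(3)] \<epsilon>(4) by linarith
          then have "ln (P n (UT n \<inter> ?A)) \<le> (- rel_entropy p r - \<eta> / 2) * N n"
            using elim(3) by (simp only: pos_divide_le_eq)
          then show ?thesis by (rule ln_le_imp_le_exp[OF True])
        qed
      qed
    qed (use \<eta> in auto)
  qed
qed

end

text \<open>An upper-tail graph close to a constant \<open>s\<close> has density close to a power of
  \<open>s\<close>, so \<open>s\<close> is at least about \<open>r\<close>, and the mean weight is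
  close to \<open>s\<close>. The tangent of the entropy at \<open>r\<close>, of nonnegative slope,
  then gives a cost of at least about that of \<open>r\<close>.\<close>

lemma near_const_bad:
  assumes \<delta>: "\<delta> > 0"
  obtains \<epsilon> where "\<epsilon> > 0"
    "\<forall>\<^sub>F n in sequentially. P n (UT n \<inter> {E. \<exists>s\<in>{0..1}. cut_dist k (graph n E) s \<le> \<epsilon>}) \<le> exp ((- rel_entropy p r + \<delta>) * N n)"
proof -
  define D where "D = rel_entropy_deriv p r"
  have D: "D \<ge> 0" unfolding D_def by (rule rel_entropy_deriv_nonneg[OF p0 pr r1])
  define \<delta>' where "\<delta>' = \<delta> / (4 * (D + 1))"
  have \<delta>': "\<delta>' > 0" using \<delta> D by (simp add: \<delta>'_def)
  obtain x where x: "x > 0" "\<And>s. s \<ge> 0 \<Longrightarrow> s ^ card (hedges H) \<ge> r ^ card (hedges H) - x \<Longrightarrow> s \<ge> r - \<delta>'"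
    using power_ge_continuous[OF r0 hedges_nonempty \<delta>'] by blast
  have eH: "eH > 0" using hedges_nonempty by simp
  define \<epsilon> where "\<epsilon> = min (x / eH) (min \<delta>' (\<delta> / 4) / 2)"
  have \<epsilon>: "\<epsilon> > 0" "\<epsilon> \<le> x / eH" "2 * \<epsilon> \<le> \<delta>'" "\<epsilon> \<le> \<delta> / 4" using x(1) eH \<delta> \<delta>' by (auto simp: \<epsilon>_def)
  have D\<delta>: "D * (2 * \<delta>') \<le> \<delta> / 2"
  proof -
    have "D * (2 * \<delta>') \<le> (D + 1) * (2 * \<delta>')" using \<delta>' by (intro mult_right_mono) auto
    also have "\<dots> = \<delta> / 2" using D by (simp add: \<delta>'_def field_simps)
    finally show ?thesis .
  qed
  have tangent: "rel_entropy p u \<ge> rel_entropy p r + D * (u ^ 1 - r ^ 1)" if "u \<in> {0..1}" for u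
    using rel_entropy_ge_tangent[OF p0 p1 r0 r1 that] by (simp add: D_def)
  show thesis
  proof (rule that[OF \<epsilon>(1)])
    show "\<forall>\<^sub>F n in sequentially. P n (UT n \<inter> {E. \<exists>s\<in>{0..1}. cut_dist k (graph n E) s \<le> \<epsilon>}) \<le> exp ((- rel_entropy p r + \<delta>) * N n)"
      using ldp_upper_UT[OF \<epsilon>(1)] N_pos eventually_gt_at_top[of 0]
    proof eventually_elim
      case (elim n)
      let ?A = "{E. \<exists>s\<in>{0..1}. cut_dist k (graph n E) s \<le> \<epsilon>}" and ?K = "ksets n k"
      show ?case
      proof (cases "P n (UT n \<inter> ?A) > 0")
        case False
        then have "P n (UT n \<inter> ?A) = 0" using P_nonneg[of n "UT n \<inter> ?A"] by linarith
        then show ?thesis by simp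
      next
        case True
        with elim(1) obtain E w where app: "approximates \<epsilon> n ?A E w" by blast
        note w01 = approximates_range[OF app]
        obtain s where s: "0 \<le> s" "s \<le> 1" "cut_dist k (graph n E) s \<le> \<epsilon>" and E: "E \<subseteq> ?K"
          using app by (auto simp: approximates_def)
        have nk: "real n ^ k > 0" using elim by simp
        let ?G = "skern n k (\<lambda>e. of_bool (e \<in> E))"
        have close: "\<bar>tsum k B ?G - tsum k B (\<lambda>_. s)\<bar> \<le> \<epsilon> * real n ^ k" if "\<And>i. i < k \<Longrightarrow> B i \<subseteq> {..<n}" for B
        proof -
          have "\<bar>tsum k B ?G - tsum k B (\<lambda>_. s)\<bar> / real n ^ k \<le> \<epsilon>"
            by (rule order_trans[OF cut_dist_ge[OF E] s(3)]) (rule that)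
          then show ?thesis using nk by (simp add: pos_divide_le_eq)
        qed
        have "\<bar>hdens n H ?G - hdens n H (\<lambda>_. s)\<bar> \<le> eH * \<epsilon>"
        proof (rule counting_lemma[OF elim(3)])
          show "?G M \<in> {0..1}" for M by (rule skern_range) simp
        qed (use close s in auto)
        moreover have "eH * \<epsilon> \<le> x" using \<epsilon>(2) eH by (simp add: pos_le_divide_eq mult.commute)
        ultimately have "s ^ card (hedges H) \<ge> r ^ card (hedges H) - x"
          using approximates_UT[OF app] hdens_const[OF elim(3), of s] by linarith
        then have s_ge: "s \<ge> r - \<delta>'" using s by (intro x(2)) auto
        have "\<bar>tsum k (\<lambda>_. {..<n}) ?G - tsum k (\<lambda>_. {..<n}) (skern n k w)\<bar> \<le> \<epsilon> * real n ^ k"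
          by (rule approximates_cut[OF app]) simp
        moreover have "\<bar>tsum k (\<lambda>_. {..<n}) ?G - tsum k (\<lambda>_. {..<n}) (\<lambda>_. s)\<bar> \<le> \<epsilon> * real n ^ k"
          by (rule close) simp
        moreover have "tsum k (\<lambda>_. {..<n}) (\<lambda>_. s) = s * real n ^ k"
          by (simp add: tsum_def card_PiE)
        ultimately have "s * real n ^ k - 2 * (\<epsilon> * real n ^ k) \<le> tsum k (\<lambda>_. {..<n}) (skern n k w)" by linarith
        also have "\<dots> = real (inj_tuples k) * sum w ?K" by (rule tsum_skern_full)
        also have "\<dots> \<le> real n ^ k / N n * sum w ?K"
          using inj_tuples_choose_le[of k n] elim(2) w01
          by (intro mult_right_mono sum_nonneg) (auto simp: pos_le_divide_eq)
        also have "\<dots> = real n ^ k * avg ?K w" by (simp add: avg_def card_ksets)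
        finally have "real n ^ k * (s - 2 * \<epsilon>) \<le> real n ^ k * avg ?K w" by (simp add: algebra_simps)
        then have "s - 2 * \<epsilon> \<le> avg ?K w" using nk by simp
        then have "avg ?K w - r \<ge> - (2 * \<delta>')" using s_ge \<epsilon>(3) by linarith
        then have "D * (avg ?K w - r) \<ge> D * (- (2 * \<delta>'))" using D by (intro mult_left_mono)
        moreover have "avg ?K (\<lambda>e. rel_entropy p (w e)) \<ge> rel_entropy p r + D * (avg ?K w - r)"
          using avg_cost_ge[where e = 1 and w = w, OF tangent elim(2) w01] by simp
        ultimately have "avg ?K (\<lambda>e. rel_entropy p (w e)) \<ge> rel_entropy p r - \<delta> / 2" using D\<delta> by simp
        then have "ln (P n (UT n \<inter> ?A)) / N n \<le> - rel_entropy p r + \<delta>"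
          using approximates_cost[OF app elim(2)] \<epsilon>(4) \<delta> by linarith
        then have "ln (P n (UT n \<inter> ?A)) \<le> (- rel_entropy p r + \<delta>) * N n"
          using elim(2) by (simp only: pos_divide_le_eq)
        then show ?thesis by (rule ln_le_imp_le_exp[OF True])
      qed
    qed
  qed
qed

end

section \<open>Symmetry breaking\<close>

text \<open>The event that \<open>v\<close> is the only vertex sent into \<open>S\<close> factors
  over the vertices, so the sum of products is a product of sums.\<close>

lemma sum_exactly_one:
  fixes g :: "nat \<Rightarrow> real"
  assumes V: "finite V" and X: "finite X" "S \<subseteq> X" and v: "v \<in> V"
  shows "(\<Sum>\<phi>\<in>V \<rightarrow>\<^sub>E X. if {u \<in> V. \<phi> u \<in> S} = {v} then g (\<phi> v) else 0)
    = sum g S * real (card (X - S)) ^ (card V - 1)"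
proof -
  have fS: "finite S" using X finite_subset by auto
  let ?f = "\<lambda>u y. if u = v then (if y \<in> S then g y else 0) else of_bool (y \<notin> S)"
  have "(\<Sum>\<phi>\<in>V \<rightarrow>\<^sub>E X. if {u \<in> V. \<phi> u \<in> S} = {v} then g (\<phi> v) else 0)
      = (\<Sum>\<phi>\<in>V \<rightarrow>\<^sub>E X. \<Prod>u\<in>V. ?f u (\<phi> u))"
  proof (intro sum.cong refl)
    fix \<phi>
    have "(\<Prod>u\<in>V. ?f u (\<phi> u)) = ?f v (\<phi> v) * (\<Prod>u\<in>V - {v}. ?f u (\<phi> u))"
      by (rule prod.remove[OF V v])
    also have "(\<Prod>u\<in>V - {v}. ?f u (\<phi> u)) = (\<Prod>u\<in>V - {v}. of_bool (\<phi> u \<notin> S))"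
      by (intro prod.cong) auto
    also have "\<dots> = of_bool (\<forall>u\<in>V - {v}. \<phi> u \<notin> S)"
      using V by (cases "\<forall>u\<in>V - {v}. \<phi> u \<notin> S") (auto simp: prod_zero_iff)
    finally have "(\<Prod>u\<in>V. ?f u (\<phi> u)) = (if \<phi> v \<in> S then g (\<phi> v) else 0) * of_bool (\<forall>u\<in>V - {v}. \<phi> u \<notin> S)"
      by simp
    moreover have "{u \<in> V. \<phi> u \<in> S} = {v} \<longleftrightarrow> \<phi> v \<in> S \<and> (\<forall>u\<in>V - {v}. \<phi> u \<notin> S)"
      using v by auto
    ultimately show "(if {u \<in> V. \<phi> u \<in> S} = {v} then g (\<phi> v) else 0) = (\<Prod>u\<in>V. ?f u (\<phi> u))"
      by simp
  qed
  also have "\<dots> = (\<Prod>u\<in>V. \<Sum>y\<in>X. ?f u y)"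
    by (rule prod_sum_PiE[symmetric]) (use V X in auto)
  also have "\<dots> = (\<Sum>y\<in>X. ?f v y) * (\<Prod>u\<in>V - {v}. \<Sum>y\<in>X. ?f u y)"
    by (rule prod.remove[OF V v])
  also have "(\<Sum>y\<in>X. ?f v y) = sum g S"
    using X by (simp add: sum.inter_restrict[symmetric] Int_absorb1)
  also have "(\<Prod>u\<in>V - {v}. \<Sum>y\<in>X. ?f u y) = (\<Prod>u\<in>V - {v}. real (card (X - S)))"
  proof (intro prod.cong refl)
    fix u assume u: "u \<in> V - {v}"
    then have "(\<Sum>y\<in>X. ?f u y) = (\<Sum>y\<in>X. of_bool (y \<notin> S))" by auto
    also have "\<dots> = real (card (X - S))"
      using X(1) by (simp add: of_bool_def sum.If_cases set_diff_eq Int_def)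
    finally show "(\<Sum>y\<in>X. ?f u y) = real (card (X - S))" .
  qed
  also have "\<dots> = real (card (X - S)) ^ (card V - 1)" using V v by simp
  finally show ?thesis .
qed

lemma card_none:
  assumes "finite V" "finite X" "S \<subseteq> X"
  shows "card {\<phi> \<in> V \<rightarrow>\<^sub>E X. {u \<in> V. \<phi> u \<in> S} = {}} = card (X - S) ^ card V"
proof -
  have "{\<phi> \<in> V \<rightarrow>\<^sub>E X. {u \<in> V. \<phi> u \<in> S} = {}} = V \<rightarrow>\<^sub>E (X - S)"
    by (auto simp: PiE_def Pi_def)
  then show ?thesis using assms(1) by (simp add: card_PiE)
qed

text \<open>The perturbed kernel of Lubetzky and Zhao: only multisets with exactly one element below \<open>s\<close>
  receive a value other than \<open>r\<close>, namely the value \<open>\<rho>\<close> of that element.\<close>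

definition perturb :: "nat \<Rightarrow> (nat \<Rightarrow> real) \<Rightarrow> real \<Rightarrow> nat multiset \<Rightarrow> real" where
  "perturb s \<rho> r M = (let F = filter_mset (\<lambda>i. i < s) M in
     if size F = 1 then (\<Sum>i\<in>#F. \<rho> i) else r)"

lemma perturb_mimg:
  assumes "finite e"
  shows "{u \<in> e. \<phi> u < s} = {v} \<Longrightarrow> perturb s \<rho> r (mimg \<phi> e) = \<rho> (\<phi> v)"
    and "\<nexists>v. {u \<in> e. \<phi> u < s} = {v} \<Longrightarrow> perturb s \<rho> r (mimg \<phi> e) = r"
proof -
  have F: "filter_mset (\<lambda>i. i < s) (mimg \<phi> e) = image_mset \<phi> (mset_set {u \<in> e. \<phi> u < s})"
    using assms by (simp add: mimg_def filter_mset_image_mset comp_def)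
  show "perturb s \<rho> r (mimg \<phi> e) = \<rho> (\<phi> v)" if "{u \<in> e. \<phi> u < s} = {v}"
    unfolding perturb_def Let_def F that by simp
  show "perturb s \<rho> r (mimg \<phi> e) = r" if "\<nexists>v. {u \<in> e. \<phi> u < s} = {v}"
  proof -
    have "card {u \<in> e. \<phi> u < s} \<noteq> 1" using that by (metis card_1_singletonE)
    then show ?thesis unfolding perturb_def Let_def F by simp
  qed
qed

lemma perturb_range:
  assumes "\<And>i. \<rho> i \<in> {0..1}" "r \<in> {0..1}"
  shows "perturb s \<rho> r M \<in> {0..1}"
proof (cases "size (filter_mset (\<lambda>i. i < s) M) = 1")
  case True
  then obtain i where "filter_mset (\<lambda>i. i < s) M = {#i#}" by (metis size_1_singleton_mset)
  then show ?thesis using assms(1)[of i] by (simp add: perturb_def)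
qed (use assms in \<open>simp add: perturb_def\<close>)

text \<open>Only tuples with exactly one entry below \<open>s\<close> deviate from \<open>r\<close>:
  there are \<open>k\<close> positions for that entry and \<open>x ^ (k - 1)\<close> choices for the
  rest. The identity is exact, so the sign of the change does not depend on
  \<open>x\<close>.\<close>

lemma kcost_perturb:
  assumes "k > 0" "x > 0"
  shows "kcost p k (s + x) (perturb s \<rho> r)
    = rel_entropy p r + real k * real x ^ (k - 1) * (\<Sum>i<s. rel_entropy p (\<rho> i) - rel_entropy p r) / real (s + x) ^ k"
proof -
  let ?h = "rel_entropy p" and ?X = "{..<s + x}" and ?\<Phi> = "{..<k} \<rightarrow>\<^sub>E {..<s + x}"
  let ?g = "\<lambda>i. ?h (\<rho> i) - ?h r"
  have c: "card (?X - {..<s}) = x" by (simp add: card_Diff_subset)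
  have "tsum k (\<lambda>_. ?X) (\<lambda>M. ?h (perturb s \<rho> r M))
      = (\<Sum>a\<in>?\<Phi>. ?h r + (\<Sum>v<k. if {u \<in> {..<k}. a u \<in> {..<s}} = {v} then ?g (a v) else 0))"
    unfolding tsum_def
  proof (intro sum.cong refl)
    fix a
    show "?h (perturb s \<rho> r (mimg a {..<k}))
        = ?h r + (\<Sum>v<k. if {u \<in> {..<k}. a u \<in> {..<s}} = {v} then ?g (a v) else 0)"
    proof (cases "\<exists>v. {u \<in> {..<k}. a u < s} = {v}")
      case True
      then obtain v where v: "{u \<in> {..<k}. a u < s} = {v}" by blast
      then have "v < k" by auto
      have "(\<Sum>v'<k. if {u \<in> {..<k}. a u \<in> {..<s}} = {v'} then ?g (a v') else 0) = (\<Sum>v'<k. if v' = v then ?g (a v') else 0)"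
        using v by (intro sum.cong) auto
      also have "\<dots> = ?g (a v)" using \<open>v < k\<close> by simp
      finally show ?thesis using perturb_mimg(1)[OF _ v] by simp
    next
      case False
      then have "(\<Sum>v<k. if {u \<in> {..<k}. a u \<in> {..<s}} = {v} then ?g (a v) else 0) = 0"
        by (intro sum.neutral) auto
      then show ?thesis using perturb_mimg(2)[of "{..<k}" a s] False by simp
    qed
  qed
  also have "\<dots> = ?h r * real (s + x) ^ k + (\<Sum>v<k. \<Sum>a\<in>?\<Phi>. if {u \<in> {..<k}. a u \<in> {..<s}} = {v} then ?g (a v) else 0)"
    by (subst sum.swap) (simp add: sum.distrib card_PiE mult.commute)
  also have "(\<Sum>v<k. \<Sum>a\<in>?\<Phi>. if {u \<in> {..<k}. a u \<in> {..<s}} = {v} then ?g (a v) else 0)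
      = (\<Sum>v<k. (\<Sum>i<s. ?g i) * real x ^ (k - 1))"
    by (intro sum.cong refl, subst sum_exactly_one) (use c in auto)
  finally show ?thesis
    using assms(2) by (simp add: kcost_def add_divide_distrib mult_ac)
qed

context tail_setup
begin

text \<open>Maps sending no vertex or exactly one vertex of \<open>H\<close> below \<open>s\<close>
  are evaluated exactly; in the second case regularity yields \<open>d\<close> factors from
  \<open>\<rho>\<close> and the others equal to \<open>r\<close>. All remaining maps contribute
  nonnegatively and are dropped.\<close>

lemma hdens_perturb_ge:
  assumes \<rho>: "\<And>i. \<rho> i \<in> {0..1}" and x: "x > 0"
  shows "hdens (s + x) H (perturb s \<rho> r)
    \<ge> real x ^ (card (verts H) - 1) * r ^ (card (hedges H) - d)
       * (real x * r ^ d + real (card (verts H)) * (\<Sum>i<s. \<rho> i ^ d)) / real (s + x) ^ card (verts H)"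
proof -
  let ?X = "{..<s + x}" and ?V = "verts H" and ?E = "hedges H"
  let ?\<Phi> = "?V \<rightarrow>\<^sub>E ?X"
  let ?Z = "\<lambda>\<phi>. {u \<in> ?V. \<phi> u \<in> {..<s}}"
  let ?pr = "\<lambda>\<phi>. \<Prod>e\<in>?E. perturb s \<rho> r (mimg \<phi> e)"
  let ?g = "\<lambda>i. \<rho> i ^ d * r ^ (card ?E - d)"
  have c: "card (?X - {..<s}) = x" by (simp add: card_Diff_subset)
  have fin: "finite ?\<Phi>" by (intro finite_PiE) auto
  have v1: "card ?V = Suc (card ?V - 1)" using ne by (simp add: card_gt_0_iff)
  have deg: "card {e \<in> ?E. v \<in> e} = d" if "v \<in> ?V" for v using reg that by (simp add: regular_hypergraph_def)
  have nn: "?pr \<phi> \<ge> 0" for \<phi>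
    using perturb_range[of \<rho> r s] \<rho> r0 r1 by (intro prod_nonneg) auto
  have none: "?pr \<phi> = r ^ card ?E" if "?Z \<phi> = {}" for \<phi>
  proof -
    have "perturb s \<rho> r (mimg \<phi> e) = r" if e: "e \<in> ?E" for e
    proof (rule perturb_mimg(2)[OF finite_hedge[OF e]])
      show "\<nexists>v. {u \<in> e. \<phi> u < s} = {v}" using \<open>?Z \<phi> = {}\<close> hedges_subset[OF e] by blast
    qed
    then show ?thesis by simp
  qed
  have one: "?pr \<phi> = ?g (\<phi> v)" if Z: "?Z \<phi> = {v}" for \<phi> v
  proof -
    have v: "v \<in> ?V" using Z by auto
    let ?E1 = "{e \<in> ?E. v \<in> e}"
    have "?pr \<phi> = prod (\<lambda>e. perturb s \<rho> r (mimg \<phi> e)) (?E - ?E1) * prod (\<lambda>e. perturb s \<rho> r (mimg \<phi> e)) ?E1"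
      by (rule prod.subset_diff) auto
    also have "prod (\<lambda>e. perturb s \<rho> r (mimg \<phi> e)) ?E1 = (\<Prod>e\<in>?E1. \<rho> (\<phi> v))"
    proof (intro prod.cong refl)
      fix e assume e: "e \<in> ?E1"
      have "{u \<in> e. \<phi> u < s} = {v}" using Z e hedges_subset[of e] by blast
      then show "perturb s \<rho> r (mimg \<phi> e) = \<rho> (\<phi> v)" using e by (intro perturb_mimg(1) finite_hedge) auto
    qed
    also have "prod (\<lambda>e. perturb s \<rho> r (mimg \<phi> e)) (?E - ?E1) = (\<Prod>e\<in>?E - ?E1. r)"
    proof (intro prod.cong refl)
      fix e assume e: "e \<in> ?E - ?E1"
      have "{u \<in> e. \<phi> u < s} \<subseteq> ?Z \<phi>" using e hedges_subset[of e] by auto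
      moreover have "v \<notin> e" using e by blast
      ultimately have "{u \<in> e. \<phi> u < s} = {}" unfolding Z by auto
      then show "perturb s \<rho> r (mimg \<phi> e) = r" using e by (intro perturb_mimg(2) finite_hedge) auto
    qed
    finally show ?thesis using deg[OF v] by (simp add: card_Diff_subset mult.commute)
  qed
  have "(\<Sum>\<phi>\<in>?\<Phi>. (if ?Z \<phi> = {} then r ^ card ?E else 0) + (\<Sum>v\<in>?V. if ?Z \<phi> = {v} then ?g (\<phi> v) else 0)) \<le> (\<Sum>\<phi>\<in>?\<Phi>. ?pr \<phi>)"
  proof (intro sum_mono)
    fix \<phi>
    consider "?Z \<phi> = {}" | v where "?Z \<phi> = {v}" | "?Z \<phi> \<noteq> {}" "\<nexists>v. ?Z \<phi> = {v}" by blast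
    then show "(if ?Z \<phi> = {} then r ^ card ?E else 0) + (\<Sum>v\<in>?V. if ?Z \<phi> = {v} then ?g (\<phi> v) else 0) \<le> ?pr \<phi>"
    proof cases
      case 1
      then have "(\<Sum>v\<in>?V. if ?Z \<phi> = {v} then ?g (\<phi> v) else 0) = 0" by (intro sum.neutral) auto
      then show ?thesis using 1 none[OF 1] by simp
    next
      case (2 v)
      then have "v \<in> ?V" by auto
      have "(\<Sum>v'\<in>?V. if ?Z \<phi> = {v'} then ?g (\<phi> v') else 0) = (\<Sum>v'\<in>?V. if v' = v then ?g (\<phi> v') else 0)"
        unfolding 2 by (intro sum.cong) auto
      also have "\<dots> = ?g (\<phi> v)" using \<open>v \<in> ?V\<close> by simp
      finally have sum: "(\<Sum>v'\<in>?V. if ?Z \<phi> = {v'} then ?g (\<phi> v') else 0) = ?g (\<phi> v)" .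
      have "?Z \<phi> \<noteq> {}" unfolding 2 by simp
      then show ?thesis by (simp only: sum one[OF 2] if_False add_0 order_refl)
    next
      case 3
      then have sum: "(\<Sum>v\<in>?V. if ?Z \<phi> = {v} then ?g (\<phi> v) else 0) = 0" by (intro sum.neutral) auto
      show ?thesis using 3(1) nn[of \<phi>] by (simp only: sum if_False add_0)
    qed
  qed
  also have "(\<Sum>\<phi>\<in>?\<Phi>. (if ?Z \<phi> = {} then r ^ card ?E else 0) + (\<Sum>v\<in>?V. if ?Z \<phi> = {v} then ?g (\<phi> v) else 0))
      = (\<Sum>\<phi>\<in>?\<Phi>. if ?Z \<phi> = {} then r ^ card ?E else 0) + (\<Sum>v\<in>?V. \<Sum>\<phi>\<in>?\<Phi>. if ?Z \<phi> = {v} then ?g (\<phi> v) else 0)"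
    unfolding sum.distrib by (subst sum.swap) simp
  also have "(\<Sum>\<phi>\<in>?\<Phi>. if ?Z \<phi> = {} then r ^ card ?E else 0) = real (card {\<phi> \<in> ?\<Phi>. ?Z \<phi> = {}}) * r ^ card ?E"
    unfolding sum.If_cases[OF fin] by (simp add: Int_def)
  also have "card {\<phi> \<in> ?\<Phi>. ?Z \<phi> = {}} = x ^ card ?V"
    by (subst card_none) (use c in auto)
  also have "(\<Sum>v\<in>?V. \<Sum>\<phi>\<in>?\<Phi>. if ?Z \<phi> = {v} then ?g (\<phi> v) else 0) = (\<Sum>v\<in>?V. sum ?g {..<s} * real x ^ (card ?V - 1))"
    by (intro sum.cong refl, subst sum_exactly_one) (use c in auto)
  also have "\<dots> = real (card ?V) * ((\<Sum>i<s. \<rho> i ^ d) * r ^ (card ?E - d) * real x ^ (card ?V - 1))"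
    by (simp add: sum_distrib_right)
  finally have "real (x ^ card ?V) * r ^ card ?E + real (card ?V) * ((\<Sum>i<s. \<rho> i ^ d) * r ^ (card ?E - d) * real x ^ (card ?V - 1)) \<le> (\<Sum>\<phi>\<in>?\<Phi>. ?pr \<phi>)" .
  moreover have "r ^ card ?E = r ^ d * r ^ (card ?E - d)" using degree_le by (simp flip: power_add)
  moreover have "real (x ^ card ?V) = real x ^ (card ?V - 1) * real x"
    by (subst v1) simp
  ultimately have "real x ^ (card ?V - 1) * r ^ (card ?E - d) * (real x * r ^ d + real (card ?V) * (\<Sum>i<s. \<rho> i ^ d)) \<le> (\<Sum>\<phi>\<in>?\<Phi>. ?pr \<phi>)"
    by (simp add: algebra_simps)
  then show ?thesis unfolding hdens_def by (intro divide_right_mono) auto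
qed

text \<open>To first order \<open>(s + x) ^ v\<close> is \<open>x ^ v + s * v * x ^ (v - 1)\<close>,
  against \<open>x ^ v + T * x ^ (v - 1)\<close>. The comparison is made through the derivative of
  \<open>(1 + s * y) ^ v\<close> at \<open>0\<close> with \<open>y = 1 / x\<close>; the last
  disjunct encodes the condition \<open>Suc v' = v\<close>.\<close>

lemma power_perturb:
  fixes s T :: real
  assumes "s * real v < T"
  shows "\<forall>\<^sub>F x in sequentially. (s + real x) ^ Suc v' < real x ^ v' * (real x + T) \<or> Suc v' \<noteq> v"
proof (cases "Suc v' = v")
  case True
  have "((\<lambda>y. (1 + s * y) ^ v) has_real_derivative s * real v) (at 0)"
    by (auto intro!: derivative_eq_intros simp: mult.commute)
  then have "((\<lambda>y. ((1 + s * y) ^ v - 1) / y) \<longlongrightarrow> s * real v) (at 0)"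
    by (simp add: has_field_derivative_iff)
  then have "((\<lambda>y. ((1 + s * y) ^ v - 1) / y) \<longlongrightarrow> s * real v) (at_right 0)"
    by (rule tendsto_within_subset) auto
  moreover have "filterlim (\<lambda>x. 1 / real x) (at_right 0) sequentially" by real_asymp
  ultimately have "(\<lambda>x. ((1 + s * (1 / real x)) ^ v - 1) / (1 / real x)) \<longlonglongrightarrow> s * real v"
    by (rule filterlim_compose)
  then have "\<forall>\<^sub>F x in sequentially. ((1 + s * (1 / real x)) ^ v - 1) / (1 / real x) < T"
    using assms by (intro order_tendstoD(2)) auto
  then show ?thesis
    using eventually_gt_at_top[of 0]
  proof eventually_elim
    case (elim x)
    have x: "real x > 0" using elim by simp
    have "(1 + s * (1 / real x)) ^ v - 1 < T / real x" using elim x by (simp add: field_simps)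
    then have "real x ^ v * (1 + s * (1 / real x)) ^ v < real x ^ v * (1 + T / real x)"
      using x by (intro mult_strict_left_mono) auto
    moreover have "real x ^ v * (1 + s * (1 / real x)) ^ v = (s + real x) ^ v"
      using x by (simp add: power_mult_distrib[symmetric] field_simps)
    moreover have "real x ^ v * (1 + T / real x) = real x ^ v' * (real x + T)"
      using x by (simp add: True[symmetric] field_simps)
    ultimately show ?case by (simp add: True)
  qed
qed simp

text \<open>The special vertices are split into \<open>a\<close> with value \<open>r1\<close> and
  \<open>b\<close> with value \<open>r2\<close>. The cost falls for every \<open>x\<close>; the gain
  in density is of first order in \<open>1 / x\<close> and the dropped maps of second order, so
  \<open>x\<close> is taken large.\<close>

lemma cheaper_kernel:
  assumes "\<not> (\<exists>\<kappa>. \<forall>u\<in>{0..1}. rel_entropy p u \<ge> rel_entropy p r + \<kappa> * (u ^ d - r ^ d))"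
  obtains m W where "m > 0" "\<And>M. W M \<in> {0..1}" "r ^ card (hedges H) < hdens m H W" "kcost p k m W < rel_entropy p r"
proof -
  obtain r1 r2 :: real and a b :: nat where r12: "r1 \<in> {0..1}" "r2 \<in> {0..1}" "a > 0" "b > 0"
    and gain: "real a * r1 ^ d + real b * r2 ^ d > real (a + b) * r ^ d"
    and cheap: "real a * rel_entropy p r1 + real b * rel_entropy p r2 < real (a + b) * rel_entropy p r"
    by (rule natural_weights_below[OF r0 r1 _ assms]) (use d2 in auto)
  define s where "s = a + b"
  define \<rho> where "\<rho> i = (if i < a then r1 else r2)" for i
  have \<rho>: "\<rho> i \<in> {0..1}" for i using r12 by (simp add: \<rho>_def)
  have split: "(\<Sum>i<s. g (\<rho> i)) = real a * g r1 + real b * g r2" for g :: "real \<Rightarrow> real"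
  proof -
    have "{..<s} = {..<a} \<union> {a..<a + b}" by (auto simp: s_def)
    then have "(\<Sum>i<s. g (\<rho> i)) = (\<Sum>i<a. g (\<rho> i)) + (\<Sum>i\<in>{a..<a + b}. g (\<rho> i))"
      by (simp add: sum.union_disjoint ivl_disj_int)
    then show ?thesis by (simp add: \<rho>_def)
  qed
  define v where "v = card (verts H)"
  have v: "v > 0" unfolding v_def using ne by (simp add: card_gt_0_iff)
  define S where "S = (\<Sum>i<s. \<rho> i ^ d)"
  \<comment> \<open>After division by \<open>r ^ card (hedges H)\<close> the maps that were kept sum
    to \<open>x ^ (v - 1) * (x + T)\<close>, to be compared with \<open>(s + x) ^ v\<close>.\<close>
  define T where "T = real v * S / r ^ d"
  have "S = real a * r1 ^ d + real b * r2 ^ d" unfolding S_def by (rule split)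
  then have "real s * r ^ d < S" using gain by (simp add: s_def)
  then have "real s < S / r ^ d" using r0 by (simp add: pos_less_divide_eq)
  then have "real s * real v < S / r ^ d * real v" using v by (intro mult_strict_right_mono) auto
  then have "real s * real v < T" by (simp add: T_def mult.commute)
  then obtain x where x: "x > 0" "(real s + real x) ^ v < real x ^ (v - 1) * (real x + T)"
    using eventually_happens[OF eventually_conj[OF power_perturb[of "real s" v T "v - 1"] eventually_gt_at_top[of 0]]] v
    by auto
  show thesis
  proof (rule that[of "s + x" "perturb s \<rho> r"])
    show "perturb s \<rho> r M \<in> {0..1}" for M by (intro perturb_range \<rho>) (use r0 r1 in auto)
    have rE: "r ^ card (hedges H) = r ^ (card (hedges H) - d) * r ^ d" using degree_le by (simp flip: power_add)
    have sx: "real (s + x) ^ v > 0" using x by simp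
    have "r ^ card (hedges H) * real (s + x) ^ v < r ^ card (hedges H) * (real x ^ (v - 1) * (real x + T))"
      using x(2) r0 by (intro mult_strict_left_mono) auto
    also have "\<dots> = real x ^ (v - 1) * r ^ (card (hedges H) - d) * (real x * r ^ d + real v * S)"
      using r0 by (simp add: rE T_def field_simps)
    finally have "r ^ card (hedges H) < real x ^ (v - 1) * r ^ (card (hedges H) - d) * (real x * r ^ d + real v * S) / real (s + x) ^ v"
      using sx by (simp add: pos_less_divide_eq)
    also have "\<dots> \<le> hdens (s + x) H (perturb s \<rho> r)"
      unfolding v_def S_def by (rule hdens_perturb_ge[OF \<rho> x(1)])
    finally show "r ^ card (hedges H) < hdens (s + x) H (perturb s \<rho> r)" .
    have "(\<Sum>i<s. rel_entropy p (\<rho> i) - rel_entropy p r) < 0"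
      using cheap unfolding sum_subtractf split by (simp add: s_def)
    then have "real k * real x ^ (k - 1) * (\<Sum>i<s. rel_entropy p (\<rho> i) - rel_entropy p r) / real (s + x) ^ k < 0"
      using x k2 by (intro divide_neg_pos mult_pos_neg) auto
    then show "kcost p k (s + x) (perturb s \<rho> r) < rel_entropy p r"
      using k2 x by (subst kcost_perturb) auto
  qed (use x in auto)
qed

lemma rate_asymmetric:
  assumes "\<not> (\<exists>\<kappa>. \<forall>u\<in>{0..1}. rel_entropy p u \<ge> rel_entropy p r + \<kappa> * (u ^ d - r ^ d))"
    and L: "rate \<longlonglongrightarrow> L"
  shows "L > - rel_entropy p r"
proof (rule cheaper_kernel[OF assms(1)])
  fix m W assume W: "m > 0" "\<And>M. W M \<in> {0..1}" "r ^ card (hedges H) < hdens m H W" "kcost p k m W < rel_entropy p r"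
  define \<eta> where "\<eta> = (rel_entropy p r - kcost p k m W) / 2"
  have \<eta>: "\<eta> > 0" using W(4) by (simp add: \<eta>_def)
  have "\<forall>\<^sub>F n in sequentially. rate n \<ge> - kcost p k m W - \<eta>"
    using ldp_lower_UT[OF W(1-3) \<eta>] by eventually_elim auto
  then have "L \<ge> - kcost p k m W - \<eta>" by (rule tendsto_lowerbound[OF L]) simp
  then show "L > - rel_entropy p r" using \<eta> by (simp add: \<eta>_def field_simps)
qed

text \<open>Two boxes suffice for all \<open>s\<close>. The box of a single vertex contains no edge
  and has expected count \<open>s\<close>, which is enough unless
  \<open>s < 1 / (2 * n ^ k)\<close>. For such \<open>s\<close> the full box expects at most
  \<open>1/2\<close> but contains at least one edge tuple, since the graph has an edge.\<close>

lemma INF_cut_dist_ge: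
  assumes E: "E \<subseteq> ksets n k" "E \<in> UT n" and n: "n > 0"
  shows "(INF s\<in>{0..1}. cut_dist k (graph n E) s) \<ge> 1 / (2 * (real n ^ k)\<^sup>2)"
proof (rule cINF_greatest)
  fix s :: real assume s: "s \<in> {0..1}"
  have nk: "real n ^ k \<ge> 1" using n by (simp add: one_le_power)
  let ?G = "skern n k (\<lambda>e. of_bool (e \<in> E))"
  have "E \<noteq> {}"
  proof
    assume "E = {}"
    then have "hdens n H ?G = 0" using hedges_nonempty
      by (auto simp: hdens_def skern_def prod_zero_iff card_gt_0_iff intro!: sum.neutral)
    then show False using E(2) hom_density_graph[OF E(1)] rH(1) by (simp add: UT_def)
  qed
  then obtain e where e: "e \<in> E" by blast
  show "1 / (2 * (real n ^ k)\<^sup>2) \<le> cut_dist k (graph n E) s"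
  proof (cases "s \<ge> 1 / (2 * real n ^ k)")
    case True
    have z: "tsum k (\<lambda>_. {0}) ?G = 0"
    proof -
      have "?G (mimg a {..<k}) = 0" if "a \<in> {..<k} \<rightarrow>\<^sub>E {0}" for a
      proof -
        have "a ` {..<k} \<subseteq> {0}" using that by auto
        then have "card (a ` {..<k}) \<le> 1" using card_mono[of "{0::nat}" "a ` {..<k}"] by simp
        then have "a ` {..<k} \<notin> ksets n k" using k2 by (auto simp: ksets_def)
        then show ?thesis by (simp add: skern_def set_mset_mimg)
      qed
      then show ?thesis unfolding tsum_def by (intro sum.neutral) auto
    qed
    have "tsum k (\<lambda>_. {0}) (\<lambda>_. s) = s" by (simp add: tsum_def card_PiE)
    then have "s / real n ^ k \<le> cut_dist k (graph n E) s"
      using cut_dist_ge[OF E(1), of "\<lambda>_. {0}" s] z s n by simp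
    moreover have "1 / (2 * (real n ^ k)\<^sup>2) \<le> s / real n ^ k"
      using divide_right_mono[OF True, of "real n ^ k"] nk by (simp add: power2_eq_square mult.assoc)
    ultimately show ?thesis by linarith
  next
    case False
    have "real (inj_tuples k) * 1 \<le> real (inj_tuples k) * (\<Sum>e\<in>ksets n k. of_bool (e \<in> E))"
    proof (rule mult_left_mono)
      have "of_bool (e \<in> E) \<le> (\<Sum>e\<in>ksets n k. of_bool (e \<in> E) :: real)"
        using e E(1) by (intro member_le_sum) auto
      then show "1 \<le> (\<Sum>e\<in>ksets n k. of_bool (e \<in> E) :: real)" using e by simp
    qed simp
    also have "\<dots> = tsum k (\<lambda>_. {..<n}) ?G" by (rule tsum_skern_full[symmetric])
    finally have "1 \<le> tsum k (\<lambda>_. {..<n}) ?G" using inj_tuples_pos[of k] by simp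
    moreover have "tsum k (\<lambda>_. {..<n}) (\<lambda>_. s) = s * real n ^ k" by (simp add: tsum_def card_PiE mult.commute)
    moreover have "s * real n ^ k \<le> 1 / 2"
    proof -
      have "s * real n ^ k \<le> 1 / (2 * real n ^ k) * real n ^ k" using False nk by (intro mult_right_mono) auto
      then show ?thesis using n by simp
    qed
    ultimately have "1 / 2 \<le> \<bar>tsum k (\<lambda>_. {..<n}) ?G - tsum k (\<lambda>_. {..<n}) (\<lambda>_. s)\<bar>" by linarith
    then have "1 / 2 / real n ^ k \<le> \<bar>tsum k (\<lambda>_. {..<n}) ?G - tsum k (\<lambda>_. {..<n}) (\<lambda>_. s)\<bar> / real n ^ k"
      using nk by (intro divide_right_mono) auto
    also have "\<dots> \<le> cut_dist k (graph n E) s" by (rule cut_dist_ge[OF E(1)]) simp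
    finally have "1 / 2 / real n ^ k \<le> cut_dist k (graph n E) s" .
    moreover have "1 / (2 * (real n ^ k)\<^sup>2) \<le> 1 / 2 / real n ^ k"
      using nk n by (simp add: divide_simps power2_eq_square)
    ultimately show ?thesis by linarith
  qed
qed simp

text \<open>The slack between \<open>\<epsilon>'\<close> and \<open>\<epsilon>\<close> takes the
  place of a constant attaining the infimum.\<close>

lemma near_const_subset:
  assumes "(INF s\<in>{0..1}. cut_dist k (graph n E) s) \<le> \<epsilon>'" "\<epsilon>' < \<epsilon>"
  shows "\<exists>s\<in>{0..1}. cut_dist k (graph n E) s \<le> \<epsilon>"
proof (rule ccontr)
  assume "\<not> ?thesis"
  then have "\<epsilon> \<le> (INF s\<in>{0..1}. cut_dist k (graph n E) s)"
    by (intro cINF_greatest) (auto simp: not_le less_imp_le)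
  then show False using assms by linarith
qed

lemma prob_UT: "\<P>(G in measure_pmf (random_hypergraph k n p). hom_density H G \<ge> r ^ card (hedges H)) = P n (UT n)"
  unfolding P_def UT_def using prob_random_hypergraph[of p k n] p0 p1 by simp

lemma cond_prob_UT:
  assumes "P n (UT n) > 0"
  shows "\<P>(G in measure_pmf (random_hypergraph k n p). X G \<bar> hom_density H G \<ge> r ^ card (hedges H))
    = 1 - P n (UT n \<inter> {E. \<not> X (graph n E)}) / P n (UT n)"
proof -
  have "\<P>(G in measure_pmf (random_hypergraph k n p). X G \<and> hom_density H G \<ge> r ^ card (hedges H))
      = P n {E. X (graph n E) \<and> hom_density H (graph n E) \<ge> r ^ card (hedges H)}"
    unfolding P_def using prob_random_hypergraph[of p k n] p0 p1 by simp
  also have "{E. X (graph n E) \<and> hom_density H (graph n E) \<ge> r ^ card (hedges H)} = UT n \<inter> {E. X (graph n E)}"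
    by (auto simp: UT_def)
  finally have 1: "\<P>(G in measure_pmf (random_hypergraph k n p). X G \<and> hom_density H G \<ge> r ^ card (hedges H))
      = P n (UT n \<inter> {E. X (graph n E)})" .
  have "P n (UT n) = P n (UT n \<inter> {E. X (graph n E)}) + P n (UT n \<inter> {E. \<not> X (graph n E)})"
    unfolding P_def bprob_def by (subst sum.union_disjoint[symmetric]) (auto intro!: sum.cong)
  then show ?thesis
    unfolding cond_prob_def 1 prob_UT using assms by (simp add: field_simps)
qed

text \<open>For a fixed \<open>n > 0\<close> the box of a single vertex shows that every graph has
  cut distance at least \<open>r / n ^ k\<close> from \<open>r\<close>, so a small
  \<open>\<epsilon>\<close> makes the bound fail at that \<open>n\<close>. Hence it is asserted for
  all large \<open>n\<close>.\<close>

lemma symmetric_phase: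
  assumes \<kappa>: "\<And>u. u \<in> {0..1} \<Longrightarrow> rel_entropy p u \<ge> rel_entropy p r + \<kappa> * (u ^ d - r ^ d)" and \<epsilon>: "\<epsilon> > 0"
  shows "\<exists>C>0. \<forall>\<^sub>F n in sequentially.
    \<P>(G in measure_pmf (random_hypergraph k n p). cut_dist k G r < \<epsilon> \<bar> hom_density H G \<ge> r ^ card (hedges H))
      \<ge> 1 - exp (- C * real n ^ k)"
proof -
  obtain c where c: "c > 0"
    "\<forall>\<^sub>F n in sequentially. P n (UT n \<inter> {E. cut_dist k (graph n E) r \<ge> \<epsilon>}) \<le> exp ((- rel_entropy p r - c) * N n)"
    using symmetric_bad[OF \<kappa> \<epsilon>] by blast
  obtain C where C: "C > 0"
    "\<forall>\<^sub>F n in sequentially. P n (UT n) > 0 \<and> P n (UT n \<inter> {E. cut_dist k (graph n E) r \<ge> \<epsilon>}) / P n (UT n) \<le> exp (- C * real n ^ k)"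
    using cond_exponential[OF rate_symmetric[OF \<kappa>] c] by blast
  show ?thesis
  proof (intro exI conjI)
    show "\<forall>\<^sub>F n in sequentially.
      \<P>(G in measure_pmf (random_hypergraph k n p). cut_dist k G r < \<epsilon> \<bar> hom_density H G \<ge> r ^ card (hedges H))
        \<ge> 1 - exp (- C * real n ^ k)"
      using C(2)
    proof eventually_elim
      case (elim n)
      then show ?case by (subst cond_prob_UT) (auto simp: not_less)
    qed
  qed (rule C(1))
qed

text \<open>Small \<open>n\<close> are absorbed into \<open>\<epsilon>\<close>: a graph in the upper tail has an edge and is therefore never
  at cut distance \<open>0\<close> from a constant.\<close>

lemma asymmetric_phase:
  assumes L: "rate \<longlonglongrightarrow> L" and gt: "L > - rel_entropy p r"
  shows "\<exists>\<epsilon>>0. \<exists>C>0. \<forall>n.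
    \<P>(G in measure_pmf (random_hypergraph k n p). hom_density H G \<ge> r ^ card (hedges H)) > 0 \<longrightarrow>
    \<P>(G in measure_pmf (random_hypergraph k n p). (INF s\<in>{0..1}. cut_dist k G s) > \<epsilon> \<bar> hom_density H G \<ge> r ^ card (hedges H))
      \<ge> 1 - exp (- C * real n ^ k)"
proof -
  \<comment> \<open>Half of the excess of \<open>L\<close> over \<open>- rel_entropy p r\<close>: a
    bound that is loosened by \<open>c\<close> from the constant exponent still stays
    \<open>c\<close> below \<open>L\<close>.\<close>
  define c where "c = (L + rel_entropy p r) / 2"
  have c: "c > 0" "- rel_entropy p r + c = L - c" using gt by (auto simp: c_def field_simps)
  let ?Near = "\<lambda>\<epsilon> n. {E. \<exists>s\<in>{0..1}. cut_dist k (graph n E) s \<le> \<epsilon>}"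
  obtain \<epsilon> where \<epsilon>: "\<epsilon> > 0" "\<forall>\<^sub>F n in sequentially. P n (UT n \<inter> ?Near \<epsilon> n) \<le> exp ((- rel_entropy p r + c) * N n)"
    using near_const_bad[OF c(1)] by blast
  obtain C where C: "C > 0"
    "\<forall>\<^sub>F n in sequentially. P n (UT n) > 0 \<and> P n (UT n \<inter> ?Near \<epsilon> n) / P n (UT n) \<le> exp (- C * real n ^ k)"
    using cond_exponential[OF L c(1) \<epsilon>(2)[unfolded c(2)]] by blast
  then obtain n0 where n0: "\<And>n. n \<ge> n0 \<Longrightarrow> P n (UT n \<inter> ?Near \<epsilon> n) / P n (UT n) \<le> exp (- C * real n ^ k)"
    by (auto simp: eventually_sequentially)
  \<comment> \<open>The second term is half of the bound of \<open>INF_cut_dist_ge\<close> at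
    \<open>Suc n0\<close>, hence strictly below the distance for every \<open>n < n0\<close> that
    matters.\<close>
  define \<epsilon>' where "\<epsilon>' = min (\<epsilon> / 2) (1 / (4 * (real (Suc n0) ^ k)\<^sup>2))"
  have \<epsilon>': "\<epsilon>' > 0" "\<epsilon>' < \<epsilon>" using \<epsilon>(1) by (auto simp: \<epsilon>'_def)
  show ?thesis
  proof (intro exI conjI allI impI)
    show "\<epsilon>' > 0" "C > 0" by (rule \<epsilon>' C)+
    fix n
    assume "\<P>(G in measure_pmf (random_hypergraph k n p). hom_density H G \<ge> r ^ card (hedges H)) > 0"
    then have pos: "P n (UT n) > 0" by (simp only: prob_UT)
    let ?B = "{E. \<not> (INF s\<in>{0..1}. cut_dist k (graph n E) s) > \<epsilon>'}"
    have "P n (UT n \<inter> ?B) / P n (UT n) \<le> exp (- C * real n ^ k)"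
    proof (cases "n \<ge> n0")
      case True
      have "P n (UT n \<inter> ?B) \<le> P n (UT n \<inter> ?Near \<epsilon> n)"
        by (rule P_mono) (use near_const_subset[OF _ \<epsilon>'(2)] in \<open>auto simp: not_less\<close>)
      then have "P n (UT n \<inter> ?B) / P n (UT n) \<le> P n (UT n \<inter> ?Near \<epsilon> n) / P n (UT n)"
        using pos by (intro divide_right_mono) auto
      then show ?thesis using n0[OF True] by linarith
    next
      case False
      have none: "E \<notin> ?B" if E: "E \<subseteq> ksets n k" "E \<in> UT n" for E
      proof -
        have n: "n > 0"
        proof (rule ccontr)
          assume "\<not> n > 0"
          have "hom_density H (graph n E) = 0"
            using \<open>\<not> n > 0\<close> ne by (simp add: hom_density_def graph_def card_gt_0_iff)
          then show False using E(2) rH(1) by (simp add: UT_def)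
        qed
        have "(real n ^ k)\<^sup>2 \<le> (real (Suc n0) ^ k)\<^sup>2" using False by (intro power_mono) auto
        then have "1 / (4 * (real (Suc n0) ^ k)\<^sup>2) \<le> 1 / (4 * (real n ^ k)\<^sup>2)"
          using n by (intro divide_left_mono) auto
        also have "\<dots> < 1 / (2 * (real n ^ k)\<^sup>2)" using n by (simp add: divide_simps)
        also have "\<dots> \<le> (INF s\<in>{0..1}. cut_dist k (graph n E) s)" by (rule INF_cut_dist_ge[OF E n])
        finally show ?thesis by (auto simp: \<epsilon>'_def)
      qed
      have "Pow (ksets n k) \<inter> (UT n \<inter> ?B) = {}" using none by blast
      then have "P n (UT n \<inter> ?B) = 0" unfolding P_def bprob_def by simp
      then show ?thesis by simp
    qed
    then show "\<P>(G in measure_pmf (random_hypergraph k n p). (INF s\<in>{0..1}. cut_dist k G s) > \<epsilon>' \<bar> hom_density H G \<ge> r ^ card (hedges H))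
        \<ge> 1 - exp (- C * real n ^ k)"
      by (subst cond_prob_UT[OF pos]) simp
  qed
qed

end

text \<open>The premise of positive probability in the second case excludes those small
  \<open>n\<close> for which no graph reaches the threshold: there the conditional probability is
  \<open>0\<close> by the convention on division, and for \<open>n > 0\<close> the bound would
  fail.\<close>

theorem theorem5p1:
  fixes d k :: nat and p r :: real and H :: "'v hypergraph"
  assumes "d \<ge> 2" and "k \<ge> 2" and "0 < p" and "p \<le> r" and "r < 1"
    and "verts H \<noteq> {}"
    and "uniform_hypergraph k H" and "regular_hypergraph d H" and "linear_hypergraph H"
  defines "upper_tail \<equiv> \<lambda>G :: nat hypergraph. hom_density H G \<ge> r ^ card (hedges H)"
    and "\<mu> \<equiv> \<lambda>n. measure_pmf (random_hypergraph k n p)"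
    and "on_minorant \<equiv>
           convex_minorant (\<lambda>x. rel_entropy p (root d x)) (r ^ d) = rel_entropy p r"
  shows
    "(on_minorant \<longrightarrow>
        (\<lambda>n. ln \<P>(G in \<mu> n. upper_tail G) / real (n choose k)) \<longlonglongrightarrow> - rel_entropy p r \<and>
        (\<forall>\<epsilon>>0. \<exists>C>0. \<forall>\<^sub>F n in sequentially.
           \<P>(G in \<mu> n. cut_dist k G r < \<epsilon> \<bar> upper_tail G) \<ge> 1 - exp (- C * real n ^ k)))
     \<and> (\<not> on_minorant \<longrightarrow>
        (\<exists>L. (\<lambda>n. ln \<P>(G in \<mu> n. upper_tail G) / real (n choose k)) \<longlonglongrightarrow> L \<and>
             L > - rel_entropy p r) \<and>
        (\<exists>\<epsilon>>0. \<exists>C>0. \<forall>n. \<P>(G in \<mu> n. upper_tail G) > 0 \<longrightarrow>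
           \<P>(G in \<mu> n. (INF s\<in>{0..1}. cut_dist k G s) > \<epsilon> \<bar> upper_tail G)
             \<ge> 1 - exp (- C * real n ^ k)))
     \<and> (d = 2 \<longrightarrow> (\<not> on_minorant \<longleftrightarrow> p < inverse (1 + threshold_base r)))"
proof -
  interpret tail_setup k H d p r
    by unfold_locales (use assms(1-9) in auto)
  have rate: "(\<lambda>n. ln \<P>(G in \<mu> n. upper_tail G) / real (n choose k)) = rate"
    unfolding \<mu>_def upper_tail_def prob_UT rate_def[abs_def] ..
  have iff: "on_minorant \<longleftrightarrow> (\<exists>\<kappa>. \<forall>u\<in>{0..1}. rel_entropy p u \<ge> rel_entropy p r + \<kappa> * (u ^ d - r ^ d))"
    unfolding on_minorant_def by (rule on_convex_minorant_iff) (use assms(1) p0 p1 r0 r1 in auto)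
  obtain L where L: "rate \<longlonglongrightarrow> L" by (rule rate_convergent)
  show ?thesis
  proof (intro conjI impI allI)
    assume on_minorant
    then obtain \<kappa> where \<kappa>: "\<And>u. u \<in> {0..1} \<Longrightarrow> rel_entropy p u \<ge> rel_entropy p r + \<kappa> * (u ^ d - r ^ d)"
      unfolding iff by blast
    show "(\<lambda>n. ln \<P>(G in \<mu> n. upper_tail G) / real (n choose k)) \<longlonglongrightarrow> - rel_entropy p r"
      unfolding rate by (rule rate_symmetric[OF \<kappa>])
    show "\<exists>C>0. \<forall>\<^sub>F n in sequentially.
        \<P>(G in \<mu> n. cut_dist k G r < \<epsilon> \<bar> upper_tail G) \<ge> 1 - exp (- C * real n ^ k)" if "\<epsilon> > 0" for \<epsilon>
      unfolding \<mu>_def upper_tail_def by (rule symmetric_phase[OF \<kappa> that])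
  next
    assume "\<not> on_minorant"
    then have gt: "L > - rel_entropy p r" unfolding iff by (rule rate_asymmetric[OF _ L])
    show "\<exists>L. (\<lambda>n. ln \<P>(G in \<mu> n. upper_tail G) / real (n choose k)) \<longlonglongrightarrow> L \<and> L > - rel_entropy p r"
      unfolding rate using L gt by blast
    show "\<exists>\<epsilon>>0. \<exists>C>0. \<forall>n. \<P>(G in \<mu> n. upper_tail G) > 0 \<longrightarrow>
        \<P>(G in \<mu> n. (INF s\<in>{0..1}. cut_dist k G s) > \<epsilon> \<bar> upper_tail G) \<ge> 1 - exp (- C * real n ^ k)"
      unfolding \<mu>_def upper_tail_def by (rule asymmetric_phase[OF L gt])
  next
    assume "d = 2"
    then show "\<not> on_minorant \<longleftrightarrow> p < inverse (1 + threshold_base r)"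
      unfolding iff using minorant_quadratic_iff[OF p0 pr r1] by auto
  qed
qed

end
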